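(* Let $P$ be the $K$-subalgebra of $K[T_3]^{\mathrm{SO}_3(K)}$ generated by $\mathrm{tr}(t_1^2),\mathrm{tr}(t_2^2),\mathrm{tr}(t_3^2),\mathrm{tr}(t_1t_2),\mathrm{tr}(t_1t_3),\mathrm{tr}(t_2t_3)$. Put $e_{ij}=\mathrm{tr}(t_it_js)$ ($1\le i\le j\le3$), $e_{iij}=\mathrm{tr}([t_i^2,t_j]s)$ ($i\ne j\in\{1,2,3\}$), $e_{132}=\mathrm{tr}([t_1t_3+t_3t_1,t_2]s)$, $e_{123}=\mathrm{tr}([t_1t_2+t_2t_1,t_3]s)$. (i) As a $P$-module, $C_3$ is generated by $\{e_{iij},e_{132},e_{123},e_{kl}\mid i\ne j\in\{1,2,3\},\ 1\le k\le l\le3\}$, and $C_3=C_3^{(0)}\oplus C_3^{(1)}$ with $C_3^{(0)}=P\cdot\langle e_{11}\rangle_{\mathrm{GL}_3(K)}$ and $C_3^{(1)}=P\cdot\langle e_{112}\rangle_{\mathrm{GL}_3(K)}$. (ii) $C_3^{(0)}$ has the free resolution $0\to P\xrightarrow{\psi^{(0)}}P^{\oplus6}\xrightarrow{\varphi^{(0)}}C_3^{(0)}\to0$, where with standard generators $e_1,\dots,e_6$ of $P^{\oplus 6}$, $\varphi^{(0)}:e_1\mapsto e_{11},e_2\mapsto e_{12},e_3\mapsto e_{13},e_4\mapsto e_{22},e_5\mapsto e_{23},e_6\mapsto e_{33}$, and $\psi^{(0)}$ maps $1\in P$ to the column vector \[\Big(\tfrac12(\mathrm{tr}(t_2^2)\mathrm{tr}(t_3^2)-\mathrm{tr}(t_2t_3)^2),\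 \mathrm{tr}(t_1t_3)\mathrm{tr}(t_2t_3)-\mathrm{tr}(t_1t_2)\mathrm{tr}(t_3^2),\ \mathrm{tr}(t_1t_2)\mathrm{tr}(t_2t_3)-\mathrm{tr}(t_1t_3)\mathrm{tr}(t_2^2),\ \tfrac12(\mathrm{tr}(t_1^2)\mathrm{tr}(t_3^2)-\mathrm{tr}(t_1t_3)^2),\ \mathrm{tr}(t_1t_2)\mathrm{tr}(t_1t_3)-\mathrm{tr}(t_1^2)\mathrm{tr}(t_2t_3),\ \tfrac12(\mathrm{tr}(t_1^2)\mathrm{tr}(t_2^2)-\mathrm{tr}(t_1t_2)^2)\Big)^T.\] (iii) $C_3^{(1)}$ has the free resolution $0\to P^{\oplus3}\xrightarrow{\psi^{(1)}}P^{\oplus8}\xrightarrow{\varphi^{(1)}}C_3^{(1)}\to0$, where with standard generators $e_1,\dots,e_8$ of $P^{\oplus 8}$, $\varphi^{(1)}:e_1\mapsto e_{112},e_2\mapsto e_{221},e_3\mapsto e_{113},e_4\mapsto e_{331},e_5\mapsto e_{223},e_6\mapsto e_{332},e_7\mapsto e_{132},e_8\mapsto e_{123}$, and $\psi^{(1)}$ is given by the $8\times3$ matrix with rows \[(\mathrm{tr}(t_2t_3),0,-\mathrm{tr}(t_3^2)),\ (\mathrm{tr}(t_1t_3),-\mathrm{tr}(t_3^2),0),\ (-\mathrm{tr}(t_2^2),0,\mathrm{tr}(t_2t_3)),\ (0,-\mathrm{tr}(t_2^2),\mathrm{tr}(t_1t_2)),\] \[(-\mathrm{tr}(t_1^2),\mathrm{tr}(t_1t_3),0),\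 (0,\mathrm{tr}(t_1t_2),-\mathrm{tr}(t_1^2)),\ (0,-\mathrm{tr}(t_2t_3),\mathrm{tr}(t_1t_3)),\ (\mathrm{tr}(t_1t_2),-\mathrm{tr}(t_2t_3),0).\]
   Context: $K$ is a field of characteristic $0$; $so_3(K)$ is the space of $3\times3$ skew-symmetric matrices. $T_3=\{t^{(k)}_{ij}\mid 1\le i<j\le 3,\ k=1,2,3\}$ are commuting indeterminates, $t_k$ the generic skew-symmetric matrix with $(i,j)$ entry $t^{(k)}_{ij}$ and $(j,i)$ entry $-t^{(k)}_{ij}$ ($i<j$), zero diagonal. $Z=\{z_{ij}\mid1\le i,j\le3\}$ are further indeterminates; $K[T_3,Z]$ is the coordinate ring of $so_3(K)^{\oplus3}\oplus M_3(K)$ with $\mathrm{SO}_3(K)$ acting by simultaneous conjugation. Let $s_{ij}=\frac12(z_{ij}+z_{ji})$ ($i\le j$), $s_{kk}=z_{kk}-\frac13(z_{11}+z_{22}+z_{33})$, and $s$ the symmetric trace-zero matrix with entries $s_{ij}$ on and above the diagonal. $C_3$ is the space of $\mathrm{SO}_3(K)$-invariant polynomials in $K[T_3][s_{ij}]$ of total degree one in the $s_{ij}$; it is a module over $K[T_3]^{\mathrm{SO}_3(K)}$, hence over $P$. $\mathrm{GL}_3(K)$ acts on $K[T_3,Z]$ by $g\cdot t^{(k)}_{ij}=\sum_l g_{lk}t^{(l)}_{ij}$, fixing the $z_{ij}$; $\langle U\rangle_{\mathrm{GL}_3(K)}$ is the submodule generated by $U$; $[a,b]=ab-ba$. *)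

theory Defs
  imports Main
begin

datatype ix = I1 | I2 | I3

text \<open>Positions (i,j) with i < j of a skew-symmetric 3x3 matrix.\<close>
datatype pr = P12 | P13 | P23

text \<open>The indeterminates: T k p is t^(k)_{ij} for p = (i,j), i<j; Z i j is z_{ij}.\<close>
datatype var = T ix pr | Z ix ix

text \<open>A point of so_3(K)^3 (+) M_3(K) is an assignment of values to the indeterminates.
  Elements of K[T_3,Z] are represented as polynomial functions on such points
  (K has characteristic 0, hence is infinite, so this is faithful).\<close>
type_synonym 'k pt = "var \<Rightarrow> 'k"
type_synonym 'k fn = "'k pt \<Rightarrow> 'k"

type_synonym 'k m3 = "ix \<Rightarrow> ix \<Rightarrow> 'k"

definition mmul :: "'k::comm_ring_1 m3 \<Rightarrow> 'k m3 \<Rightarrow> 'k m3" where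
  "mmul A B = (\<lambda>i j. A i I1 * B I1 j + A i I2 * B I2 j + A i I3 * B I3 j)"

definition madd :: "'k::comm_ring_1 m3 \<Rightarrow> 'k m3 \<Rightarrow> 'k m3" where
  "madd A B = (\<lambda>i j. A i j + B i j)"

definition mcomm :: "'k::comm_ring_1 m3 \<Rightarrow> 'k m3 \<Rightarrow> 'k m3" where
  "mcomm A B = (\<lambda>i j. mmul A B i j - mmul B A i j)"

definition mT :: "'k m3 \<Rightarrow> 'k m3" where
  "mT A = (\<lambda>i j. A j i)"

definition mid :: "'k::comm_ring_1 m3" where
  "mid = (\<lambda>i j. if i = j then 1 else 0)"

definition mtr :: "'k::comm_ring_1 m3 \<Rightarrow> 'k" where
  "mtr A = A I1 I1 + A I2 I2 + A I3 I3"

definition det3 :: "'k::comm_ring_1 m3 \<Rightarrow> 'k" where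
  "det3 g = g I1 I1 * (g I2 I2 * g I3 I3 - g I2 I3 * g I3 I2)
          - g I1 I2 * (g I2 I1 * g I3 I3 - g I2 I3 * g I3 I1)
          + g I1 I3 * (g I2 I1 * g I3 I2 - g I2 I2 * g I3 I1)"

definition SO3 :: "'k::comm_ring_1 m3 set" where
  "SO3 = {g. mmul (mT g) g = mid \<and> det3 g = 1}"

definition GL3 :: "'k::field m3 set" where
  "GL3 = {g. det3 g \<noteq> 0}"

definition tm :: "'k::comm_ring_1 pt \<Rightarrow> ix \<Rightarrow> 'k m3" where
  "tm x k = (\<lambda>i j. case (i, j) of
      (I1, I2) \<Rightarrow> x (T k P12) | (I2, I1) \<Rightarrow> - x (T k P12)
    | (I1, I3) \<Rightarrow> x (T k P13) | (I3, I1) \<Rightarrow> - x (T k P13)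
    | (I2, I3) \<Rightarrow> x (T k P23) | (I3, I2) \<Rightarrow> - x (T k P23)
    | _ \<Rightarrow> 0)"

definition zm :: "'k pt \<Rightarrow> 'k m3" where
  "zm x = (\<lambda>i j. x (Z i j))"

definition sm :: "'k::field_char_0 pt \<Rightarrow> 'k m3" where
  "sm x = (\<lambda>i j. if i = j then x (Z i i) - (x (Z I1 I1) + x (Z I2 I2) + x (Z I3 I3)) / 3
                 else (x (Z i j) + x (Z j i)) / 2)"

inductive_set alg :: "'k::comm_ring_1 fn set \<Rightarrow> 'k fn set" for S where
  gen: "f \<in> S \<Longrightarrow> f \<in> alg S"
| const: "(\<lambda>x. c) \<in> alg S"
| add: "f \<in> alg S \<Longrightarrow> g \<in> alg S \<Longrightarrow> (\<lambda>x. f x + g x) \<in> alg S"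
| mult: "f \<in> alg S \<Longrightarrow> g \<in> alg S \<Longrightarrow> (\<lambda>x. f x * g x) \<in> alg S"

definition KT :: "'k::comm_ring_1 fn set" where
  "KT = alg {(\<lambda>x. x (T k p)) | k p. True}"

definition act :: "'k::comm_ring_1 m3 \<Rightarrow> 'k pt \<Rightarrow> 'k pt" where
  "act g x v = (case v of
      T k p \<Rightarrow> (let M = mmul (mmul g (tm x k)) (mT g) in
                 (case p of P12 \<Rightarrow> M I1 I2 | P13 \<Rightarrow> M I1 I3 | P23 \<Rightarrow> M I2 I3))
    | Z i j \<Rightarrow> mmul (mmul g (zm x)) (mT g) i j)"

definition SO3_inv :: "'k::comm_ring_1 fn \<Rightarrow> bool" where
  "SO3_inv f \<longleftrightarrow> (\<forall>g \<in> SO3. \<forall>x. f (act g x) = f x)"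

text \<open>C_3: SO_3-invariant elements of K[T_3][s_ij] of total degree one in the s_ij,
  i.e. of the form sum_{i,j} c_ij s_ij with c_ij in K[T_3].\<close>
definition C3 :: "'k::field_char_0 fn set" where
  "C3 = {f. SO3_inv f \<and>
           (\<exists>c. (\<forall>i j. c i j \<in> KT) \<and>
                (\<forall>x. f x = (\<Sum>i\<in>{I1,I2,I3}. \<Sum>j\<in>{I1,I2,I3}. c i j x * sm x i j)))}"

definition trp :: "ix \<Rightarrow> ix \<Rightarrow> 'k::comm_ring_1 fn" where
  "trp i j = (\<lambda>x. mtr (mmul (tm x i) (tm x j)))"

definition P :: "'k::comm_ring_1 fn set" where
  "P = alg {trp I1 I1, trp I2 I2, trp I3 I3, trp I1 I2, trp I1 I3, trp I2 I3}"

definition pspan :: "'k::comm_ring_1 fn set \<Rightarrow> 'k fn set" where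
  "pspan G = {f. \<exists>n (p :: nat \<Rightarrow> 'k fn) g. (\<forall>i<n. p i \<in> P \<and> g i \<in> G) \<and>
                          f = (\<lambda>x. \<Sum>i<n. p i x * g i x)}"

text \<open>g . t^(k)_ij = sum_l g_lk t^(l)_ij, z fixed; extended as algebra automorphism,
  i.e. as substitution (g . f)(x) = f(glsub g x).\<close>
definition glsub :: "'k::comm_ring_1 m3 \<Rightarrow> 'k pt \<Rightarrow> 'k pt" where
  "glsub g x v = (case v of
      T k p \<Rightarrow> g I1 k * x (T I1 p) + g I2 k * x (T I2 p) + g I3 k * x (T I3 p)
    | Z i j \<Rightarrow> x (Z i j))"

definition glact :: "'k::comm_ring_1 m3 \<Rightarrow> 'k fn \<Rightarrow> 'k fn" where
  "glact g f = (\<lambda>x. f (glsub g x))"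

text \<open>P . <U>_{GL_3}: the P-module generated by the GL_3-orbit of U
  (the K-span of the orbit is contained in it since K is contained in P).\<close>
definition PGL :: "'k::field fn set \<Rightarrow> 'k fn set" where
  "PGL U = pspan {glact g u | g u. g \<in> GL3 \<and> u \<in> U}"

definition e2 :: "ix \<Rightarrow> ix \<Rightarrow> 'k::field_char_0 fn" where
  "e2 i j = (\<lambda>x. mtr (mmul (mmul (tm x i) (tm x j)) (sm x)))"

definition eiij :: "ix \<Rightarrow> ix \<Rightarrow> 'k::field_char_0 fn" where
  "eiij i j = (\<lambda>x. mtr (mmul (mcomm (mmul (tm x i) (tm x i)) (tm x j)) (sm x)))"

definition e132 :: "'k::field_char_0 fn" where
  "e132 = (\<lambda>x. mtr (mmul (mcomm (madd (mmul (tm x I1) (tm x I3)) (mmul (tm x I3) (tm x I1)))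
                                 (tm x I2)) (sm x)))"

definition e123 :: "'k::field_char_0 fn" where
  "e123 = (\<lambda>x. mtr (mmul (mcomm (madd (mmul (tm x I1) (tm x I2)) (mmul (tm x I2) (tm x I1)))
                                 (tm x I3)) (sm x)))"

definition E0 :: "'k::field_char_0 fn list" where
  "E0 = [e2 I1 I1, e2 I1 I2, e2 I1 I3, e2 I2 I2, e2 I2 I3, e2 I3 I3]"

definition E1 :: "'k::field_char_0 fn list" where
  "E1 = [eiij I1 I2, eiij I2 I1, eiij I1 I3, eiij I3 I1, eiij I2 I3, eiij I3 I2, e132, e123]"

definition C3_0 :: "'k::field_char_0 fn set" where
  "C3_0 = PGL {e2 I1 I1}"

definition C3_1 :: "'k::field_char_0 fn set" where
  "C3_1 = PGL {eiij I1 I2}"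

definition Pvec :: "nat \<Rightarrow> (nat \<Rightarrow> 'k::comm_ring_1 fn) set" where
  "Pvec n = {p. \<forall>i<n. p i \<in> P}"

definition phi :: "'k::comm_ring_1 fn list \<Rightarrow> (nat \<Rightarrow> 'k fn) \<Rightarrow> 'k fn" where
  "phi E p = (\<lambda>x. \<Sum>i<length E. p i x * (E ! i) x)"

definition psi0 :: "nat \<Rightarrow> 'k::field_char_0 fn" where
  "psi0 i = (\<lambda>x. [ (trp I2 I2 x * trp I3 I3 x - (trp I2 I3 x)^2) / 2,
                    trp I1 I3 x * trp I2 I3 x - trp I1 I2 x * trp I3 I3 x,
                    trp I1 I2 x * trp I2 I3 x - trp I1 I3 x * trp I2 I2 x,
                    (trp I1 I1 x * trp I3 I3 x - (trp I1 I3 x)^2) / 2,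
                    trp I1 I2 x * trp I1 I3 x - trp I1 I1 x * trp I2 I3 x,
                    (trp I1 I1 x * trp I2 I2 x - (trp I1 I2 x)^2) / 2 ] ! i)"

definition psi1 :: "nat \<Rightarrow> nat \<Rightarrow> 'k::field_char_0 fn" where
  "psi1 i j = (\<lambda>x. [ [trp I2 I3 x, 0, - trp I3 I3 x],
                      [trp I1 I3 x, - trp I3 I3 x, 0],
                      [- trp I2 I2 x, 0, trp I2 I3 x],
                      [0, - trp I2 I2 x, trp I1 I2 x],
                      [- trp I1 I1 x, trp I1 I3 x, 0],
                      [0, trp I1 I2 x, - trp I1 I1 x],
                      [0, - trp I2 I3 x, trp I1 I3 x],
                      [trp I1 I2 x, - trp I2 I3 x, 0] ] ! i ! j)"

end

theory Submission
  imports Defs "HOL-Computational_Algebra.Polynomial"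
begin

text \<open>
  Identify \<open>so\<^sub>3\<close> with \<open>K\<^sup>3\<close>, so that \<open>t\<^sub>k\<close> becomes a vector \<open>v\<^sub>k\<close>, \<open>tr(t\<^sub>i t\<^sub>j) = -2 v\<^sub>i \<cdot> v\<^sub>j\<close>,
  \<open>e\<^sub>i\<^sub>j = s(v\<^sub>i, v\<^sub>j)\<close> and \<open>e\<^sub>i\<^sub>i\<^sub>j = 2 s(v\<^sub>i, v\<^sub>i \<times> v\<^sub>j)\<close>.

  Generation: restricting an invariant \<open>f\<close> to \<open>z = u u\<^sup>T\<close> gives a polynomial invariant of the four vectors
  \<open>v\<^sub>1, v\<^sub>2, v\<^sub>3, u\<close>. Parametrise rotations by quaternions \<open>q\<close>: then \<open>|q|\<^sup>2\<^sup>D f\<close> is a sum of products of \<open>D\<close>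
  forms \<open>Re(a q x q\<^sup>*)\<close>. The Laplacian in \<open>q\<close> contracts such a product to products of \<open>D - 1\<close> forms with
  quaternion products of the \<open>x\<close> as new parameters, and it maps \<open>|q|\<^sup>2\<^sup>D\<close> to a nonzero multiple of
  \<open>|q|\<^sup>2\<^sup>D\<^sup>-\<^sup>2\<close>. Applying it \<open>D\<close> times (an algebraic Wick theorem in place of Haar integration) expresses
  \<open>f\<close> through scalar and triple products. The part quadratic in \<open>u\<close> is then read off, and trace-freeness
  of \<open>s\<close> together with vector identities reduces it to the listed generators.

  Exactness: \<open>P\<close> is a polynomial ring in the Gram entries. Evaluating a relation at well-chosen rank one
  \<open>z\<close> shows that its coefficients are proportional to the adjugate of the Gram matrix \<open>G\<close> (for \<open>C\<^sub>3\<^sup>(\<^sup>0\<^sup>)\<close>), or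
  form a matrix \<open>C\<close> with \<open>G C\<close> skew-symmetric (for \<open>C\<^sub>3\<^sup>(\<^sup>1\<^sup>)\<close>). Both systems are solved over \<open>P\<close> using that
  two principal 2-minors of \<open>G\<close>, and two distinct entries of \<open>G\<close>, are coprime.
\<close>

section \<open>The quaternionic Laplacian and algebraic averaging over rotations\<close>

subsection \<open>Quaternions\<close>

datatype 'a quat = Quat (qr: 'a) (qi: 'a) (qj: 'a) (qk: 'a)

instantiation quat :: (comm_ring_1) ring_1
begin

definition "0 = Quat 0 0 0 0"
definition "1 = Quat 1 0 0 0"
definition "x + y = Quat (qr x + qr y) (qi x + qi y) (qj x + qj y) (qk x + qk y)"
definition "x - y = Quat (qr x - qr y) (qi x - qi y) (qj x - qj y) (qk x - qk y)"
definition "- x = Quat (- qr x) (- qi x) (- qj x) (- qk x)"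
definition "x * y = Quat
   (qr x * qr y - qi x * qi y - qj x * qj y - qk x * qk y)
   (qr x * qi y + qi x * qr y + qj x * qk y - qk x * qj y)
   (qr x * qj y - qi x * qk y + qj x * qr y + qk x * qi y)
   (qr x * qk y + qi x * qj y - qj x * qi y + qk x * qr y)"

instance
  by standard
    (simp_all add: zero_quat_def one_quat_def plus_quat_def minus_quat_def uminus_quat_def
      times_quat_def algebra_simps)

end

lemma quat_sel [simp]:
  "qr (x + y) = qr x + qr y" "qi (x + y) = qi x + qi y"
  "qj (x + y) = qj x + qj y" "qk (x + y) = qk x + qk y"
  "qr (x - y) = qr x - qr y" "qi (x - y) = qi x - qi y"
  "qj (x - y) = qj x - qj y" "qk (x - y) = qk x - qk y"
  "qr (- x) = - qr x" "qi (- x) = - qi x" "qj (- x) = - qj x" "qk (- x) = - qk x"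
  "qr 0 = 0" "qi 0 = 0" "qj 0 = 0" "qk 0 = 0"
  "qr 1 = 1" "qi 1 = 0" "qj 1 = 0" "qk 1 = 0"
  by (simp_all add: plus_quat_def minus_quat_def uminus_quat_def zero_quat_def one_quat_def)

lemma quat_sel_times:
  "qr (x * y) = qr x * qr y - qi x * qi y - qj x * qj y - qk x * qk y"
  "qi (x * y) = qr x * qi y + qi x * qr y + qj x * qk y - qk x * qj y"
  "qj (x * y) = qr x * qj y - qi x * qk y + qj x * qr y + qk x * qi y"
  "qk (x * y) = qr x * qk y + qi x * qj y - qj x * qi y + qk x * qr y"
  by (simp_all add: times_quat_def)

definition qsc :: "'a::comm_ring_1 \<Rightarrow> 'a quat" where
  "qsc c = Quat c 0 0 0"

definition qcnj :: "'a::comm_ring_1 quat \<Rightarrow> 'a quat" where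
  "qcnj x = Quat (qr x) (- qi x) (- qj x) (- qk x)"

definition qn :: "'a::comm_ring_1 quat \<Rightarrow> 'a" where
  "qn x = qr x ^ 2 + qi x ^ 2 + qj x ^ 2 + qk x ^ 2"

lemma qsc_sel [simp]: "qr (qsc c) = c" "qi (qsc c) = 0" "qj (qsc c) = 0" "qk (qsc c) = 0"
  by (simp_all add: qsc_def)

lemma qcnj_sel [simp]:
  "qr (qcnj x) = qr x" "qi (qcnj x) = - qi x" "qj (qcnj x) = - qj x" "qk (qcnj x) = - qk x"
  by (simp_all add: qcnj_def)

lemma qcnj_add [simp]: "qcnj (x + y) = qcnj x + qcnj y"
  by (rule quat.expand) simp

lemma qcnj_mult [simp]: "qcnj (x * y) = qcnj y * qcnj x"
  by (rule quat.expand) (simp add: quat_sel_times algebra_simps)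

lemma qcnj_cnj [simp]: "qcnj (qcnj x) = x"
  by (rule quat.expand) simp

lemma qcnj_qsc [simp]: "qcnj (qsc c) = qsc c"
  by (rule quat.expand) simp

lemma qr_qsc_mult [simp]: "qr (qsc c * x) = c * qr x" "qr (x * qsc c) = c * qr x"
  by (simp_all add: quat_sel_times)

lemma qsc_comm: "x * qsc c = qsc c * x"
  by (rule quat.expand) (simp add: quat_sel_times)

lemma qr_mult_comm: "qr (x * y) = qr (y * x)"
  by (simp add: quat_sel_times algebra_simps)

definition qunits :: "'a::comm_ring_1 quat list" where
  "qunits = [Quat 1 0 0 0, Quat 0 1 0 0, Quat 0 0 1 0, Quat 0 0 0 1]"

text \<open>Contraction against an orthonormal basis: this is what makes the Laplacian act on
  products of the forms \<open>qform\<close> below by multiplying the quaternions they carry.\<close>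

lemma sum_qunits_pair:
  "(\<Sum>e\<leftarrow>qunits. qr (x * e) * qr (y * e)) = qr (x * qcnj y)"
  by (simp add: qunits_def quat_sel_times)

text \<open>Summing \<open>e * y * qcnj e\<close> over the basis leaves four times the real part of
  \<open>y\<close>, because the imaginary directions cancel.\<close>

lemma sum_qunits_single:
  "(\<Sum>e\<leftarrow>qunits. qr (x * e * y * qcnj e)) = 4 * qr x * qr y"
  by (simp add: qunits_def quat_sel_times algebra_simps)

subsection \<open>Taylor coefficients along lines\<close>

text \<open>Derivatives over an arbitrary field of characteristic 0 are read off from the
  restriction to a line, which avoids any notion of limit.\<close>

definition on_line :: "('a::field_char_0 quat \<Rightarrow> 'a) \<Rightarrow> 'a quat \<Rightarrow> 'a quat \<Rightarrow> 'a poly \<Rightarrow> bool" where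
  "on_line F q e p \<longleftrightarrow> (\<forall>t. F (q + qsc t * e) = poly p t)"

definition qpoly :: "('a::field_char_0 quat \<Rightarrow> 'a) \<Rightarrow> bool" where
  "qpoly F \<longleftrightarrow> (\<forall>q e. \<exists>p. on_line F q e p)"

text \<open>The \<open>n\<close>-th derivative in direction \<open>e\<close> divided by n
  factorial.\<close>

definition lcf :: "('a::field_char_0 quat \<Rightarrow> 'a) \<Rightarrow> 'a quat \<Rightarrow> 'a quat \<Rightarrow> nat \<Rightarrow> 'a" where
  "lcf F q e n = coeff (THE p. on_line F q e p) n"

lemma lcf_eq: "on_line F q e p \<Longrightarrow> lcf F q e n = coeff p n"
proof -
  assume a: "on_line F q e p"
  have "(THE p. on_line F q e p) = p"
  proof (rule the_equality)
    show "on_line F q e p" by (rule a)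
  next
    fix r assume "on_line F q e r"
    \<comment> \<open>The field is infinite, so a polynomial is determined by its values.\<close>
    with a have "poly r = poly p" by (auto simp: on_line_def)
    then show "r = p" by (simp add: poly_eq_poly_eq_iff)
  qed
  then show ?thesis by (simp add: lcf_def)
qed

lemma on_line_add: "on_line F q e p \<Longrightarrow> on_line G q e r \<Longrightarrow> on_line (\<lambda>q. F q + G q) q e (p + r)"
  by (simp add: on_line_def)

lemma on_line_mult: "on_line F q e p \<Longrightarrow> on_line G q e r \<Longrightarrow> on_line (\<lambda>q. F q * G q) q e (p * r)"
  by (simp add: on_line_def)

lemma on_line_const: "on_line (\<lambda>q. c) q e [:c:]"
  by (simp add: on_line_def)

lemma on_line_coeff0: "on_line F q e p \<Longrightarrow> coeff p 0 = F q"
proof -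
  assume "on_line F q e p"
  then have "F (q + qsc 0 * e) = poly p 0" unfolding on_line_def by blast
  moreover have "q + qsc 0 * e = q" by (rule quat.expand) (simp add: quat_sel_times)
  ultimately show ?thesis by (simp add: poly_0_coeff_0)
qed

lemma qpoly_add: "qpoly F \<Longrightarrow> qpoly G \<Longrightarrow> qpoly (\<lambda>q. F q + G q)"
  unfolding qpoly_def using on_line_add by blast

lemma qpoly_mult: "qpoly F \<Longrightarrow> qpoly G \<Longrightarrow> qpoly (\<lambda>q. F q * G q)"
  unfolding qpoly_def using on_line_mult by blast

lemma qpoly_const: "qpoly (\<lambda>q. c)"
  unfolding qpoly_def using on_line_const by blast

lemma lcf_const: "lcf (\<lambda>q. c) q e (Suc n) = 0"
  by (simp add: lcf_eq[OF on_line_const])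

lemma lcf_add:
  assumes "qpoly F" "qpoly G"
  shows "lcf (\<lambda>q. F q + G q) q e n = lcf F q e n + lcf G q e n"
proof -
  from assms obtain p r where p: "on_line F q e p" and r: "on_line G q e r"
    unfolding qpoly_def by blast
  show ?thesis by (simp add: lcf_eq[OF on_line_add[OF p r]] lcf_eq[OF p] lcf_eq[OF r])
qed

lemma lcf_mult:
  assumes "qpoly F" "qpoly G"
  shows "lcf (\<lambda>q. F q * G q) q e 1 = F q * lcf G q e 1 + lcf F q e 1 * G q" (is ?A)
    and "lcf (\<lambda>q. F q * G q) q e 2
      = F q * lcf G q e 2 + lcf F q e 1 * lcf G q e 1 + lcf F q e 2 * G q" (is ?B)
proof -
  from assms obtain p r where p: "on_line F q e p" and r: "on_line G q e r"
    unfolding qpoly_def by blast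
  note m = lcf_eq[OF on_line_mult[OF p r]] lcf_eq[OF p] lcf_eq[OF r]
    on_line_coeff0[OF p, symmetric] on_line_coeff0[OF r, symmetric]
  show ?A by (simp add: m coeff_mult)
  show ?B by (simp add: m coeff_mult numeral_2_eq_2)
qed

text \<open>Second Taylor coefficients carry a factor 1/2, so this is half of the usual Laplacian;
  in its product rule \<open>grd\<close> then has coefficient 1.\<close>

definition lap :: "('a::field_char_0 quat \<Rightarrow> 'a) \<Rightarrow> 'a quat \<Rightarrow> 'a" where
  "lap F q = (\<Sum>e\<leftarrow>qunits. lcf F q e 2)"

definition grd :: "('a::field_char_0 quat \<Rightarrow> 'a) \<Rightarrow> ('a quat \<Rightarrow> 'a) \<Rightarrow> 'a quat \<Rightarrow> 'a" where
  "grd F G q = (\<Sum>e\<leftarrow>qunits. lcf F q e 1 * lcf G q e 1)"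

lemma lap_const: "lap (\<lambda>q. c) q = 0"
  using lcf_const[of c q _ 1] by (simp add: lap_def qunits_def numeral_2_eq_2)

lemma lap_add: "qpoly F \<Longrightarrow> qpoly G \<Longrightarrow> lap (\<lambda>q. F q + G q) q = lap F q + lap G q"
  by (simp add: lap_def lcf_add qunits_def)

lemma lap_mult:
  "qpoly F \<Longrightarrow> qpoly G \<Longrightarrow> lap (\<lambda>q. F q * G q) q = F q * lap G q + grd F G q + lap F q * G q"
  by (simp add: lap_def grd_def lcf_mult qunits_def algebra_simps)

lemma grd_const: "grd F (\<lambda>q. c) q = 0"
  using lcf_const[of c q _ 0] by (simp add: grd_def qunits_def)

lemma grd_add:
  "qpoly G \<Longrightarrow> qpoly H \<Longrightarrow> grd F (\<lambda>q. G q + H q) q = grd F G q + grd F H q"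
  by (simp add: grd_def lcf_add qunits_def algebra_simps)

lemma grd_mult:
  "qpoly G \<Longrightarrow> qpoly H \<Longrightarrow> grd F (\<lambda>q. G q * H q) q = G q * grd F H q + grd F G q * H q"
  unfolding grd_def qunits_def by (simp add: lcf_mult(1)[simplified] algebra_simps)

text \<open>Coordinates of vectors rotated by \<open>q\<close> have this shape
  (\<open>mv_rot\<close>), and so does the norm of \<open>q\<close>
  (\<open>qform_one\<close>).\<close>

definition qform :: "'a::comm_ring_1 quat \<Rightarrow> 'a quat \<Rightarrow> 'a quat \<Rightarrow> 'a" where
  "qform A X q = qr (A * q * X * qcnj q)"

text \<open>A form is quadratic in \<open>q\<close>, hence quadratic along a line. Cyclicity and
  conjugation invariance of the real part move the direction \<open>e\<close> to the far right of
  the linear coefficient, where \<open>sum_qunits_pair\<close> can contract it.\<close>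

lemma qform_line:
  "on_line (qform A X) q e
    [: qform A X q, qr ((X * qcnj q * A + qcnj X * qcnj q * qcnj A) * e), qform A X e :]"
proof -
  have 1: "qr (A * q * X * qcnj e) = qr (qcnj X * qcnj q * qcnj A * e)"
  proof -
    have "qr (A * q * X * qcnj e) = qr (qcnj (A * q * X * qcnj e))" by (simp only: qcnj_sel)
    also have "\<dots> = qr (e * (qcnj X * qcnj q * qcnj A))"
      by (simp only: qcnj_mult qcnj_cnj mult.assoc)
    finally show ?thesis by (metis qr_mult_comm)
  qed
  have 2: "qr (A * e * X * qcnj q) = qr (X * qcnj q * A * e)"
  proof -
    have "qr (A * e * X * qcnj q) = qr ((A * e) * (X * qcnj q))" by (simp add: mult.assoc)
    also have "\<dots> = qr ((X * qcnj q) * (A * e))" by (rule qr_mult_comm)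
    finally show ?thesis by (simp add: mult.assoc)
  qed
  have *: "qform A X (q + qsc t * e) = qform A X q
    + t * (qr (A * e * X * qcnj q) + qr (A * q * X * qcnj e)) + t * (t * qform A X e)" for t
  proof -
    have a: "A * (qsc t * e) = qsc t * (A * e)" by (metis mult.assoc qsc_comm)
    have "A * (q + qsc t * e) * X * qcnj (q + qsc t * e)
      = A * q * X * qcnj q + qsc t * (A * e * X * qcnj q) + (A * q * X * qcnj e) * qsc t
        + qsc t * ((A * e * X * qcnj e) * qsc t)"
      unfolding qcnj_add qcnj_mult qcnj_qsc distrib_left distrib_right a
      by (simp add: mult.assoc add_ac)
    then show ?thesis unfolding qform_def by (simp add: distrib_left)
  qed
  have b: "qr ((X * qcnj q * A + qcnj X * qcnj q * qcnj A) * e)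
    = qr (A * e * X * qcnj q) + qr (A * q * X * qcnj e)"
    by (simp add: 1 2 distrib_right)
  show ?thesis unfolding on_line_def b * by (simp add: distrib_left)
qed

lemma qpoly_qform: "qpoly (qform A X)"
  unfolding qpoly_def using qform_line by blast

lemma lap_qform: "lap (qform A X) q = 4 * qr A * qr X"
  using sum_qunits_single[of A X] unfolding lap_def qform_def[symmetric]
  by (simp add: lcf_eq[OF qform_line] numeral_2_eq_2)

text \<open>The Wick contraction: two forms merge into a sum of single forms whose parameters are
  products of the old ones and their conjugates. The two summands of each linear coefficient account
  for the four terms.\<close>

lemma grd_qform:
  "grd (qform A X) (qform B Y) q
   = qform (A * qcnj B) (qcnj Y * X) q + qform (A * B) (Y * X) q
   + qform (qcnj A * qcnj B) (qcnj Y * qcnj X) q + qform (qcnj A * B) (Y * qcnj X) q"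
proof -
  have "grd (qform A X) (qform B Y) q = qr ((X * qcnj q * A + qcnj X * qcnj q * qcnj A)
      * qcnj (Y * qcnj q * B + qcnj Y * qcnj q * qcnj B))"
    unfolding grd_def sum_qunits_pair[symmetric] by (simp add: lcf_eq[OF qform_line])
  also have "\<dots> = qr (X * qcnj q * A * qcnj B * q * qcnj Y) + qr (X * qcnj q * A * B * q * Y)
    + qr (qcnj X * qcnj q * qcnj A * qcnj B * q * qcnj Y) + qr (qcnj X * qcnj q * qcnj A * B * q * Y)"
    by (simp add: distrib_left distrib_right mult.assoc)
  also have "\<dots> = qform (A * qcnj B) (qcnj Y * X) q + qform (A * B) (Y * X) q
   + qform (qcnj A * qcnj B) (qcnj Y * qcnj X) q + qform (qcnj A * B) (Y * qcnj X) q"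
  proof -
    have "qr (X * qcnj q * C * D * q * Z) = qform (C * D) (Z * X) q" for X Z C D :: "'a quat"
    proof -
      have "qr (X * qcnj q * C * D * q * Z) = qr ((X * qcnj q) * (C * D * q * Z))"
        by (simp add: mult.assoc)
      also have "\<dots> = qr ((C * D * q * Z) * (X * qcnj q))" by (rule qr_mult_comm)
      finally show ?thesis by (simp add: qform_def mult.assoc)
    qed
    then show ?thesis by simp
  qed
  finally show ?thesis .
qed

lemma qform_one: "qform 1 1 q = qn q"
  by (simp add: qform_def qn_def quat_sel_times power2_eq_square)

lemma qpoly_qn: "qpoly qn"
  using qpoly_qform[of 1 1] by (simp add: qform_one[abs_def])

lemma qpoly_qn_pow: "qpoly (\<lambda>q. qn q ^ n)"
  by (induction n) (simp_all add: qpoly_const qpoly_mult qpoly_qn)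

lemma lap_qn: "lap qn q = 4"
  using lap_qform[of 1 1 q] by (simp add: qform_one[abs_def])

lemma grd_qn: "grd qn qn q = 4 * qn q"
proof -
  have "qcnj 1 = (1::'a quat)" by (rule quat.expand) simp
  then show ?thesis using grd_qform[of 1 1 1 1 q] by (simp add: qform_one[abs_def] qform_one)
qed

lemma grd_qn_pow: "grd qn (\<lambda>q. qn q ^ n) q = 4 * of_nat n * qn q ^ n"
  by (induction n) (simp_all add: grd_const grd_mult qpoly_qn qpoly_qn_pow grd_qn algebra_simps)

text \<open>The factor is nonzero in characteristic 0, so the Laplacian can be used to strip off
  powers of the norm one by one.\<close>

lemma lap_qn_pow: "lap (\<lambda>q. qn q ^ Suc n) q = 2 * of_nat (Suc n) * of_nat (n + 2) * qn q ^ n"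
proof (induction n)
  case 0
  show ?case by (simp add: lap_qn)
next
  case (Suc n)
  have "lap (\<lambda>q. qn q ^ Suc (Suc n)) q = lap (\<lambda>q. qn q * qn q ^ Suc n) q" by simp
  also have "\<dots> = qn q * lap (\<lambda>q. qn q ^ Suc n) q + grd qn (\<lambda>q. qn q ^ Suc n) q + lap qn q * qn q ^ Suc n"
    by (rule lap_mult[OF qpoly_qn qpoly_qn_pow])
  finally show ?case unfolding Suc lap_qn grd_qn_pow by (simp add: algebra_simps)
qed

subsection \<open>Averaging over rotations\<close>

text \<open>Level \<open>n\<close> consists of sums of products of \<open>n\<close> forms with a
  scalar from \<open>R\<close>. The left parameter \<open>A\<close> is any constant quaternion,
  while the right one may depend on the point \<open>y\<close>. Fixing the number of forms gives
  homogeneity of degree \<open>2 n\<close> in \<open>q\<close>.\<close>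

inductive wick :: "('y \<Rightarrow> 'a::field_char_0) set \<Rightarrow> ('y \<Rightarrow> 'a quat) set \<Rightarrow> nat
    \<Rightarrow> ('a quat \<Rightarrow> 'y \<Rightarrow> 'a) \<Rightarrow> bool"
  for R Q where
  base: "r \<in> R \<Longrightarrow> wick R Q 0 (\<lambda>q y. r y)"
| form: "wick R Q n F \<Longrightarrow> X \<in> Q \<Longrightarrow> wick R Q (Suc n) (\<lambda>q y. qform A (X y) q * F q y)"
| add: "wick R Q n F \<Longrightarrow> wick R Q n G \<Longrightarrow> wick R Q n (\<lambda>q y. F q y + G q y)"

text \<open>Closure under what contraction produces: \<open>grd_qform\<close> multiplies and
  conjugates parameters, and \<open>lap_qform\<close> turns real parts into scalars. The parameter 1
  makes powers of the norm available.\<close>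

locale wick_ring =
  fixes R :: "('y \<Rightarrow> 'a::field_char_0) set" and Q :: "('y \<Rightarrow> 'a quat) set"
  assumes R_const: "(\<lambda>y. c) \<in> R"
    and R_add: "f \<in> R \<Longrightarrow> g \<in> R \<Longrightarrow> (\<lambda>y. f y + g y) \<in> R"
    and R_mult: "f \<in> R \<Longrightarrow> g \<in> R \<Longrightarrow> (\<lambda>y. f y * g y) \<in> R"
    and Q_one: "(\<lambda>y. 1) \<in> Q"
    and Q_mult: "X \<in> Q \<Longrightarrow> Y \<in> Q \<Longrightarrow> (\<lambda>y. X y * Y y) \<in> Q"
    and Q_cnj: "X \<in> Q \<Longrightarrow> (\<lambda>y. qcnj (X y)) \<in> Q"
    and Q_qr: "X \<in> Q \<Longrightarrow> (\<lambda>y. qr (X y)) \<in> R"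
begin

abbreviation W where "W \<equiv> wick R Q"

lemma W_qpoly: "W n F \<Longrightarrow> qpoly (\<lambda>q. F q y)"
  by (induction rule: wick.induct) (simp_all add: qpoly_const qpoly_add qpoly_mult qpoly_qform)

lemma W_scale: "W n F \<Longrightarrow> r \<in> R \<Longrightarrow> W n (\<lambda>q y. r y * F q y)"
proof (induction rule: wick.induct)
  case (base s)
  then show ?case using wick.base[OF R_mult[of r s]] by simp
next
  case (form n F X A)
  then show ?case using wick.form[of R Q n "\<lambda>q y. r y * F q y" X A] by (simp add: algebra_simps)
next
  case (add n F G)
  then show ?case using wick.add[of R Q n "\<lambda>q y. r y * F q y" "\<lambda>q y. r y * G q y"]
    by (simp add: algebra_simps)
qed

lemma W_zero: "W n (\<lambda>q y. 0)"
proof (induction n)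
  case 0
  show ?case using wick.base[OF R_const] by simp
next
  case (Suc n)
  show ?case using wick.form[OF Suc Q_one] by simp
qed

lemma W_mult: "W n F \<Longrightarrow> W m G \<Longrightarrow> W (n + m) (\<lambda>q y. F q y * G q y)"
proof (induction rule: wick.induct)
  case (base s)
  then show ?case using W_scale by simp
next
  case (form n F X A)
  then show ?case using wick.form[of R Q "n+m" "\<lambda>q y. F q y * G q y" X A] by (simp add: algebra_simps)
next
  case (add n F H)
  then show ?case using wick.add[of R Q "n+m" "\<lambda>q y. F q y * G q y" "\<lambda>q y. H q y * G q y"]
    by (simp add: algebra_simps)
qed

lemma W_const: "W 0 F \<Longrightarrow> \<exists>r\<in>R. F = (\<lambda>q y. r y)"
proof (induction "0::nat" F rule: wick.induct)
  case (add F G)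
  then obtain r s where "r \<in> R" "s \<in> R" "F = (\<lambda>q y. r y)" "G = (\<lambda>q y. s y)" by blast
  then show ?case using R_add[of r s] by auto
qed auto

lemma W_grd_form:
  assumes "X \<in> Q" "Y \<in> Q" and F: "W n F"
  shows "W (Suc n) (\<lambda>q y. grd (qform A (X y)) (qform B (Y y)) q * F q y)"
  unfolding grd_qform distrib_right
  by (intro wick.add wick.form F Q_mult Q_cnj assms(1,2))

text \<open>By the product rule the gradient meets one of the \<open>n\<close> forms at a time and
  merges with it through \<open>grd_qform\<close>; the number of forms drops from
  \<open>n + 1\<close> to \<open>n\<close>.\<close>

lemma W_grd: "W n F \<Longrightarrow> X \<in> Q \<Longrightarrow> W n (\<lambda>q y. grd (qform A (X y)) (\<lambda>q. F q y) q)"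
proof (induction rule: wick.induct)
  case (base r)
  show ?case using W_zero by (simp add: grd_const)
next
  case (form n F Y B)
  have "grd (qform A (X y)) (\<lambda>q. qform B (Y y) q * F q y) q
    = qform B (Y y) q * grd (qform A (X y)) (\<lambda>q. F q y) q
      + grd (qform A (X y)) (qform B (Y y)) q * F q y" for q y
    by (rule grd_mult[OF qpoly_qform W_qpoly[OF form(1)]])
  then show ?case
    using wick.add[OF wick.form[OF form.IH[OF form.prems] form.hyps(2)]
       W_grd_form[OF form.prems form.hyps(2) form.hyps(1)]] by simp
next
  case (add n F G)
  then show ?case by (simp add: grd_add W_qpoly wick.add)
qed

text \<open>The Laplacian either hits a single form, leaving a scalar, or a pair of forms, leaving
  one; both ways one form is lost. Level 0 has no predecessor, so there the induction carries the
  vanishing of the Laplacian instead.\<close>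

lemma W_lap_aux: "W n F \<Longrightarrow> (n = 0 \<longrightarrow> (\<lambda>q y. lap (\<lambda>q. F q y) q) = (\<lambda>q y. 0)) \<and>
    (\<forall>m. n = Suc m \<longrightarrow> W m (\<lambda>q y. lap (\<lambda>q. F q y) q))"
proof (induction rule: wick.induct)
  case (base r)
  show ?case by (simp add: lap_const)
next
  case (form n F X A)
  have eq: "lap (\<lambda>q. qform A (X y) q * F q y) q = qform A (X y) q * lap (\<lambda>q. F q y) q
      + (grd (qform A (X y)) (\<lambda>q. F q y) q + 4 * qr A * qr (X y) * F q y)" for q y
    by (subst lap_mult[OF qpoly_qform W_qpoly[OF form(1)]]) (simp add: lap_qform)
  have 1: "W n (\<lambda>q y. qform A (X y) q * lap (\<lambda>q. F q y) q)"
  proof (cases n)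
    case 0
    then have "(\<lambda>q y. lap (\<lambda>q. F q y) q) = (\<lambda>q y. 0)" using form.IH by blast
    then have "lap (\<lambda>q. F q y) q = 0" for q y by (rule fun_cong[THEN fun_cong])
    then show ?thesis using W_zero by simp
  next
    case (Suc m)
    then have "W m (\<lambda>q y. lap (\<lambda>q. F q y) q)" using form.IH by blast
    from wick.form[OF this form.hyps(2), of A] show ?thesis using Suc by simp
  qed
  have 2: "W n (\<lambda>q y. 4 * qr A * qr (X y) * F q y)"
    using W_scale[OF form.hyps(1) R_mult[OF R_const[of "4 * qr A"] Q_qr[OF form.hyps(2)]]]
    by simp
  show ?case unfolding eq using wick.add[OF 1 wick.add[OF W_grd[OF form.hyps(1,2)] 2]] by auto
next
  case (add n F G)
  have eq: "lap (\<lambda>q. F q y + G q y) q = lap (\<lambda>q. F q y) q + lap (\<lambda>q. G q y) q" for q y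
    by (rule lap_add[OF W_qpoly[OF add(1)] W_qpoly[OF add(2)]])
  show ?case unfolding eq
  proof (intro conjI impI allI)
    assume "n = 0"
    then have "(\<lambda>q y. lap (\<lambda>q. F q y) q) = (\<lambda>q y. 0)"
      "(\<lambda>q y. lap (\<lambda>q. G q y) q) = (\<lambda>q y. 0)" using add.IH by blast+
    then have "lap (\<lambda>q. F q y) q = 0" "lap (\<lambda>q. G q y) q = 0" for q y
      by (auto dest!: fun_cong[THEN fun_cong])
    then show "(\<lambda>q y. lap (\<lambda>q. F q y) q + lap (\<lambda>q. G q y) q) = (\<lambda>q y. 0)" by simp
  next
    fix m assume "n = Suc m"
    then show "W m (\<lambda>q y. lap (\<lambda>q. F q y) q + lap (\<lambda>q. G q y) q)"
      using add.IH by (simp add: wick.add)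
  qed
qed

lemma W_lap: "W (Suc n) F \<Longrightarrow> W n (\<lambda>q y. lap (\<lambda>q. F q y) q)"
  using W_lap_aux by blast

text \<open>Applying the Laplacian \<open>n\<close> times turns the left factor into a nonzero
  constant and leaves no forms, so that only an element of \<open>R\<close> remains.\<close>

theorem W_average: "W n (\<lambda>q y. qn q ^ n * f y) \<Longrightarrow> f \<in> R"
proof (induction n)
  case 0
  then obtain r where r: "r \<in> R" "(\<lambda>(q::'a quat) y. f y) = (\<lambda>q y. r y)" using W_const by fastforce
  from fun_cong[OF fun_cong[OF r(2)]] have "f y = r y" for y .
  then have "f = r" by blast
  with r show ?case by simp
next
  case (Suc n)
  let ?c = "2 * of_nat (Suc n) * of_nat (n + 2) :: 'a"
  have c0: "?c \<noteq> 0" using of_nat_neq_0 by (metis add_2_eq_Suc' mult_eq_0_iff zero_neq_numeral)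
  then obtain c where c: "c \<noteq> 0" "c = ?c" by blast
  \<comment> \<open>In the variable \<open>q\<close> the value \<open>f y\<close> is a constant, so
    the product rule keeps only the Laplacian of the norm power.\<close>
  have eq: "lap (\<lambda>q. qn q ^ Suc n * f y) q = c * qn q ^ n * f y" for q y
    unfolding lap_mult[OF qpoly_qn_pow qpoly_const] lap_qn_pow lap_const grd_const c(2)
    by (simp only: mult_zero_right add_0_left)
  from W_lap[OF Suc.prems] have "W n (\<lambda>q y. c * qn q ^ n * f y)" unfolding eq .
  from W_scale[OF this R_const[of "inverse c"]]
  have "W n (\<lambda>q y. qn q ^ n * f y)" using c(1) by (simp add: mult.assoc[symmetric])
  then show ?case by (rule Suc.IH)
qed

end

section \<open>Vectors, their covariants and the rotation action\<close>

subsection \<open>Vectors\<close>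

type_synonym 'k vec = "ix \<Rightarrow> 'k"

definition dot :: "'k::comm_ring_1 vec \<Rightarrow> 'k vec \<Rightarrow> 'k" where
  "dot a b = a I1 * b I1 + a I2 * b I2 + a I3 * b I3"

definition cross :: "'k::comm_ring_1 vec \<Rightarrow> 'k vec \<Rightarrow> 'k vec" where
  "cross a b = (\<lambda>i. case i of I1 \<Rightarrow> a I2 * b I3 - a I3 * b I2
     | I2 \<Rightarrow> a I3 * b I1 - a I1 * b I3 | I3 \<Rightarrow> a I1 * b I2 - a I2 * b I1)"

lemma cross_nth [simp]:
  "cross a b I1 = a I2 * b I3 - a I3 * b I2" "cross a b I2 = a I3 * b I1 - a I1 * b I3"
  "cross a b I3 = a I1 * b I2 - a I2 * b I1"
  by (simp_all add: cross_def)

lemma ix_eqI: "a I1 = b I1 \<Longrightarrow> a I2 = b I2 \<Longrightarrow> a I3 = b I3 \<Longrightarrow> a = b"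
  by (rule ext) (metis ix.exhaust)

lemma m3_eqI:
  assumes "A I1 I1 = B I1 I1" "A I1 I2 = B I1 I2" "A I1 I3 = B I1 I3"
    "A I2 I1 = B I2 I1" "A I2 I2 = B I2 I2" "A I2 I3 = B I2 I3"
    "A I3 I1 = B I3 I1" "A I3 I2 = B I3 I2" "A I3 I3 = B I3 I3"
  shows "A = (B :: ix \<Rightarrow> ix \<Rightarrow> 'k)"
  by (intro ix_eqI assms)

definition qv :: "'k::comm_ring_1 vec \<Rightarrow> 'k quat" where
  "qv a = Quat 0 (a I1) (a I2) (a I3)"

definition vpart :: "'k quat \<Rightarrow> 'k vec" where
  "vpart q = (\<lambda>i. case i of I1 \<Rightarrow> qi q | I2 \<Rightarrow> qj q | I3 \<Rightarrow> qk q)"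

lemma vpart_nth [simp]: "vpart q I1 = qi q" "vpart q I2 = qj q" "vpart q I3 = qk q"
  by (simp_all add: vpart_def)

lemma qv_sel [simp]: "qr (qv a) = 0" "qi (qv a) = a I1" "qj (qv a) = a I2" "qk (qv a) = a I3"
  by (simp_all add: qv_def)

lemma vpart_qv [simp]: "vpart (qv a) = a"
  by (rule ix_eqI) simp_all

lemma qr_mult_vpart: "qr (x * y) = qr x * qr y - dot (vpart x) (vpart y)"
  by (simp add: quat_sel_times dot_def)

lemma vpart_mult:
  "vpart (x * y) = (\<lambda>i. qr x * vpart y i + (qr y * vpart x i + cross (vpart x) (vpart y) i))"
  by (rule ix_eqI) (simp_all add: quat_sel_times)

lemma vpart_qcnj: "vpart (qcnj x) = (\<lambda>i. - 1 * vpart x i)"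
  by (rule ix_eqI) simp_all

lemma dot_cross_cross: "dot (cross a b) (cross c d) = dot a c * dot b d + - 1 * (dot a d * dot b c)"
  by (simp add: dot_def algebra_simps)

lemma cross_cross: "cross a (cross b c) = (\<lambda>i. dot a c * b i + (- 1 * dot a b) * c i)"
  by (rule ix_eqI) (simp_all add: dot_def algebra_simps)

lemma cross_anti: "cross a b = (\<lambda>i. - 1 * cross b a i)"
  by (rule ix_eqI) (simp_all add: algebra_simps)

lemma cross_cross_cross:
  "cross (cross a b) (cross c d) = (\<lambda>i. dot a (cross b d) * c i + (- 1 * dot a (cross b c)) * d i)"
  by (rule ix_eqI) (simp_all add: dot_def algebra_simps)

lemma dot_comm: "dot a b = dot b a"
  by (simp add: dot_def algebra_simps)

lemma dot_add: "dot (\<lambda>i. a i + b i) c = dot a c + dot b c" "dot c (\<lambda>i. a i + b i) = dot c a + dot c b"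
  by (simp_all add: dot_def algebra_simps)

lemma dot_scale: "dot (\<lambda>i. r * a i) c = r * dot a c" "dot c (\<lambda>i. r * a i) = r * dot c a"
  by (simp_all add: dot_def algebra_simps)

lemma cross_add:
  "cross (\<lambda>i. a i + b i) c = (\<lambda>i. cross a c i + cross b c i)"
  "cross c (\<lambda>i. a i + b i) = (\<lambda>i. cross c a i + cross c b i)"
  by (rule ix_eqI; simp add: algebra_simps)+

lemma cross_scale:
  "cross (\<lambda>i. r * a i) c = (\<lambda>i. r * cross a c i)" "cross c (\<lambda>i. r * a i) = (\<lambda>i. r * cross c a i)"
  by (rule ix_eqI; simp add: algebra_simps)+

lemma dot_zero: "dot (\<lambda>i. 0) c = 0" "dot c (\<lambda>i. 0) = 0"
  by (simp_all add: dot_def)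

lemma cross_zero: "cross (\<lambda>i. 0) c = (\<lambda>i. 0)" "cross c (\<lambda>i. 0) = (\<lambda>i. 0)"
  by (rule ix_eqI; simp)+

subsection \<open>Scalar and vector covariants of a set of vectors\<close>

definition scov :: "('k::comm_ring_1 pt \<Rightarrow> 'k vec) set \<Rightarrow> 'k fn set" where
  "scov L = alg ({(\<lambda>x. dot (a x) (b x)) | a b. a \<in> L \<and> b \<in> L}
    \<union> {(\<lambda>x. dot (a x) (cross (b x) (c x))) | a b c. a \<in> L \<and> b \<in> L \<and> c \<in> L})"

text \<open>A single layer of cross products suffices for closure: \<open>cross_cross\<close> and
  \<open>cross_cross_cross\<close> bring iterated cross products back to combinations of the vectors
  with scalar covariants as coefficients.\<close>

inductive_set vcov :: "('k::comm_ring_1 pt \<Rightarrow> 'k vec) set \<Rightarrow> ('k pt \<Rightarrow> 'k vec) set" for L where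
  zero: "(\<lambda>x i. 0) \<in> vcov L"
| vec: "a \<in> L \<Longrightarrow> a \<in> vcov L"
| cross: "a \<in> L \<Longrightarrow> b \<in> L \<Longrightarrow> (\<lambda>x. cross (a x) (b x)) \<in> vcov L"
| add: "X \<in> vcov L \<Longrightarrow> Y \<in> vcov L \<Longrightarrow> (\<lambda>x i. X x i + Y x i) \<in> vcov L"
| scale: "r \<in> scov L \<Longrightarrow> X \<in> vcov L \<Longrightarrow> (\<lambda>x i. r x * X x i) \<in> vcov L"

lemma scov_dot: "a \<in> L \<Longrightarrow> b \<in> L \<Longrightarrow> (\<lambda>x. dot (a x) (b x)) \<in> scov L"
  unfolding scov_def by (rule alg.gen) blast

lemma scov_det: "a \<in> L \<Longrightarrow> b \<in> L \<Longrightarrow> c \<in> L \<Longrightarrow> (\<lambda>x. dot (a x) (cross (b x) (c x))) \<in> scov L"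
  unfolding scov_def by (rule alg.gen) blast

lemma scov_add: "f \<in> scov L \<Longrightarrow> g \<in> scov L \<Longrightarrow> (\<lambda>x. f x + g x) \<in> scov L"
  unfolding scov_def by (rule alg.add)

lemma scov_mult: "f \<in> scov L \<Longrightarrow> g \<in> scov L \<Longrightarrow> (\<lambda>x. f x * g x) \<in> scov L"
  unfolding scov_def by (rule alg.mult)

lemma scov_const: "(\<lambda>x. c) \<in> scov L"
  unfolding scov_def by (rule alg.const)

lemmas scov_intros = scov_dot scov_det scov_add scov_mult scov_const

lemma vcov_dot_vec: "X \<in> vcov L \<Longrightarrow> a \<in> L \<Longrightarrow> (\<lambda>x. dot (a x) (X x)) \<in> scov L"
  by (induction rule: vcov.induct) (simp_all add: dot_zero dot_add dot_scale scov_intros)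

lemma vcov_dot_cross:
  "X \<in> vcov L \<Longrightarrow> a \<in> L \<Longrightarrow> b \<in> L \<Longrightarrow> (\<lambda>x. dot (cross (a x) (b x)) (X x)) \<in> scov L"
proof (induction rule: vcov.induct)
  case (vec c)
  then show ?case by (subst dot_comm) (simp add: scov_det)
next
  case (cross c d)
  then show ?case unfolding dot_cross_cross by (intro scov_intros)
qed (simp_all add: dot_zero dot_add dot_scale scov_intros)

lemma vcov_dot: "X \<in> vcov L \<Longrightarrow> Y \<in> vcov L \<Longrightarrow> (\<lambda>x. dot (X x) (Y x)) \<in> scov L"
  by (induction rule: vcov.induct)
    (simp_all add: dot_zero dot_add dot_scale scov_intros vcov_dot_vec vcov_dot_cross)

lemma vcov_cross_vec: "X \<in> vcov L \<Longrightarrow> a \<in> L \<Longrightarrow> (\<lambda>x. cross (a x) (X x)) \<in> vcov L"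
proof (induction rule: vcov.induct)
  case (cross c d)
  then show ?case unfolding cross_cross
    by (intro vcov.add vcov.scale scov_intros vcov.vec)
qed (simp_all add: cross_zero cross_add cross_scale vcov.intros)

lemma vcov_cross_cross:
  "X \<in> vcov L \<Longrightarrow> a \<in> L \<Longrightarrow> b \<in> L \<Longrightarrow> (\<lambda>x. cross (cross (a x) (b x)) (X x)) \<in> vcov L"
proof (induction rule: vcov.induct)
  case (vec c)
  then show ?case by (subst cross_anti, subst cross_cross)
      (intro vcov.add vcov.scale scov_intros vcov.vec)
next
  case (cross c d)
  then show ?case unfolding cross_cross_cross
    by (intro vcov.add vcov.scale scov_intros vcov.vec)
qed (simp_all add: cross_zero cross_add cross_scale vcov.intros)

lemma vcov_cross: "X \<in> vcov L \<Longrightarrow> Y \<in> vcov L \<Longrightarrow> (\<lambda>x. cross (X x) (Y x)) \<in> vcov L"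
  by (induction rule: vcov.induct)
    (simp_all add: cross_zero cross_add cross_scale vcov.intros vcov_cross_vec vcov_cross_cross)

definition qcov :: "('k::comm_ring_1 pt \<Rightarrow> 'k vec) set \<Rightarrow> ('k pt \<Rightarrow> 'k quat) set" where
  "qcov L = {X. (\<lambda>x. qr (X x)) \<in> scov L \<and> (\<lambda>x. vpart (X x)) \<in> vcov L}"

text \<open>The real and imaginary parts of a quaternion product are given by dot and cross products
  of the imaginary parts, so the closure of the covariants under both supplies the closure
  conditions.\<close>

lemma wick_ring_cov: "wick_ring (scov L) (qcov (L :: ('k::field_char_0 pt \<Rightarrow> 'k vec) set))"
proof
  have "vpart 1 = (\<lambda>i. 0::'k)" by (rule ix_eqI) simp_all
  then show "(\<lambda>x. 1) \<in> qcov L" by (simp add: qcov_def scov_const vcov.zero)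
next
  fix X Y :: "'k pt \<Rightarrow> 'k quat" assume X: "X \<in> qcov L" and Y: "Y \<in> qcov L"
  then have "(\<lambda>x. qr (X x) * qr (Y x) + - 1 * dot (vpart (X x)) (vpart (Y x))) \<in> scov L"
    unfolding qcov_def by (intro scov_intros vcov_dot) simp_all
  moreover have "(\<lambda>x i. qr (X x) * vpart (Y x) i
     + (qr (Y x) * vpart (X x) i + cross (vpart (X x)) (vpart (Y x)) i)) \<in> vcov L"
    using X Y unfolding qcov_def by (intro vcov.add vcov.scale vcov_cross) simp_all
  ultimately show "(\<lambda>x. X x * Y x) \<in> qcov L"
    unfolding qcov_def by (simp add: qr_mult_vpart vpart_mult)
next
  fix X :: "'k pt \<Rightarrow> 'k quat" assume "X \<in> qcov L"
  then show "(\<lambda>x. qcnj (X x)) \<in> qcov L"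
    using vcov.scale[OF scov_const[of "- 1" L], of "\<lambda>x. vpart (X x)"]
    unfolding qcov_def by (simp add: vpart_qcnj)
qed (auto simp: scov_intros qcov_def)

lemma qv_qcov: "a \<in> L \<Longrightarrow> (\<lambda>x. qv (a x)) \<in> qcov L"
  by (simp add: qcov_def scov_const vcov.vec)

subsection \<open>Rotations\<close>

definition rot :: "'k::comm_ring_1 quat \<Rightarrow> 'k m3" where
  "rot q = (\<lambda>i j. vpart (q * qv (\<lambda>k. if k = j then 1 else 0) * qcnj q) i)"

definition mv :: "'k::comm_ring_1 m3 \<Rightarrow> 'k vec \<Rightarrow> 'k vec" where
  "mv g a = (\<lambda>i. g i I1 * a I1 + g i I2 * a I2 + g i I3 * a I3)"

text \<open>The matrix \<open>rot q\<close> stretches lengths by \<open>qn q\<close>, so dividing by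
  the norm yields a rotation without taking square roots in the field.\<close>

definition nrot :: "'k::field quat \<Rightarrow> 'k m3" where
  "nrot q = (\<lambda>i j. rot q i j / qn q)"

lemma rot_entries:
  fixes q :: "'k::comm_ring_1 quat"
  defines "a \<equiv> qr q" and "b \<equiv> qi q" and "c \<equiv> qj q" and "d \<equiv> qk q"
  shows "rot q I1 I1 = a*a + b*b - c*c - d*d" "rot q I1 I2 = 2*(b*c - a*d)" "rot q I1 I3 = 2*(b*d + a*c)"
    "rot q I2 I1 = 2*(b*c + a*d)" "rot q I2 I2 = a*a - b*b + c*c - d*d" "rot q I2 I3 = 2*(c*d - a*b)"
    "rot q I3 I1 = 2*(b*d - a*c)" "rot q I3 I2 = 2*(c*d + a*b)" "rot q I3 I3 = a*a - b*b - c*c + d*d"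
  unfolding rot_def a_def b_def c_def d_def by (simp_all add: quat_sel_times algebra_simps)

lemma mv_rot: "mv (rot q) a i = qform (- qv (\<lambda>k. if k = i then 1 else 0)) (qv a) q"
  by (cases i) (simp_all add: mv_def rot_entries qform_def quat_sel_times algebra_simps)

lemma rot_orth: "mmul (mT (rot q)) (rot q) = (\<lambda>i j. if i = j then qn q * qn q else 0)"
  by (rule m3_eqI)
    (simp_all add: mmul_def mT_def rot_entries qn_def power2_eq_square algebra_simps)

lemma rot_det: "det3 (rot q) = qn q * qn q * qn q"
  unfolding det3_def rot_entries qn_def power2_eq_square by (simp add: algebra_simps)

lemma nrot_SO3:
  fixes q :: "'k::field quat"
  assumes n: "qn q \<noteq> 0"
  shows "nrot q \<in> SO3"
proof -
  have o: "mmul (mT (rot q)) (rot q) i j = (if i = j then qn q * qn q else 0)" for i j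
    by (simp add: rot_orth)
  have "mmul (mT (nrot q)) (nrot q) i j = mmul (mT (rot q)) (rot q) i j / (qn q * qn q)" for i j
    by (simp add: mmul_def mT_def nrot_def add_divide_distrib)
  then have "mmul (mT (nrot q)) (nrot q) = mid"
    unfolding o mid_def using n by (intro ext) simp
  moreover have "det3 (nrot q) = det3 (rot q) / (qn q * qn q * qn q)"
    unfolding det3_def nrot_def using n by (simp add: field_simps)
  ultimately show ?thesis unfolding SO3_def rot_det using n by simp
qed

text \<open>The classical adjugate matrix, with the transposition of the cofactors built in.\<close>

definition adj :: "'k::comm_ring_1 m3 \<Rightarrow> 'k m3" where
  "adj g = (\<lambda>i j. case (i, j) of
      (I1, I1) \<Rightarrow> g I2 I2 * g I3 I3 - g I2 I3 * g I3 I2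
    | (I1, I2) \<Rightarrow> g I1 I3 * g I3 I2 - g I1 I2 * g I3 I3
    | (I1, I3) \<Rightarrow> g I1 I2 * g I2 I3 - g I1 I3 * g I2 I2
    | (I2, I1) \<Rightarrow> g I2 I3 * g I3 I1 - g I2 I1 * g I3 I3
    | (I2, I2) \<Rightarrow> g I1 I1 * g I3 I3 - g I1 I3 * g I3 I1
    | (I2, I3) \<Rightarrow> g I1 I3 * g I2 I1 - g I1 I1 * g I2 I3
    | (I3, I1) \<Rightarrow> g I2 I1 * g I3 I2 - g I2 I2 * g I3 I1
    | (I3, I2) \<Rightarrow> g I1 I2 * g I3 I1 - g I1 I1 * g I3 I2
    | (I3, I3) \<Rightarrow> g I1 I1 * g I2 I2 - g I1 I2 * g I2 I1)"

lemma mmul_adj: "mmul g (adj g) = (\<lambda>i j. det3 g * mid i j)"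
  by (rule m3_eqI) (simp_all add: mmul_def adj_def mid_def det3_def algebra_simps)

lemma mmul_assoc: "mmul (mmul A B) C = mmul A (mmul B C)"
  by (simp add: mmul_def algebra_simps)

lemma mmul_mid [simp]: "mmul mid A = A" "mmul A mid = A"
  by (rule m3_eqI; simp add: mmul_def mid_def)+

text \<open>The transpose is a left inverse, and the adjugate is a right inverse since the
  determinant is 1; hence they agree. Every entry of a rotation is thus its own cofactor.\<close>

lemma SO3_adj_eq:
  assumes "g \<in> SO3"
  shows "mT g = adj g"
proof -
  have "adj g = mmul (mmul (mT g) g) (adj g)" using assms by (simp add: SO3_def)
  also have "\<dots> = mmul (mT g) mid"
    unfolding mmul_assoc mmul_adj using assms by (simp add: SO3_def)
  finally show ?thesis by simp
qed

lemma SO3_orth: "g \<in> SO3 \<Longrightarrow> mmul g (mT g) = mid"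
  using SO3_adj_eq[of g] mmul_adj[of g] by (simp add: SO3_def)

lemma SO3_adj:
  assumes "g \<in> SO3"
  shows "g I1 I1 = g I2 I2 * g I3 I3 - g I2 I3 * g I3 I2"
    "g I1 I2 = g I2 I3 * g I3 I1 - g I2 I1 * g I3 I3"
    "g I1 I3 = g I2 I1 * g I3 I2 - g I2 I2 * g I3 I1"
    "g I2 I1 = g I1 I3 * g I3 I2 - g I1 I2 * g I3 I3"
    "g I2 I2 = g I1 I1 * g I3 I3 - g I1 I3 * g I3 I1"
    "g I2 I3 = g I1 I2 * g I3 I1 - g I1 I1 * g I3 I2"
    "g I3 I1 = g I1 I2 * g I2 I3 - g I1 I3 * g I2 I2"
    "g I3 I2 = g I1 I3 * g I2 I1 - g I1 I1 * g I2 I3"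
    "g I3 I3 = g I1 I1 * g I2 I2 - g I1 I2 * g I2 I1"
proof -
  have "g i j = adj g j i" for i j using SO3_adj_eq[OF assms] by (metis mT_def)
  note e = this
  show "g I1 I1 = g I2 I2 * g I3 I3 - g I2 I3 * g I3 I2"
    "g I1 I2 = g I2 I3 * g I3 I1 - g I2 I1 * g I3 I3"
    "g I1 I3 = g I2 I1 * g I3 I2 - g I2 I2 * g I3 I1"
    "g I2 I1 = g I1 I3 * g I3 I2 - g I1 I2 * g I3 I3"
    "g I2 I2 = g I1 I1 * g I3 I3 - g I1 I3 * g I3 I1"
    "g I2 I3 = g I1 I2 * g I3 I1 - g I1 I1 * g I3 I2"
    "g I3 I1 = g I1 I2 * g I2 I3 - g I1 I3 * g I2 I2"
    "g I3 I2 = g I1 I3 * g I2 I1 - g I1 I1 * g I2 I3"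
    "g I3 I3 = g I1 I1 * g I2 I2 - g I1 I2 * g I2 I1"
    by (subst e, simp add: adj_def)+
qed

text \<open>The axis vector: the matrix \<open>tm x k\<close> acts on a vector as the cross product
  with \<open>vv x k\<close> from the left.\<close>

definition vv :: "'k::comm_ring_1 pt \<Rightarrow> ix \<Rightarrow> 'k vec" where
  "vv x k = (\<lambda>i. case i of I1 \<Rightarrow> - x (T k P23) | I2 \<Rightarrow> x (T k P13) | I3 \<Rightarrow> - x (T k P12))"

lemma vv_nth [simp]: "vv x k I1 = - x (T k P23)" "vv x k I2 = x (T k P13)" "vv x k I3 = - x (T k P12)"
  by (simp_all add: vv_def)

lemma act_T [simp]:
  "act g x (T k P12) = mmul (mmul g (tm x k)) (mT g) I1 I2"
  "act g x (T k P13) = mmul (mmul g (tm x k)) (mT g) I1 I3"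
  "act g x (T k P23) = mmul (mmul g (tm x k)) (mT g) I2 I3"
  "act g x (Z i j) = mmul (mmul g (zm x)) (mT g) i j"
  by (simp_all add: act_def Let_def)

lemma tm_entries [simp]:
  "tm x k I1 I1 = 0" "tm x k I2 I2 = 0" "tm x k I3 I3 = 0"
  "tm x k I1 I2 = x (T k P12)" "tm x k I2 I1 = - x (T k P12)"
  "tm x k I1 I3 = x (T k P13)" "tm x k I3 I1 = - x (T k P13)"
  "tm x k I2 I3 = x (T k P23)" "tm x k I3 I2 = - x (T k P23)"
  by (simp_all add: tm_def)

lemma tm_act: "tm (act g x) k = mmul (mmul g (tm x k)) (mT g)"
  by (rule m3_eqI) (simp_all add: mmul_def mT_def algebra_simps)

text \<open>Conjugating a skew-symmetric matrix by \<open>g\<close> transforms its axis by the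
  cofactor matrix, which for a rotation is \<open>g\<close> itself.\<close>

lemma vv_act:
  assumes "g \<in> SO3"
  shows "vv (act g x) k = mv g (vv x k)"
proof (rule ix_eqI)
  note c = SO3_adj[OF assms]
  show "vv (act g x) k I1 = mv g (vv x k) I1"
    unfolding mv_def c(1-3) by (simp add: mmul_def mT_def algebra_simps)
  show "vv (act g x) k I2 = mv g (vv x k) I2"
    unfolding mv_def c(4-6) by (simp add: mmul_def mT_def algebra_simps)
  show "vv (act g x) k I3 = mv g (vv x k) I3"
    unfolding mv_def c(7-9) by (simp add: mmul_def mT_def algebra_simps)
qed

section \<open>Invariants quadratic in an auxiliary vector\<close>

subsection \<open>The first fundamental theorem for covariants of degree one in s\<close>

definition uu :: "'k pt \<Rightarrow> 'k vec" where
  "uu x = (\<lambda>i. x (Z i i))"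

text \<open>An invariant linear in \<open>s\<close> is determined by its values at \<open>z = u u\<^sup>T\<close>; the vector \<open>u\<close> is
  stored on the diagonal of \<open>z\<close>.\<close>

definition rank1 :: "'k::comm_ring_1 pt \<Rightarrow> 'k pt" where
  "rank1 x = (\<lambda>v. case v of T k p \<Rightarrow> x (T k p) | Z i j \<Rightarrow> uu x i * uu x j)"

definition tvec :: "('k::comm_ring_1 pt \<Rightarrow> 'k vec) set" where
  "tvec = range (\<lambda>k x. vv x k)"

text \<open>A power of the norm clears the denominators in \<open>nrot\<close> and makes
  \<open>h\<close> a sum of products of forms. All exponents beyond a bound are demanded, so that
  two functions can be brought to the same power when they are added.\<close>

definition rotpoly :: "('k::field_char_0 m3 \<Rightarrow> 'k pt \<Rightarrow> 'k) \<Rightarrow> bool" where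
  "rotpoly h \<longleftrightarrow> (\<exists>D0. \<forall>D\<ge>D0. \<exists>F. wick (scov (insert uu tvec)) (qcov (insert uu tvec)) D F \<and>
      (\<forall>q x. qn q \<noteq> 0 \<longrightarrow> F q x = qn q ^ D * h (nrot q) x))"

interpretation tu: wick_ring "scov (insert uu tvec)" "qcov (insert uu tvec)"
  by (rule wick_ring_cov)

lemma W_qn_pow: "tu.W n (\<lambda>q y. qn q ^ n)"
proof (induction n)
  case 0
  show ?case using wick.base[OF tu.R_const[of 1]] by simp
next
  case (Suc n)
  show ?case using wick.form[OF Suc tu.Q_one, of 1] by (simp add: qform_one)
qed

lemma rotpoly_cong:
  assumes "rotpoly h" "\<And>g x. g \<in> SO3 \<Longrightarrow> h g x = h' g x"
  shows "rotpoly h'"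
  using assms(1) unfolding rotpoly_def by (simp add: assms(2)[OF nrot_SO3])

lemma rotpoly_const: "rotpoly (\<lambda>g x. c)"
  unfolding rotpoly_def
  by (rule exI[of _ 0]) (use tu.W_scale[OF W_qn_pow tu.R_const[of c]] in \<open>auto simp: mult.commute\<close>)

lemma rotpoly_add:
  assumes "rotpoly h" "rotpoly h'"
  shows "rotpoly (\<lambda>g x. h g x + h' g x)"
proof -
  from assms obtain D1 D2 where 1: "\<forall>D\<ge>D1. \<exists>F. tu.W D F \<and> (\<forall>q x. qn q \<noteq> 0 \<longrightarrow> F q x = qn q ^ D * h (nrot q) x)"
    and 2: "\<forall>D\<ge>D2. \<exists>F. tu.W D F \<and> (\<forall>q x. qn q \<noteq> 0 \<longrightarrow> F q x = qn q ^ D * h' (nrot q) x)"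
    unfolding rotpoly_def by blast
  show ?thesis unfolding rotpoly_def
  proof (intro exI[of _ "max D1 D2"] allI impI)
    fix D assume D: "max D1 D2 \<le> D"
    then have D': "D1 \<le> D" "D2 \<le> D" by simp_all
    obtain F where "tu.W D F" "\<forall>q x. qn q \<noteq> 0 \<longrightarrow> F q x = qn q ^ D * h (nrot q) x"
      using 1[rule_format, OF D'(1)] by blast
    moreover obtain G where "tu.W D G" "\<forall>q x. qn q \<noteq> 0 \<longrightarrow> G q x = qn q ^ D * h' (nrot q) x"
      using 2[rule_format, OF D'(2)] by blast
    ultimately show "\<exists>F. tu.W D F \<and> (\<forall>q x. qn q \<noteq> 0 \<longrightarrow> F q x = qn q ^ D * (h (nrot q) x + h' (nrot q) x))"
      by (intro exI[of _ "\<lambda>q x. F q x + G q x"]) (simp add: wick.add distrib_left)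
  qed
qed

lemma rotpoly_mult:
  assumes "rotpoly h" "rotpoly h'"
  shows "rotpoly (\<lambda>g x. h g x * h' g x)"
proof -
  from assms obtain D1 D2 where 1: "\<forall>D\<ge>D1. \<exists>F. tu.W D F \<and> (\<forall>q x. qn q \<noteq> 0 \<longrightarrow> F q x = qn q ^ D * h (nrot q) x)"
    and 2: "\<forall>D\<ge>D2. \<exists>F. tu.W D F \<and> (\<forall>q x. qn q \<noteq> 0 \<longrightarrow> F q x = qn q ^ D * h' (nrot q) x)"
    unfolding rotpoly_def by blast
  show ?thesis unfolding rotpoly_def
  proof (intro exI[of _ "D1 + D2"] allI impI)
    fix D assume "D1 + D2 \<le> D"
    then obtain E where D: "D = D1 + E" "D2 \<le> E" by (auto simp: le_iff_add add.assoc)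
    obtain F where "tu.W D1 F" "\<forall>q x. qn q \<noteq> 0 \<longrightarrow> F q x = qn q ^ D1 * h (nrot q) x"
      using 1[rule_format, OF order_refl] by blast
    moreover obtain G where "tu.W E G" "\<forall>q x. qn q \<noteq> 0 \<longrightarrow> G q x = qn q ^ E * h' (nrot q) x"
      using 2[rule_format, OF D(2)] by blast
    ultimately show "\<exists>F. tu.W D F \<and> (\<forall>q x. qn q \<noteq> 0 \<longrightarrow> F q x = qn q ^ D * (h (nrot q) x * h' (nrot q) x))"
      by (intro exI[of _ "\<lambda>q x. F q x * G q x"]) (simp add: tu.W_mult D power_add)
  qed
qed

lemma rotpoly_mv:
  assumes "a \<in> insert uu tvec"
  shows "rotpoly (\<lambda>g x. mv g (a x) i)"
  unfolding rotpoly_def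
proof (intro exI[of _ 1] allI impI)
  fix D :: nat assume "1 \<le> D"
  then obtain E where D: "D = Suc E" by (cases D) auto
  have "mv (nrot q) b i = mv (rot q) b i / qn q" for q :: "'a quat" and b
    by (simp add: mv_def nrot_def add_divide_distrib)
  then have eq: "mv (rot q) b i * qn q ^ E = qn q ^ Suc E * mv (nrot q) b i"
    if "qn q \<noteq> 0" for q :: "'a quat" and b
    using that by simp
  then show "\<exists>F. tu.W D F \<and> (\<forall>q x. qn q \<noteq> 0 \<longrightarrow> F q x = qn q ^ D * mv (nrot q) (a x) i)"
    using wick.form[OF W_qn_pow[of E] qv_qcov[OF assms], of "- qv (\<lambda>k. if k = i then 1 else 0)"]
    unfolding D by (intro exI[of _ "\<lambda>q x. mv (rot q) (a x) i * qn q ^ E"]) (simp add: mv_rot[symmetric] eq del: power_Suc)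
qed

lemma rank1_T [simp]: "rank1 x (T k p) = x (T k p)" "rank1 x (Z i j) = uu x i * uu x j"
  by (simp_all add: rank1_def)

lemma vv_rank1 [simp]: "vv (rank1 x) = vv x"
  by (rule ext, rule ix_eqI) simp_all

lemma vv_tvec: "(\<lambda>x. vv x k) \<in> tvec"
  by (simp add: tvec_def)

lemma rotpoly_neg: "rotpoly h \<Longrightarrow> rotpoly (\<lambda>g x. - h g x)"
  using rotpoly_mult[OF rotpoly_const[of "- 1"]] by fastforce

lemma rotpoly_T: "rotpoly (\<lambda>g x. act g (rank1 x) (T k p))"
proof (cases p)
  case P12
  have "rotpoly (\<lambda>g x. - mv g (vv x k) I3)" by (intro rotpoly_neg rotpoly_mv) (simp add: vv_tvec)
  then show ?thesis unfolding P12
  proof (rule rotpoly_cong)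
    fix g :: "'a m3" and x assume "g \<in> SO3"
    from vv_act[OF this, of "rank1 x" k] have "mv g (vv x k) = vv (act g (rank1 x)) k"
      by (simp only: vv_rank1)
    then show "- mv g (vv x k) I3 = act g (rank1 x) (T k P12)" by (simp only: vv_nth minus_minus)
  qed
next
  case P13
  have "rotpoly (\<lambda>g x. mv g (vv x k) I2)" by (intro rotpoly_mv) (simp add: vv_tvec)
  then show ?thesis unfolding P13
  proof (rule rotpoly_cong)
    fix g :: "'a m3" and x assume "g \<in> SO3"
    from vv_act[OF this, of "rank1 x" k] have "mv g (vv x k) = vv (act g (rank1 x)) k"
      by (simp only: vv_rank1)
    then show "mv g (vv x k) I2 = act g (rank1 x) (T k P13)" by (simp only: vv_nth minus_minus)
  qed
next
  case P23
  have "rotpoly (\<lambda>g x. - mv g (vv x k) I1)" by (intro rotpoly_neg rotpoly_mv) (simp add: vv_tvec)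
  then show ?thesis unfolding P23
  proof (rule rotpoly_cong)
    fix g :: "'a m3" and x assume "g \<in> SO3"
    from vv_act[OF this, of "rank1 x" k] have "mv g (vv x k) = vv (act g (rank1 x)) k"
      by (simp only: vv_rank1)
    then show "- mv g (vv x k) I1 = act g (rank1 x) (T k P23)" by (simp only: vv_nth minus_minus)
  qed
qed

lemma rotpoly_Z: "rotpoly (\<lambda>g x. act g (rank1 x) (Z i j))"
proof -
  have "rotpoly (\<lambda>g x. mv g (uu x) i * mv g (uu x) j)" by (intro rotpoly_mult rotpoly_mv) simp_all
  then show ?thesis
    by (rule rotpoly_cong) (simp add: mmul_def mT_def zm_def mv_def algebra_simps)
qed

lemma rotpoly_KT:
  assumes "c \<in> KT"
  shows "rotpoly (\<lambda>g x. c (act g (rank1 x)))"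
  using assms unfolding KT_def
proof (induction rule: alg.induct)
  case (gen f)
  then show ?case using rotpoly_T by auto
qed (auto intro: rotpoly_const rotpoly_add rotpoly_mult)

lemma rotpoly_sm: "rotpoly (\<lambda>g x. sm (act g (rank1 x)) i j)"
proof (cases "i = j")
  case True
  have "rotpoly (\<lambda>g x. act g (rank1 x) (Z i i) + (act g (rank1 x) (Z I1 I1)
     + act g (rank1 x) (Z I2 I2) + act g (rank1 x) (Z I3 I3)) * (- 1 / 3))"
    by (intro rotpoly_add rotpoly_mult rotpoly_const rotpoly_Z)
  then show ?thesis unfolding sm_def using True by simp
next
  case False
  have "rotpoly (\<lambda>g x. (act g (rank1 x) (Z i j) + act g (rank1 x) (Z j i)) * (1 / 2))"
    by (intro rotpoly_add rotpoly_mult rotpoly_const rotpoly_Z)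
  then show ?thesis unfolding sm_def using False by simp
qed

text \<open>An invariant does not change along the rotations \<open>nrot q\<close>, so a norm power
  times its value lies in the Wick class, and averaging eliminates \<open>q\<close>.\<close>

lemma C3_rank1:
  fixes f :: "'k::field_char_0 fn"
  assumes "f \<in> C3"
  shows "(\<lambda>x. f (rank1 x)) \<in> scov (insert uu tvec)"
proof -
  from assms obtain c where c: "\<And>i j. c i j \<in> KT"
    and f: "\<And>x. f x = (\<Sum>i\<in>{I1,I2,I3}. \<Sum>j\<in>{I1,I2,I3}. c i j x * sm x i j)"
    and inv: "SO3_inv f"
    unfolding C3_def by blast
  have "rotpoly (\<lambda>g x. f (act g (rank1 x)))" unfolding f
    by simp (intro rotpoly_add rotpoly_mult rotpoly_sm rotpoly_KT c)
  then have "rotpoly (\<lambda>g x. f (rank1 x))"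
    by (rule rotpoly_cong) (use inv in \<open>simp add: SO3_inv_def\<close>)
  then obtain D F where W: "tu.W D F"
    and F: "\<And>q x. qn q \<noteq> 0 \<Longrightarrow> F q x = qn q ^ D * f (rank1 x)"
    unfolding rotpoly_def by blast
  \<comment> \<open>One extra norm factor extends the identity to isotropic \<open>q\<close>: there
    both sides vanish.\<close>
  have "qform 1 1 q * F q x = qn q ^ Suc D * f (rank1 x)" for q x
    using F[of q x] by (cases "qn q = 0") (simp_all add: qform_one)
  with wick.form[OF W tu.Q_one, of 1]
  have "tu.W (Suc D) (\<lambda>q x. qn q ^ Suc D * f (rank1 x))" by simp
  then show ?thesis by (rule tu.W_average)
qed

subsection \<open>Extracting the part of degree two in u\<close>

text \<open>Scales the vector \<open>u\<close> and keeps the \<open>t\<close> variables, so that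
  powers of \<open>t\<close> measure the degree in \<open>u\<close>.\<close>

definition scz :: "'k::comm_ring_1 \<Rightarrow> 'k pt \<Rightarrow> 'k pt" where
  "scz t x = (\<lambda>v. case v of T k p \<Rightarrow> x (T k p) | Z i j \<Rightarrow> t * x (Z i j))"

lemma uu_scz: "uu (scz t x) = (\<lambda>i. t * uu x i)" "vv (scz t x) = vv x"
  by (simp add: uu_def scz_def) (rule ext, rule ix_eqI, simp_all add: scz_def)

text \<open>The possible parts of degree two in \<open>u\<close>, in the explicit form that
  \<open>polz_quad\<close> converts into values of \<open>s\<close>.\<close>

inductive_set quad :: "'k::comm_ring_1 fn set" where
  zero: "(\<lambda>x. 0) \<in> quad"
| unit: "r \<in> scov tvec \<Longrightarrow> (\<lambda>x. r x * dot (uu x) (uu x)) \<in> quad"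
| prod: "X \<in> vcov tvec \<Longrightarrow> Y \<in> vcov tvec \<Longrightarrow> (\<lambda>x. dot (uu x) (X x) * dot (uu x) (Y x)) \<in> quad"
| add: "f \<in> quad \<Longrightarrow> g \<in> quad \<Longrightarrow> (\<lambda>x. f x + g x) \<in> quad"

lemma quad_scale:
  assumes "f \<in> quad" and s: "s \<in> scov tvec"
  shows "(\<lambda>x. s x * f x) \<in> quad"
  using assms(1)
proof (induction rule: quad.induct)
  case zero
  show ?case by (simp add: quad.zero)
next
  case (unit r)
  show ?case using quad.unit[OF scov_mult[OF s unit]] by (simp add: mult.assoc)
next
  case (prod X Y)
  show ?case using quad.prod[OF vcov.scale[OF s prod(1)] prod(2)]
    by (simp add: dot_scale mult.assoc)
next
  case (add f g)
  then show ?case using quad.add by (simp add: distrib_left)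
qed

text \<open>The parts of degree 0 and 1 are tracked together with the quadratic one, because they
  enter the quadratic part of a product.\<close>

definition graded :: "'k::comm_ring_1 fn \<Rightarrow> 'k fn \<Rightarrow> ('k pt \<Rightarrow> 'k vec) \<Rightarrow> 'k fn \<Rightarrow> bool" where
  "graded f r0 X r2 \<longleftrightarrow> r0 \<in> scov tvec \<and> X \<in> vcov tvec \<and> r2 \<in> quad \<and>
     (\<forall>x. \<exists>p. (\<forall>t. f (scz t x) = poly p t) \<and> coeff p 0 = r0 x \<and> coeff p 1 = dot (uu x) (X x)
        \<and> coeff p 2 = r2 x)"

lemma graded0: "r \<in> scov tvec \<Longrightarrow> (\<And>t x. r (scz t x) = r x) \<Longrightarrow> \<exists>r0 X r2. graded r r0 X r2"
  unfolding graded_def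
  by (rule exI[of _ r], rule exI[of _ "\<lambda>x i. 0"], rule exI[of _ "\<lambda>x. 0"])
    (auto simp: vcov.zero quad.zero dot_zero numeral_2_eq_2 intro!: exI[of _ "[:_:]"])

lemma graded1: "X \<in> vcov tvec \<Longrightarrow> (\<And>t x. f (scz t x) = t * dot (uu x) (X x)) \<Longrightarrow> \<exists>r0 X r2. graded f r0 X r2"
  unfolding graded_def
  by (rule exI[of _ "\<lambda>x. 0"], rule exI[of _ X], rule exI[of _ "\<lambda>x. 0"])
    (auto simp: scov_const quad.zero numeral_2_eq_2 intro!: exI[of _ "[:0, _:]"])

lemma graded2: "r2 \<in> quad \<Longrightarrow> (\<And>t x. f (scz t x) = t * (t * r2 x)) \<Longrightarrow> \<exists>r0 X r2. graded f r0 X r2"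
  unfolding graded_def
  by (rule exI[of _ "\<lambda>x. 0"], rule exI[of _ "\<lambda>x i. 0"], rule exI[of _ r2])
    (auto simp: scov_const vcov.zero dot_zero numeral_2_eq_2 intro!: exI[of _ "[:0, 0, _:]"])

lemma scov_subset_graded:
  fixes f :: "'k::field_char_0 fn"
  assumes "f \<in> scov (insert uu tvec)"
  shows "\<exists>r0 X r2. graded f r0 X r2"
  using assms unfolding scov_def
proof (induction rule: alg.induct)
  case (gen f)
  then consider (dot) a b where "a \<in> insert uu tvec" "b \<in> insert uu tvec" "f = (\<lambda>x. dot (a x) (b x))"
    | (det) a b c where "a \<in> insert uu tvec" "b \<in> insert uu tvec" "c \<in> insert uu tvec"
        "f = (\<lambda>x. dot (a x) (cross (b x) (c x)))"
    by blast
  then show ?case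
  proof cases
    case dot
    have sc: "\<And>t x. a (scz t x) = a x" if "a \<in> tvec" for a :: "'k pt \<Rightarrow> 'k vec"
      using that by (auto simp: tvec_def uu_scz)
    consider "a = uu" "b = uu" | "a = uu" "b \<in> tvec" | "a \<in> tvec" "b = uu" | "a \<in> tvec" "b \<in> tvec"
      using dot by blast
    then show ?thesis
    proof cases
      case 1
      then show ?thesis using quad.unit[OF scov_const[of 1]]
        by (intro graded2[of "\<lambda>x. dot (uu x) (uu x)"]) (simp_all add: dot uu_scz dot_scale)
    next
      case 2
      then show ?thesis by (intro graded1[of b]) (simp_all add: dot uu_scz dot_scale sc vcov.vec)
    next
      case 3
      then show ?thesis
        by (intro graded1[of a]) (simp_all add: dot uu_scz dot_scale sc vcov.vec dot_comm)
    next
      case 4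
      then show ?thesis by (intro graded0) (simp_all add: dot scov_dot sc)
    qed
  next
    case det
    have sc: "\<And>t x. a (scz t x) = a x" if "a \<in> tvec" for a :: "'k pt \<Rightarrow> 'k vec"
      using that by (auto simp: tvec_def uu_scz)
    \<comment> \<open>A triple product containing \<open>u\<close> at least twice is zero and is
      treated as a linear part with zero coefficient.\<close>
    have z: "f (scz t x) = t * dot (uu x) ((\<lambda>x i. 0) x)"
      if "\<And>t x. f (scz t x) = 0" for t x using that by (simp add: dot_zero)
    have z': ?thesis if "\<And>t x. f (scz t x) = 0"
      by (rule graded1[OF vcov.zero z[OF that]])
    have x: "dot b (cross (\<lambda>i. t * a i) c) = t * dot a (cross c b)"
      "dot b (cross c (\<lambda>i. t * a i)) = t * dot a (cross b c)" for t and a b c :: "'k vec"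
      by (simp_all add: dot_def algebra_simps)
    have y: "dot a (cross a c) = 0" "dot a (cross c a) = 0" for a c :: "'k vec"
      by (simp_all add: dot_def algebra_simps)
    have w: "cross a a = (\<lambda>i. 0)" for a :: "'k vec"
      by (rule ix_eqI) simp_all
    show ?thesis
    proof (cases "a = uu")
      case a: True
      consider "b = uu" | "c = uu" | "b \<in> tvec" "c \<in> tvec" using det by blast
      then show ?thesis
      proof cases
        case 3
        then show ?thesis
          by (intro graded1[of "\<lambda>x. cross (b x) (c x)"])
            (simp_all add: det a uu_scz dot_scale sc vcov.cross)
      qed (intro z'; simp add: det a uu_scz dot_scale cross_scale y)+
    next
      case False
      then have a: "a \<in> tvec" using det by blast
      consider "b = uu" "c = uu" | "b = uu" "c \<in> tvec" | "b \<in> tvec" "c = uu" | "b \<in> tvec" "c \<in> tvec"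
        using det by blast
      then show ?thesis
      proof cases
        case 1
        then show ?thesis by (intro z') (simp add: det uu_scz dot_scale cross_scale w dot_zero)
      next
        case 2
        with a show ?thesis
          by (intro graded1[of "\<lambda>x. cross (c x) (a x)"]) (simp_all add: det uu_scz sc vcov.cross x)
      next
        case 3
        with a show ?thesis
          by (intro graded1[of "\<lambda>x. cross (a x) (b x)"]) (simp_all add: det uu_scz sc vcov.cross x)
      next
        case 4
        with a show ?thesis by (intro graded0) (simp_all add: det scov_det sc)
      qed
    qed
  qed
next
  case (const c)
  show ?case by (intro graded0) (simp_all add: scov_const)
next
  case (add f g)
  then obtain r0 X r2 s0 Y s2 where g: "graded f r0 X r2" "graded g s0 Y s2" by blast
  have "graded (\<lambda>x. f x + g x) (\<lambda>x. r0 x + s0 x) (\<lambda>x i. X x i + Y x i) (\<lambda>x. r2 x + s2 x)"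
    unfolding graded_def
  proof (intro conjI allI)
    fix x
    from g(1) obtain p where p: "\<And>t. f (scz t x) = poly p t" "coeff p 0 = r0 x"
      "coeff p 1 = dot (uu x) (X x)" "coeff p 2 = r2 x"
      unfolding graded_def by blast
    from g(2) obtain p' where p': "\<And>t. g (scz t x) = poly p' t" "coeff p' 0 = s0 x"
      "coeff p' 1 = dot (uu x) (Y x)" "coeff p' 2 = s2 x"
      unfolding graded_def by blast
    show "\<exists>p. (\<forall>t. f (scz t x) + g (scz t x) = poly p t) \<and> coeff p 0 = r0 x + s0 x
       \<and> coeff p 1 = dot (uu x) (\<lambda>i. X x i + Y x i) \<and> coeff p 2 = r2 x + s2 x"
      by (intro exI[of _ "p + p'"] conjI allI; simp only: p p' poly_add coeff_add dot_add)
  qed (use g in \<open>simp_all add: graded_def scov_add vcov.add quad.add\<close>)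
  then show ?case by blast
next
  case (mult f g)
  then obtain r0 X r2 s0 Y s2 where g: "graded f r0 X r2" "graded g s0 Y s2" by blast
  have "graded (\<lambda>x. f x * g x) (\<lambda>x. r0 x * s0 x) (\<lambda>x i. r0 x * Y x i + s0 x * X x i)
     (\<lambda>x. r0 x * s2 x + (dot (uu x) (X x) * dot (uu x) (Y x) + s0 x * r2 x))"
    unfolding graded_def
  proof (intro conjI allI)
    fix x
    from g(1) obtain p where p: "\<And>t. f (scz t x) = poly p t" "coeff p 0 = r0 x"
      "coeff p 1 = dot (uu x) (X x)" "coeff p 2 = r2 x"
      unfolding graded_def by blast
    from g(2) obtain p' where p': "\<And>t. g (scz t x) = poly p' t" "coeff p' 0 = s0 x"
      "coeff p' 1 = dot (uu x) (Y x)" "coeff p' 2 = s2 x"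
      unfolding graded_def by blast
    have c: "coeff (p * p') 0 = coeff p 0 * coeff p' 0"
      "coeff (p * p') 1 = coeff p 0 * coeff p' 1 + coeff p 1 * coeff p' 0"
      "coeff (p * p') 2 = coeff p 0 * coeff p' 2 + coeff p 1 * coeff p' 1 + coeff p 2 * coeff p' 0"
      by (simp_all add: coeff_mult numeral_2_eq_2)
    have c': "coeff (p * p') 1 = dot (uu x) (\<lambda>i. r0 x * Y x i + s0 x * X x i)"
      "coeff (p * p') 2 = r0 x * s2 x + (dot (uu x) (X x) * dot (uu x) (Y x) + s0 x * r2 x)"
      unfolding c p p' by (simp_all add: dot_add dot_scale algebra_simps)
    show "\<exists>p. (\<forall>t. f (scz t x) * g (scz t x) = poly p t) \<and> coeff p 0 = r0 x * s0 x
       \<and> coeff p 1 = dot (uu x) (\<lambda>i. r0 x * Y x i + s0 x * X x i)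
       \<and> coeff p 2 = r0 x * s2 x + (dot (uu x) (X x) * dot (uu x) (Y x) + s0 x * r2 x)"
      by (intro exI[of _ "p * p'"] conjI allI; simp only: c(1) c' p p' poly_mult)
  qed (use g in \<open>simp_all add: graded_def scov_intros vcov.intros quad_scale quad.intros\<close>)
  then show ?case by blast
qed

text \<open>Since \<open>s\<close> is quadratic in \<open>u\<close> on rank one points, the function
  is homogeneous of degree two in \<open>u\<close> and coincides with its quadratic part.\<close>

lemma C3_quad:
  fixes f :: "'k::field_char_0 fn"
  assumes "f \<in> C3"
  shows "(\<lambda>x. f (rank1 x)) \<in> quad"
proof -
  obtain r0 X r2 where g: "graded (\<lambda>x. f (rank1 x)) r0 X r2"
    using scov_subset_graded[OF C3_rank1[OF assms]] by blast
  from assms obtain c where c: "\<And>i j. c i j \<in> KT"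
    and f: "\<And>x. f x = (\<Sum>i\<in>{I1,I2,I3}. \<Sum>j\<in>{I1,I2,I3}. c i j x * sm x i j)"
    unfolding C3_def by blast
  have c': "c i j (rank1 (scz t x)) = c i j (rank1 x)" for i j t x
    using c[of i j] unfolding KT_def
    by (induction rule: alg.induct) (auto simp: scz_def)
  have s': "sm (rank1 (scz t x)) i j = t * (t * sm (rank1 x) i j)" for t x i j
    by (simp add: sm_def uu_scz field_simps)
  have "f (rank1 x) = r2 x" for x
  proof -
    from g obtain p where p: "\<And>t. f (rank1 (scz t x)) = poly p t" "coeff p 2 = r2 x"
      unfolding graded_def by blast
    have "poly p t = poly [:0, 0, f (rank1 x):] t" for t
      unfolding p(1)[symmetric] f c' s' by (simp add: algebra_simps)
    then have "p = [:0, 0, f (rank1 x):]" using poly_eq_poly_eq_iff by blast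
    with p(2) show ?thesis by (simp add: numeral_2_eq_2)
  qed
  with g show ?thesis unfolding graded_def by presburger
qed

section \<open>Generation of C3 over P and its two summands\<close>

subsection \<open>Modules over P\<close>

lemma P_const: "(\<lambda>x. c) \<in> P" and P_add: "f \<in> P \<Longrightarrow> g \<in> P \<Longrightarrow> (\<lambda>x. f x + g x) \<in> P"
  and P_mult: "f \<in> P \<Longrightarrow> g \<in> P \<Longrightarrow> (\<lambda>x. f x * g x) \<in> P"
  unfolding P_def by (rule alg.intros; assumption?)+

lemma mtr_comm: "mtr (mmul A B) = mtr (mmul B A)"
  by (simp add: mtr_def mmul_def algebra_simps)

lemma trp_comm: "trp i j = trp j i"
  unfolding trp_def by (subst mtr_comm) simp

lemma P_trp: "trp i j \<in> P"
proof -
  have "trp I1 I1 \<in> P" "trp I1 I2 \<in> P" "trp I1 I3 \<in> P" "trp I2 I2 \<in> P" "trp I2 I3 \<in> P" "trp I3 I3 \<in> P"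
    unfolding P_def by (rule alg.gen; simp)+
  then show ?thesis by (cases i; cases j; simp add: trp_comm[of I2 I1] trp_comm[of I3 I1] trp_comm[of I3 I2])
qed

lemma pspan_zero: "(\<lambda>x. 0) \<in> pspan G"
  unfolding pspan_def by (auto intro!: exI[of _ 0])

lemma pspan_step:
  fixes f :: "'k::comm_ring_1 fn"
  assumes "f \<in> pspan G" "p \<in> P" "g \<in> G"
  shows "(\<lambda>x. f x + p x * g x) \<in> pspan G"
proof -
  from assms(1) obtain n :: nat and q h where q: "\<forall>i<n. q i \<in> P \<and> h i \<in> G" "f = (\<lambda>x. \<Sum>i<n. q i x * h i x)"
    unfolding pspan_def by blast
  show ?thesis unfolding pspan_def
    by (rule CollectI, rule exI[of _ "Suc n"], rule exI[of _ "q(n := p)"], rule exI[of _ "h(n := g)"])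
      (use q assms(2,3) in \<open>auto simp: less_Suc_eq\<close>)
qed

lemma pspan_induct [consumes 1, case_names zero step]:
  fixes f :: "'k::comm_ring_1 fn"
  assumes "f \<in> pspan G" "Q (\<lambda>x. 0)"
    "\<And>f p g. f \<in> pspan G \<Longrightarrow> Q f \<Longrightarrow> p \<in> P \<Longrightarrow> g \<in> G \<Longrightarrow> Q (\<lambda>x. f x + p x * g x)"
  shows "Q f"
proof -
  from assms(1) obtain n :: nat and q h where q: "\<forall>i<n. q i \<in> P \<and> h i \<in> G" "f = (\<lambda>x. \<Sum>i<n. q i x * h i x)"
    unfolding pspan_def by blast
  have "m \<le> n \<Longrightarrow> (\<lambda>x. \<Sum>i<m. q i x * h i x) \<in> pspan G \<and> Q (\<lambda>x. \<Sum>i<m. q i x * h i x)" for m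
  proof (induction m)
    case 0
    show ?case using assms(2) pspan_zero by simp
  next
    case (Suc m)
    then show ?case using q(1) by (simp add: pspan_step assms(3))
  qed
  with q(2) show ?thesis by blast
qed

lemma pspan_add:
  fixes f :: "'k::comm_ring_1 fn"
  assumes "f \<in> pspan G" "h \<in> pspan G"
  shows "(\<lambda>x. f x + h x) \<in> pspan G"
  using assms(2)
proof (induction rule: pspan_induct)
  case (step h p g)
  then show ?case using pspan_step[of "\<lambda>x. f x + h x" G p g] by (simp add: add.assoc)
qed (simp add: assms(1))

lemma pspan_scale:
  fixes f :: "'k::comm_ring_1 fn"
  shows "f \<in> pspan G \<Longrightarrow> r \<in> P \<Longrightarrow> (\<lambda>x. r x * f x) \<in> pspan G"
proof (induction rule: pspan_induct)
  case zero
  show ?case by (simp add: pspan_zero)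
next
  case (step f p g)
  then show ?case using pspan_step[of "\<lambda>x. r x * f x" G "\<lambda>x. r x * p x" g] P_mult[of r p]
    by (simp add: distrib_left mult.assoc)
qed

lemma pspan_cscale: "f \<in> pspan G \<Longrightarrow> (\<lambda>x. c * f x) \<in> pspan G"
  using pspan_scale[OF _ P_const] by blast

lemma pspan_gen: "g \<in> G \<Longrightarrow> g \<in> pspan G"
  using pspan_step[OF pspan_zero P_const[of 1]] by simp

lemma pspan_subset:
  fixes G :: "'k::comm_ring_1 fn set"
  assumes "G \<subseteq> pspan H"
  shows "pspan G \<subseteq> pspan H"
proof
  fix f assume "f \<in> pspan G"
  then show "f \<in> pspan H"
  proof (induction rule: pspan_induct)
    case (step f p g)
    then show ?case using pspan_add[OF _ pspan_scale] assms by blast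
  qed (rule pspan_zero)
qed

lemma pspan_union: "pspan (G \<union> H) = {(\<lambda>x. a x + b x) | a b. a \<in> pspan G \<and> b \<in> pspan H}"
proof
  show "pspan (G \<union> H) \<subseteq> {(\<lambda>x. a x + b x) | a b. a \<in> pspan G \<and> b \<in> pspan H}"
  proof
    fix f assume "f \<in> pspan (G \<union> H)"
    then show "f \<in> {(\<lambda>x. a x + b x) | a b. a \<in> pspan G \<and> b \<in> pspan H}"
    proof (induction rule: pspan_induct)
      case zero
      show ?case using pspan_zero by force
    next
      case (step f p g)
      then obtain a b where ab: "a \<in> pspan G" "b \<in> pspan H" "f = (\<lambda>x. a x + b x)" by blast
      from step have "g \<in> G \<or> g \<in> H" by blast
      then show ?case
      proof
        assume "g \<in> G"
        then show ?thesis using ab pspan_step[OF ab(1) step.hyps(2), of g]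
          by (intro CollectI exI[of _ "\<lambda>x. a x + p x * g x"] exI[of _ b]) (simp add: add_ac)
      next
        assume "g \<in> H"
        then show ?thesis using ab pspan_step[OF ab(2) step.hyps(2), of g]
          by (intro CollectI exI[of _ a] exI[of _ "\<lambda>x. b x + p x * g x"]) (simp add: add_ac)
      qed
    qed
  qed
  have "pspan G \<subseteq> pspan (G \<union> H)" "pspan H \<subseteq> pspan (G \<union> H)"
    by (rule pspan_subset; auto intro: pspan_gen)+
  then show "{(\<lambda>x. a x + b x) | a b. a \<in> pspan G \<and> b \<in> pspan H} \<subseteq> pspan (G \<union> H)"
    using pspan_add by blast
qed

lemma pspan_phi: "pspan (set E) = phi E ` Pvec (length E)"
proof
  show "pspan (set E) \<subseteq> phi E ` Pvec (length E)"
  proof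
    fix f assume "f \<in> pspan (set E)"
    then show "f \<in> phi E ` Pvec (length E)"
    proof (induction rule: pspan_induct)
      case zero
      show ?case
        by (rule image_eqI[of _ _ "\<lambda>i x. 0"]) (simp_all add: phi_def Pvec_def P_const)
    next
      case (step f p g)
      then obtain q where q: "q \<in> Pvec (length E)" "f = phi E q" by blast
      from step obtain k where k: "k < length E" "g = E ! k" by (auto simp: in_set_conv_nth)
      have "phi E (q(k := \<lambda>x. q k x + p x)) x = f x + p x * g x" for x
      proof -
        have "(\<Sum>i<length E. (q(k := \<lambda>x. q k x + p x)) i x * (E ! i) x)
          = (\<Sum>i<length E. q i x * (E ! i) x + (if i = k then p x * g x else 0))"
          by (rule sum.cong) (auto simp: k distrib_right)
        then show ?thesis using k by (simp add: phi_def q sum.distrib)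
      qed
      then show ?case using q k step
        by (intro image_eqI[of _ _ "q(k := \<lambda>x. q k x + p x)"] ext)
          (simp_all add: Pvec_def P_add del: fun_upd_apply, simp add: P_add)
    qed
  qed
  show "phi E ` Pvec (length E) \<subseteq> pspan (set E)"
  proof
    fix f assume "f \<in> phi E ` Pvec (length E)"
    then obtain p where "\<forall>i<length E. p i \<in> P" "f = phi E p" by (auto simp: Pvec_def)
    then show "f \<in> pspan (set E)" unfolding phi_def pspan_def
      by (intro CollectI exI[of _ "length E"] exI[of _ p] exI[of _ "\<lambda>i. E ! i"]) simp
  qed
qed

subsection \<open>The generators as values of s on vectors\<close>

definition bil :: "'k::field_char_0 pt \<Rightarrow> 'k vec \<Rightarrow> 'k vec \<Rightarrow> 'k" where
  "bil x a b = dot a (mv (sm x) b)"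

lemma sm_sym: "sm x I2 I1 = sm x I1 I2" "sm x I3 I1 = sm x I1 I3" "sm x I3 I2 = sm x I2 I3"
  by (simp_all add: sm_def add.commute)

lemma sm_tr: "sm x I3 I3 = - sm x I1 I1 - sm x I2 I2"
  by (simp add: sm_def field_simps)

lemmas bil_expand = bil_def dot_def mv_def sm_sym sm_tr

lemma bil_sym: "bil x a b = bil x b a"
  by (simp add: bil_expand algebra_simps)

lemma bil_add: "bil x (\<lambda>i. a i + b i) c = bil x a c + bil x b c"
  by (simp add: bil_def dot_add)

lemma bil_scale: "bil x (\<lambda>i. r * a i) c = r * bil x a c"
  by (simp add: bil_def dot_scale)

lemma bil_add2: "bil x c (\<lambda>i. a i + b i) = bil x c a + bil x c b"
  using bil_add bil_sym by metis

lemma bil_scale2: "bil x c (\<lambda>i. r * a i) = r * bil x c a"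
  using bil_scale bil_sym by metis

lemma bil_zero: "bil x (\<lambda>i. 0) c = 0" "bil x c (\<lambda>i. 0) = 0"
  by (simp_all add: bil_expand)

text \<open>The trace-free condition on \<open>s\<close> makes its second compound linear in \<open>s\<close>.\<close>

lemma bil_cross_cross:
  "bil x (cross a b) (cross c d) = (- 1 * dot b d) * bil x a c + (dot b c * bil x a d
     + (dot a d * bil x b c + (- 1 * dot a c) * bil x b d))"
  by (simp add: bil_expand algebra_simps)

text \<open>Expansion of \<open>v\<close> in the cross products of \<open>a\<close>,
  \<open>b\<close>, \<open>c\<close>, which form the dual basis up to the determinant. It trades a
  determinant for cross products inside \<open>s\<close>.\<close>

lemma bil_det:
  "dot a (cross b c) * bil x v w = dot v a * bil x w (cross b c)
     + (dot v b * bil x w (cross c a) + dot v c * bil x w (cross a b))"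
  by (simp add: bil_expand algebra_simps)

text \<open>The cyclic sum of the tensors of \<open>a\<close> with \<open>cross b c\<close> is the
  determinant times the identity, so this is the trace condition on \<open>s\<close>.\<close>

lemma bil_cyc: "bil x a (cross b c) + bil x b (cross c a) + bil x c (cross a b) = 0"
  by (simp add: bil_expand algebra_simps)

lemma trp_dot: "trp i j x = - 2 * dot (vv x i) (vv x j)"
  by (simp add: trp_def mtr_def mmul_def dot_def algebra_simps)

lemma e2_bil: "e2 i j = (\<lambda>x. bil x (vv x i) (vv x j))"
  by (rule ext) (simp add: e2_def mtr_def mmul_def bil_expand algebra_simps)

lemma eiij_bil: "eiij i j = (\<lambda>x. 2 * bil x (vv x i) (cross (vv x i) (vv x j)))"
  by (rule ext) (simp add: eiij_def mtr_def mmul_def mcomm_def bil_expand algebra_simps)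

lemma e132_bil: "e132 = (\<lambda>x. - 2 * (bil x (vv x I1) (cross (vv x I2) (vv x I3))
    + bil x (vv x I3) (cross (vv x I2) (vv x I1))))"
  by (rule ext) (simp add: e132_def mtr_def mmul_def madd_def mcomm_def bil_expand algebra_simps)

lemma e123_bil: "e123 = (\<lambda>x. - 2 * (bil x (vv x I1) (cross (vv x I3) (vv x I2))
    + bil x (vv x I2) (cross (vv x I3) (vv x I1))))"
  by (rule ext) (simp add: e123_def mtr_def mmul_def madd_def mcomm_def bil_expand algebra_simps)

definition b3 :: "ix \<Rightarrow> ix \<Rightarrow> ix \<Rightarrow> 'k::field_char_0 fn" where
  "b3 i j k = (\<lambda>x. bil x (vv x i) (cross (vv x j) (vv x k)))"

lemma b3_anti: "b3 i k j = (\<lambda>x. - 1 * b3 i j k x)"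
  unfolding b3_def by (subst cross_anti) (simp only: bil_scale2)

lemma b3_same: "b3 i j j = (\<lambda>x. 0)"
  unfolding b3_def by (rule ext) (simp add: bil_expand algebra_simps)

lemma pspan_E0: "e2 i j \<in> pspan (set E0)"
proof -
  have "e2 i j \<in> set E0 \<or> e2 j i \<in> set E0" by (cases i; cases j) (simp_all add: E0_def)
  moreover have "e2 i j = e2 j i" by (simp add: e2_bil bil_sym)
  ultimately show ?thesis by (metis pspan_gen)
qed

lemma pspan_E1: "(b3 i j k :: 'k::field_char_0 fn) \<in> pspan (set E1)"
proof -
  let ?M = "pspan (set E1) :: 'k fn set"
  note cl = pspan_add pspan_cscale
  have E: "e \<in> ?M" if "e \<in> set E1" for e :: "'k fn" using that by (rule pspan_gen)
  have iij: "b3 i i j \<in> ?M" for i j :: ix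
  proof (cases "i = j")
    case True
    then show ?thesis by (simp add: b3_same pspan_zero)
  next
    case False
    then have "eiij i j \<in> set E1" by (cases i; cases j) (simp_all add: E1_def)
    from pspan_cscale[OF E[OF this], of "1/2"] show ?thesis by (simp add: eiij_bil b3_def)
  qed
  have cyc: "b3 I1 I2 I3 x + b3 I2 I3 I1 x + b3 I3 I1 I2 x = 0" for x :: "'k pt"
    unfolding b3_def by (rule bil_cyc)
  have e: "e132 x = - 2 * b3 I1 I2 I3 x + 2 * b3 I3 I1 I2 x"
    "e123 x = 2 * b3 I1 I2 I3 x - 2 * b3 I2 I3 I1 x" for x :: "'k pt"
    unfolding e132_bil e123_bil b3_def
    by (simp_all add: cross_anti[of "vv x I2" "vv x I1"] cross_anti[of "vv x I3" "vv x I2"] bil_scale2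
        bil_expand algebra_simps)
  \<comment> \<open>The difference \<open>e123 - e132\<close> is 4 times the first cyclic term minus
    2 times the other two; the cyclic relation turns this into 6 times the first.\<close>
  have "(\<lambda>x. (1/6) * (e123 x + (- 1) * e132 x)) \<in> ?M"
    by (intro cl E) (simp_all add: E1_def)
  moreover have "(\<lambda>x. (1/6) * (e123 x + (- 1) * e132 x)) = (b3 I1 I2 I3 :: 'k fn)"
  proof
    fix x :: "'k pt"
    have "6 * b3 I1 I2 I3 x = e123 x - e132 x" using cyc[of x] unfolding e by algebra
    then show "(1/6) * (e123 x + (- 1) * e132 x) = b3 I1 I2 I3 x" by (simp add: field_simps)
  qed
  ultimately have 1: "b3 I1 I2 I3 \<in> ?M" by simp
  have "(\<lambda>x. b3 I1 I2 I3 x + (- 1/2) * e123 x) \<in> ?M"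
    by (intro cl E 1) (simp_all add: E1_def)
  moreover have "(\<lambda>x. b3 I1 I2 I3 x + (- 1/2) * e123 x) = (b3 I2 I3 I1 :: 'k fn)"
    unfolding e by (simp add: field_simps)
  ultimately have 2: "b3 I2 I3 I1 \<in> ?M" by simp
  have "(\<lambda>x. b3 I1 I2 I3 x + (1/2) * e132 x) \<in> ?M"
    by (intro cl E 1) (simp_all add: E1_def)
  moreover have "(\<lambda>x. b3 I1 I2 I3 x + (1/2) * e132 x) = (b3 I3 I1 I2 :: 'k fn)"
    unfolding e by (simp add: field_simps)
  ultimately have 3: "b3 I3 I1 I2 \<in> ?M" by simp
  have anti: "b3 i k j \<in> ?M" if "b3 i j k \<in> ?M" for i j k
    using that unfolding b3_anti[of i k j] by (rule pspan_cscale)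
  have eq: "b3 i j j \<in> ?M" for i j by (simp add: b3_same pspan_zero)
  show ?thesis
    using 1 2 3 anti[OF 1] anti[OF 2] anti[OF 3] iij anti[OF iij] eq
    by (cases i; cases j; cases k) simp_all
qed

abbreviation Egen :: "'k::field_char_0 fn set" where
  "Egen \<equiv> pspan (set E0 \<union> set E1)"

lemma E0_E1_gen: "pspan (set E0) \<subseteq> Egen" "pspan (set E1) \<subseteq> Egen"
  by (rule pspan_subset; auto intro: pspan_gen)+

lemma Egen_vec: "a \<in> tvec \<Longrightarrow> b \<in> tvec \<Longrightarrow> (\<lambda>x. bil x (a x) (b x)) \<in> Egen"
  using pspan_E0 E0_E1_gen unfolding tvec_def e2_bil by blast

lemma Egen_vec_cross:
  "a \<in> tvec \<Longrightarrow> b \<in> tvec \<Longrightarrow> c \<in> tvec \<Longrightarrow> (\<lambda>x. bil x (a x) (cross (b x) (c x))) \<in> Egen"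
  using pspan_E1 E0_E1_gen unfolding tvec_def b3_def by blast

lemma P_dot:
  assumes "a \<in> tvec" "b \<in> tvec"
  shows "(\<lambda>x. dot (a x) (b x)) \<in> (P :: 'k::field_char_0 fn set)"
proof -
  from assms obtain i j where a: "a = (\<lambda>x. vv x i)" "b = (\<lambda>x. vv x j)" by (auto simp: tvec_def)
  have "(\<lambda>x. (- 1 / 2) * trp i j x) \<in> (P :: 'k fn set)" by (intro P_mult P_const P_trp)
  then show ?thesis by (simp add: a trp_dot)
qed

lemma Egen_cross_cross:
  "a \<in> tvec \<Longrightarrow> b \<in> tvec \<Longrightarrow> c \<in> tvec \<Longrightarrow> d \<in> tvec \<Longrightarrow>
    (\<lambda>x. bil x (cross (a x) (b x)) (cross (c x) (d x))) \<in> Egen"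
  unfolding bil_cross_cross by (intro pspan_add pspan_scale P_mult P_const P_dot Egen_vec)

definition tdet :: "'k::comm_ring_1 fn" where
  "tdet x = dot (vv x I1) (cross (vv x I2) (vv x I3))"

lemma Egen_tdet_vec: "a \<in> tvec \<Longrightarrow> b \<in> tvec \<Longrightarrow> (\<lambda>x. tdet x * bil x (a x) (b x)) \<in> Egen"
  unfolding tdet_def bil_det by (intro pspan_add pspan_scale P_dot Egen_vec_cross vv_tvec)

lemma Egen_tdet_cross:
  "a \<in> tvec \<Longrightarrow> b \<in> tvec \<Longrightarrow> c \<in> tvec \<Longrightarrow> (\<lambda>x. tdet x * bil x (a x) (cross (b x) (c x))) \<in> Egen"
  unfolding tdet_def bil_det by (intro pspan_add pspan_scale P_dot Egen_cross_cross vv_tvec)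

text \<open>The determinant is an invariant outside the six generators of \<open>P\<close>. It
  exchanges the two kinds of generators: \<open>bil_det\<close> turns a vector argument of
  \<open>s\<close> into cross products, and \<open>bil_cross_cross\<close> reduces pairs of cross
  products again.\<close>

lemma Egen_tdet:
  fixes f :: "'k::field_char_0 fn"
  assumes "f \<in> Egen"
  shows "(\<lambda>x. tdet x * f x) \<in> Egen"
  using assms
proof (induction rule: pspan_induct)
  case zero
  show ?case by (simp add: pspan_zero)
next
  case (step f p g)
  have 0: "(\<lambda>x. tdet x * e2 i j x) \<in> (Egen :: 'k fn set)" for i j
    unfolding e2_bil by (intro Egen_tdet_vec vv_tvec)
  have 1: "(\<lambda>x. tdet x * b3 i j k x) \<in> (Egen :: 'k fn set)" for i j k
    unfolding b3_def by (intro Egen_tdet_cross vv_tvec)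
  have 2: "(\<lambda>x. tdet x * eiij i j x) \<in> (Egen :: 'k fn set)" for i j
    using pspan_cscale[OF 1[of i i j], of 2] unfolding eiij_bil b3_def by (simp add: mult_ac)
  have 3: "(\<lambda>x. tdet x * e132 x) \<in> (Egen :: 'k fn set)"
    using pspan_cscale[OF pspan_add[OF 1[of I1 I2 I3] 1[of I3 I2 I1]], of "- 2"]
    unfolding e132_bil b3_def by (simp add: algebra_simps)
  have 4: "(\<lambda>x. tdet x * e123 x) \<in> (Egen :: 'k fn set)"
    using pspan_cscale[OF pspan_add[OF 1[of I1 I3 I2] 1[of I2 I3 I1]], of "- 2"]
    unfolding e123_bil b3_def by (simp add: algebra_simps)
  have "(\<lambda>x. tdet x * g x) \<in> Egen"
    using step.hyps(3) 0 2 3 4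
    unfolding set_append[symmetric] E0_def E1_def list.set Un_insert_left Un_empty_left insert_iff
    by blast
  from pspan_add[OF step.IH pspan_scale[OF this step.hyps(2)]]
  show ?case by (simp add: algebra_simps)
qed

text \<open>By alternation the factor is the sign of the index permutation, or 0 when an index
  repeats.\<close>

lemma tvec_det:
  assumes "a \<in> tvec" "b \<in> tvec" "c \<in> tvec"
  shows "\<exists>r. \<forall>x. dot (a x) (cross (b x) (c x)) = r * (tdet x :: 'k::comm_ring_1)"
proof -
  from assms obtain i j k where a: "a = (\<lambda>x. vv x i)" "b = (\<lambda>x. vv x j)" "c = (\<lambda>x. vv x k)"
    by (auto simp: tvec_def)
  have "(\<forall>x::'k pt. dot (vv x i) (cross (vv x j) (vv x k)) = 0 * tdet x)
     \<or> (\<forall>x::'k pt. dot (vv x i) (cross (vv x j) (vv x k)) = 1 * tdet x)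
     \<or> (\<forall>x::'k pt. dot (vv x i) (cross (vv x j) (vv x k)) = (- 1) * tdet x)"
    by (cases i; cases j; cases k; (rule disjI1, simp add: tdet_def dot_def algebra_simps; fail)?;
        (rule disjI2, rule disjI1, simp add: tdet_def dot_def algebra_simps; fail)?;
        (rule disjI2, rule disjI2, simp add: tdet_def dot_def algebra_simps; fail)?)
  then show ?thesis unfolding a by blast
qed

text \<open>Closure under dot products and under \<open>tdet\<close> makes the \<open>P\<close>-span
  a module over all scalar covariants of the three vectors.\<close>

lemma Egen_scov:
  assumes "r \<in> scov tvec" "f \<in> Egen"
  shows "(\<lambda>x. r x * f x) \<in> Egen"
  using assms unfolding scov_def
proof (induction arbitrary: f rule: alg.induct)
  case (gen g)
  then consider (dot) a b where "a \<in> tvec" "b \<in> tvec" "g = (\<lambda>x. dot (a x) (b x))"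
    | (det) a b c where "a \<in> tvec" "b \<in> tvec" "c \<in> tvec" "g = (\<lambda>x. dot (a x) (cross (b x) (c x)))"
    by blast
  then show ?case
  proof cases
    case dot
    then show ?thesis using gen(2) by (simp add: pspan_scale P_dot)
  next
    case det
    then obtain r where "g = (\<lambda>x. r * tdet x)" using tvec_det by blast
    then show ?thesis using pspan_cscale[OF Egen_tdet[OF gen(2)], of r] by (simp add: mult.assoc)
  qed
next
  case (const c)
  then show ?case by (simp add: pspan_cscale)
next
  case (add g h)
  then show ?case by (simp add: distrib_right pspan_add)
next
  case (mult g h)
  then show ?case by (simp add: mult.assoc)
qed

lemma Egen_bil_vec: "X \<in> vcov tvec \<Longrightarrow> a \<in> tvec \<Longrightarrow> (\<lambda>x. bil x (a x) (X x)) \<in> Egen"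
  by (induction rule: vcov.induct)
    (simp_all add: bil_zero pspan_zero bil_add2 bil_scale2 pspan_add Egen_scov Egen_vec Egen_vec_cross)

lemma Egen_bil_cross:
  "X \<in> vcov tvec \<Longrightarrow> a \<in> tvec \<Longrightarrow> b \<in> tvec \<Longrightarrow> (\<lambda>x. bil x (cross (a x) (b x)) (X x)) \<in> Egen"
proof (induction rule: vcov.induct)
  case (vec c)
  then show ?case by (subst bil_sym) (simp add: Egen_vec_cross)
qed (simp_all add: bil_zero pspan_zero bil_add2 bil_scale2 pspan_add Egen_scov Egen_cross_cross)

lemma Egen_bil: "X \<in> vcov tvec \<Longrightarrow> Y \<in> vcov tvec \<Longrightarrow> (\<lambda>x. bil x (X x) (Y x)) \<in> Egen"
  by (induction rule: vcov.induct)
    (simp_all add: bil_zero pspan_zero bil_add bil_scale pspan_add Egen_scov Egen_bil_vec Egen_bil_cross)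

subsection \<open>Generation of C3\<close>

definition setu :: "'k::comm_ring_1 pt \<Rightarrow> 'k vec \<Rightarrow> 'k pt" where
  "setu x a = (\<lambda>v. case v of T k p \<Rightarrow> x (T k p) | Z i j \<Rightarrow> if i = j then a i else 0)"

lemma uu_setu [simp]: "uu (setu x a) = a" "vv (setu x a) = vv x"
  by (simp add: uu_def setu_def) (rule ext, rule ix_eqI, simp_all add: setu_def)

lemma scov_setu: "r \<in> scov tvec \<Longrightarrow> r (setu x a) = r x"
  unfolding scov_def by (induction rule: alg.induct) (auto simp: tvec_def)

lemma vcov_setu: "X \<in> vcov tvec \<Longrightarrow> X (setu x a) = X x"
  by (induction rule: vcov.induct) (auto simp: tvec_def scov_setu)

definition ev :: "ix \<Rightarrow> 'k::comm_ring_1 vec" where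
  "ev k = (\<lambda>i. if i = k then 1 else 0)"

text \<open>Polarisation: replaces \<open>u u\<^sup>T\<close> by \<open>s\<close> in a function quadratic in \<open>u\<close>.\<close>

definition polz :: "'k::field_char_0 fn \<Rightarrow> 'k fn" where
  "polz \<phi> x =
     sm x I1 I1 * \<phi> (setu x (ev I1)) + sm x I2 I2 * \<phi> (setu x (ev I2)) + sm x I3 I3 * \<phi> (setu x (ev I3))
   + sm x I1 I2 * (\<phi> (setu x (\<lambda>i. ev I1 i + ev I2 i)) - \<phi> (setu x (ev I1)) - \<phi> (setu x (ev I2)))
   + sm x I1 I3 * (\<phi> (setu x (\<lambda>i. ev I1 i + ev I3 i)) - \<phi> (setu x (ev I1)) - \<phi> (setu x (ev I3)))
   + sm x I2 I3 * (\<phi> (setu x (\<lambda>i. ev I2 i + ev I3 i)) - \<phi> (setu x (ev I2)) - \<phi> (setu x (ev I3)))"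

lemma polz_add: "polz (\<lambda>x. f x + g x) = (\<lambda>x. polz f x + polz g x)"
  by (rule ext) (simp add: polz_def algebra_simps)

text \<open>Polarisation sends the square of the length of \<open>u\<close> to the trace of
  \<open>s\<close>, which is 0, and a product of two linear forms in \<open>u\<close> to the value
  of \<open>s\<close> on their coefficient vectors.\<close>

lemma polz_quad:
  fixes f :: "'k::field_char_0 fn"
  assumes "f \<in> quad"
  shows "polz f \<in> Egen"
  using assms
proof (induction rule: quad.induct)
  case zero
  have "polz (\<lambda>x. 0) = (\<lambda>x. 0 :: 'k)" by (rule ext) (simp add: polz_def)
  then show ?case by (simp add: pspan_zero)
next
  case (unit r)
  then have "polz (\<lambda>x. r x * dot (uu x) (uu x)) = (\<lambda>x. 0)"
    by (intro ext) (simp add: polz_def scov_setu dot_def ev_def sm_tr algebra_simps)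
  then show ?case by (simp add: pspan_zero)
next
  case (prod X Y)
  then have "polz (\<lambda>x. dot (uu x) (X x) * dot (uu x) (Y x)) = (\<lambda>x. bil x (X x) (Y x))"
    by (intro ext) (simp add: polz_def vcov_setu bil_expand ev_def algebra_simps)
  then show ?case using Egen_bil[OF prod] by simp
next
  case (add f g)
  then show ?case by (simp add: polz_add pspan_add)
qed

lemma C3_polz:
  fixes f :: "'k::field_char_0 fn"
  assumes "f \<in> C3"
  shows "polz (\<lambda>x. f (rank1 x)) = f"
proof
  fix x :: "'k pt"
  from assms obtain c where c: "\<And>i j. c i j \<in> KT"
    and f: "\<And>x. f x = (\<Sum>i\<in>{I1,I2,I3}. \<Sum>j\<in>{I1,I2,I3}. c i j x * sm x i j)"
    unfolding C3_def by blast
  have c': "c i j (rank1 (setu x a)) = c i j x" for i j a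
    using c[of i j] unfolding KT_def
    by (induction rule: alg.induct) (auto simp: setu_def)
  \<comment> \<open>The trace correction disappears after polarisation, again because
    \<open>sm x\<close> has trace 0; what is left is \<open>f\<close> itself by linearity in
    \<open>s\<close>.\<close>
  have s: "sm (rank1 (setu x a)) i j = a i * a j - (if i = j then dot a a / 3 else 0)" for a i j
    by (simp add: sm_def dot_def)
  show "polz (\<lambda>x. f (rank1 x)) x = f x"
    unfolding polz_def f c' by (simp add: s dot_def ev_def sm_sym sm_tr field_simps)
qed

lemma C3_subset: "C3 \<subseteq> Egen"
  using C3_polz polz_quad C3_quad by (metis subsetI)

lemma KT_tm: "(\<lambda>x. tm x k i j) \<in> KT"
proof -
  have T: "(\<lambda>x. x (T k p)) \<in> KT" for k p unfolding KT_def by (rule alg.gen) blast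
  have N: "(\<lambda>x. - x (T k p)) \<in> KT" for k p
    using alg.mult[OF alg.const[of "- 1"] T[unfolded KT_def]] unfolding KT_def by simp
  have Z: "(\<lambda>x. 0) \<in> KT" unfolding KT_def by (rule alg.const)
  show ?thesis by (cases i; cases j) (simp_all add: T N Z)
qed

text \<open>Equivariant polynomial matrices. Taking the trace of such a matrix times
  \<open>s\<close> gives an element of \<open>C3\<close>, and sums, products and commutators stay in
  this class.\<close>

definition covmat :: "('k::comm_ring_1 pt \<Rightarrow> 'k m3) \<Rightarrow> bool" where
  "covmat A \<longleftrightarrow> (\<forall>i j. (\<lambda>x. A x i j) \<in> KT) \<and>
     (\<forall>g\<in>SO3. \<forall>x. A (act g x) = mmul (mmul g (A x)) (mT g))"

lemma KT_add: "f \<in> KT \<Longrightarrow> g \<in> KT \<Longrightarrow> (\<lambda>x. f x + g x) \<in> KT"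
  and KT_mult: "f \<in> KT \<Longrightarrow> g \<in> KT \<Longrightarrow> (\<lambda>x. f x * g x) \<in> KT"
  and KT_const: "(\<lambda>x. c) \<in> KT"
  unfolding KT_def by (rule alg.intros; assumption?)+

lemma conj_mmul:
  assumes "g \<in> SO3"
  shows "mmul (mmul (mmul g A) (mT g)) (mmul (mmul g B) (mT g)) = mmul (mmul g (mmul A B)) (mT g)"
proof -
  have "mmul (mmul (mmul g A) (mT g)) (mmul (mmul g B) (mT g))
    = mmul (mmul g A) (mmul (mmul (mT g) g) (mmul B (mT g)))"
    by (simp only: mmul_assoc)
  also have "\<dots> = mmul (mmul g (mmul A B)) (mT g)" using assms by (simp add: SO3_def mmul_assoc)
  finally show ?thesis .
qed

lemma conj_madd:
  "mmul (mmul g (madd A B)) (mT g) = madd (mmul (mmul g A) (mT g)) (mmul (mmul g B) (mT g))"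
  by (simp add: mmul_def madd_def algebra_simps)

lemma conj_minus:
  "mmul (mmul g (\<lambda>i j. A i j - B i j)) (mT g)
   = (\<lambda>i j. mmul (mmul g A) (mT g) i j - mmul (mmul g B) (mT g) i j)"
  by (simp add: mmul_def algebra_simps)

lemma conj_mtr: "g \<in> SO3 \<Longrightarrow> mtr (mmul (mmul g A) (mT g)) = mtr A"
  by (subst mtr_comm) (simp add: mmul_assoc[symmetric] SO3_def)

lemma covmat_tm: "covmat (\<lambda>x. tm x k)"
  by (simp add: covmat_def KT_tm tm_act)

lemma covmat_mmul: "covmat A \<Longrightarrow> covmat B \<Longrightarrow> covmat (\<lambda>x. mmul (A x) (B x))"
  unfolding covmat_def by (simp add: conj_mmul) (simp add: mmul_def KT_add KT_mult)

lemma covmat_madd: "covmat A \<Longrightarrow> covmat B \<Longrightarrow> covmat (\<lambda>x. madd (A x) (B x))"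
  unfolding covmat_def by (simp add: conj_madd) (simp add: madd_def KT_add)

lemma covmat_mcomm: "covmat A \<Longrightarrow> covmat B \<Longrightarrow> covmat (\<lambda>x. mcomm (A x) (B x))"
proof -
  assume A: "covmat A" and B: "covmat B"
  note AB = covmat_mmul[OF A B] covmat_mmul[OF B A]
  have "(\<lambda>x. mmul (A x) (B x) i j + (- 1) * mmul (B x) (A x) i j) \<in> KT" for i j
    using AB by (intro KT_add KT_mult KT_const) (simp_all add: covmat_def)
  then show ?thesis using AB unfolding covmat_def mcomm_def by (simp add: conj_minus)
qed

lemma zm_act: "zm (act g x) = mmul (mmul g (zm x)) (mT g)"
  by (intro ext) (simp add: zm_def)

lemma sm_mat: "sm x = (\<lambda>i j. (zm x i j + zm x j i) / 2 - mtr (zm x) / 3 * mid i j)"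
  by (intro ext) (simp add: sm_def zm_def mtr_def mid_def)

lemma conj_sm:
  fixes A :: "'k::field_char_0 m3"
  shows "mmul (mmul g (\<lambda>i j. (A i j + A j i) / 2 - c * B i j)) (mT g)
   = (\<lambda>i j. (mmul (mmul g A) (mT g) i j + mmul (mmul g A) (mT g) j i) / 2
        - c * mmul (mmul g B) (mT g) i j)"
  by (intro ext) (simp add: mmul_def mT_def field_simps)

lemma sm_act:
  assumes "g \<in> SO3"
  shows "sm (act g x) = mmul (mmul g (sm x)) (mT g)"
  unfolding sm_mat conj_sm zm_act conj_mtr[OF assms] by (simp add: SO3_orth[OF assms])

lemma covmat_C3:
  assumes "covmat A"
  shows "(\<lambda>x. mtr (mmul (A x) (sm x))) \<in> C3"
proof -
  have "SO3_inv (\<lambda>x. mtr (mmul (A x) (sm x)))"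
    using assms unfolding SO3_inv_def covmat_def by (simp add: sm_act conj_mmul conj_mtr)
  moreover have "mtr (mmul (A x) (sm x)) = (\<Sum>i\<in>{I1,I2,I3}. \<Sum>j\<in>{I1,I2,I3}. A x j i * sm x i j)" for x
    by (simp add: mtr_def mmul_def)
  ultimately show ?thesis using assms unfolding C3_def covmat_def
    by (intro CollectI conjI exI[of _ "\<lambda>i j x. A x j i"]) simp_all
qed

lemma E_C3: "set E0 \<union> set E1 \<subseteq> (C3 :: 'k::field_char_0 fn set)"
proof -
  have "e2 i j \<in> (C3 :: 'k fn set)" "eiij i j \<in> (C3 :: 'k fn set)"
    "e132 \<in> (C3 :: 'k fn set)" "e123 \<in> (C3 :: 'k fn set)" for i j
    unfolding e2_def eiij_def e132_def e123_def
    by (intro covmat_C3 covmat_mmul covmat_madd covmat_mcomm covmat_tm)+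
  then show ?thesis by (simp add: E0_def E1_def)
qed

lemma P_inv:
  fixes p :: "'k::comm_ring_1 fn"
  assumes "p \<in> P"
  shows "p \<in> KT \<and> SO3_inv p"
  using assms unfolding P_def
proof (induction rule: alg.induct)
  case (gen f)
  then obtain i j where f: "f = trp i j" by blast
  have c: "covmat (\<lambda>x :: 'k pt. mmul (tm x i) (tm x j))" by (intro covmat_mmul covmat_tm)
  have "SO3_inv (trp i j :: 'k fn)" unfolding SO3_inv_def trp_def by (simp add: tm_act conj_mmul conj_mtr)
  moreover have "trp i j \<in> (KT :: 'k fn set)" unfolding trp_def mtr_def
    using c by (intro KT_add) (simp_all add: covmat_def)
  ultimately show ?case by (simp add: f)
qed (auto simp: SO3_inv_def KT_const KT_add KT_mult)

lemma Egen_subset: "Egen \<subseteq> (C3 :: 'k::field_char_0 fn set)"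
proof
  fix f :: "'k fn" assume "f \<in> Egen"
  then show "f \<in> C3"
  proof (induction rule: pspan_induct)
    case zero
    show ?case unfolding C3_def SO3_inv_def
      by (intro CollectI conjI exI[of _ "\<lambda>i j x. 0"]) (simp_all add: KT_const)
  next
    case (step f p g)
    with E_C3 have "g \<in> C3" by blast
    then obtain d where d: "SO3_inv g" "\<And>i j. d i j \<in> KT"
      "\<And>x. g x = (\<Sum>i\<in>{I1,I2,I3}. \<Sum>j\<in>{I1,I2,I3}. d i j x * sm x i j)"
      unfolding C3_def by blast
    from step.IH obtain c where c: "SO3_inv f" "\<And>i j. c i j \<in> KT"
      "\<And>x. f x = (\<Sum>i\<in>{I1,I2,I3}. \<Sum>j\<in>{I1,I2,I3}. c i j x * sm x i j)"
      unfolding C3_def by blast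
    note p = P_inv[OF step.hyps(2)]
    have "SO3_inv (\<lambda>x. f x + p x * g x)" using c(1) d(1) p by (simp add: SO3_inv_def)
    moreover have "f x + p x * g x
        = (\<Sum>i\<in>{I1,I2,I3}. \<Sum>j\<in>{I1,I2,I3}. (c i j x + p x * d i j x) * sm x i j)" for x
      unfolding c(3) d(3) by (simp add: algebra_simps)
    ultimately show ?case unfolding C3_def
      by (intro CollectI conjI exI[of _ "\<lambda>i j x. c i j x + p x * d i j x"])
        (simp_all add: KT_add KT_mult c d p)
  qed
qed

theorem C3_eq: "C3 = Egen"
  using C3_subset Egen_subset by blast

subsection \<open>The GL3-orbits of the generators\<close>

definition tcomb :: "'k::comm_ring_1 pt \<Rightarrow> 'k vec \<Rightarrow> 'k vec" where
  "tcomb x a = (\<lambda>i. a I1 * vv x I1 i + a I2 * vv x I2 i + a I3 * vv x I3 i)"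

lemma vv_glsub: "vv (glsub g x) k = tcomb x (\<lambda>l. g l k)"
  by (rule ix_eqI) (simp_all add: tcomb_def glsub_def)

lemma sm_glsub: "sm (glsub g x) = sm x"
  by (intro ext) (simp add: sm_def glsub_def)

lemma bil_glsub: "bil (glsub g x) = bil x"
  by (intro ext) (simp add: bil_def sm_glsub)

text \<open>The image of \<open>e_11\<close> under \<open>g\<close> depends only on the first column
  of \<open>g\<close>, so its orbit is parametrised by nonzero vectors; likewise \<open>q1\<close>
  depends on two independent columns.\<close>

definition q0 :: "'k::field_char_0 vec \<Rightarrow> 'k fn" where
  "q0 a = (\<lambda>x. bil x (tcomb x a) (tcomb x a))"

definition q1 :: "'k::field_char_0 vec \<Rightarrow> 'k vec \<Rightarrow> 'k fn" where
  "q1 a b = (\<lambda>x. 2 * bil x (tcomb x a) (cross (tcomb x a) (tcomb x b)))"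

lemma glact_e2: "glact g (e2 I1 I1) = q0 (\<lambda>l. g l I1)"
  by (simp add: glact_def e2_bil q0_def bil_glsub vv_glsub)

lemma glact_eiij: "glact g (eiij I1 I2) = q1 (\<lambda>l. g l I1) (\<lambda>l. g l I2)"
  by (simp add: glact_def eiij_bil q1_def bil_glsub vv_glsub)

lemma q0_expand:
  "q0 a x = a I1 * a I1 * e2 I1 I1 x + (2 * a I1 * a I2 * e2 I1 I2 x + (2 * a I1 * a I3 * e2 I1 I3 x
    + (a I2 * a I2 * e2 I2 I2 x + (2 * a I2 * a I3 * e2 I2 I3 x + a I3 * a I3 * e2 I3 I3 x))))"
  by (simp add: q0_def e2_bil tcomb_def bil_add bil_add2 bil_scale bil_scale2
      bil_sym[of x "vv x I2" "vv x I1"] bil_sym[of x "vv x I3" "vv x I1"]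
      bil_sym[of x "vv x I3" "vv x I2"] algebra_simps)

lemma cross_tcomb:
  "cross (tcomb x a) (tcomb x b) = (\<lambda>i. (a I1 * b I2 - a I2 * b I1) * cross (vv x I1) (vv x I2) i
    + (a I1 * b I3 - a I3 * b I1) * cross (vv x I1) (vv x I3) i
    + (a I2 * b I3 - a I3 * b I2) * cross (vv x I2) (vv x I3) i)"
  by (rule ix_eqI; simp add: tcomb_def; simp add: algebra_simps)

lemma E1_bil:
  fixes x :: "'k::field_char_0 pt"
  defines "u \<equiv> vv x I1" and "v \<equiv> vv x I2" and "w \<equiv> vv x I3"
  shows "eiij I1 I2 x = 2 * bil x u (cross u v)" "eiij I2 I1 x = - 2 * bil x v (cross u v)"
    "eiij I1 I3 x = 2 * bil x u (cross u w)" "eiij I3 I1 x = - 2 * bil x w (cross u w)"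
    "eiij I2 I3 x = 2 * bil x v (cross v w)" "eiij I3 I2 x = - 2 * bil x w (cross v w)"
    "e132 x = 2 * bil x w (cross u v) - 2 * bil x u (cross v w)"
    "e123 x = 2 * bil x u (cross v w) + 2 * bil x v (cross u w)"
    "bil x v (cross u w) = bil x u (cross v w) + bil x w (cross u v)"
proof -
  have anti: "cross v u = (\<lambda>i. - 1 * cross u v i)" "cross w u = (\<lambda>i. - 1 * cross u w i)"
    "cross w v = (\<lambda>i. - 1 * cross v w i)"
    by (rule cross_anti)+
  show "eiij I1 I2 x = 2 * bil x u (cross u v)" "eiij I2 I1 x = - 2 * bil x v (cross u v)"
    "eiij I1 I3 x = 2 * bil x u (cross u w)" "eiij I3 I1 x = - 2 * bil x w (cross u w)"
    "eiij I2 I3 x = 2 * bil x v (cross v w)" "eiij I3 I2 x = - 2 * bil x w (cross v w)"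
    "e132 x = 2 * bil x w (cross u v) - 2 * bil x u (cross v w)"
    "e123 x = 2 * bil x u (cross v w) + 2 * bil x v (cross u w)"
    unfolding eiij_bil e132_bil e123_bil u_def[symmetric] v_def[symmetric] w_def[symmetric] anti
      bil_scale2 by (simp_all add: algebra_simps)
  have "bil x u (cross v w) + bil x v (cross w u) + bil x w (cross u v) = 0" by (rule bil_cyc)
  then show "bil x v (cross u w) = bil x u (cross v w) + bil x w (cross u v)"
    unfolding anti bil_scale2 by (simp add: algebra_simps)
qed

lemma q1_expand:
  "q1 a b x = (a I1 * a I1 * b I2 - a I1 * a I2 * b I1) * eiij I1 I2 x
   + ((a I2 * a I2 * b I1 - a I2 * a I1 * b I2) * eiij I2 I1 x
   + ((a I1 * a I1 * b I3 - a I1 * a I3 * b I1) * eiij I1 I3 x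
   + ((a I3 * a I3 * b I1 - a I3 * a I1 * b I3) * eiij I3 I1 x
   + ((a I2 * a I2 * b I3 - a I2 * a I3 * b I2) * eiij I2 I3 x
   + ((a I3 * a I3 * b I2 - a I3 * a I2 * b I3) * eiij I3 I2 x
   + ((a I1 * a I3 * b I2 - a I2 * a I3 * b I1) * e132 x
   + (a I1 * a I2 * b I3 - a I2 * a I3 * b I1) * e123 x))))))"
  unfolding q1_def cross_tcomb E1_bil(1-8)
  unfolding tcomb_def bil_add bil_scale bil_add2 bil_scale2 E1_bil(9)
  by (simp add: algebra_simps)

lemma exists_GL3_columns:
  fixes a b c :: "'k::field vec"
  assumes "dot a (cross b c) \<noteq> 0"
  shows "\<exists>g\<in>GL3. (\<lambda>l. g l I1) = a \<and> (\<lambda>l. g l I2) = b"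
proof
  let ?g = "\<lambda>i j. case j of I1 \<Rightarrow> a i | I2 \<Rightarrow> b i | I3 \<Rightarrow> c i"
  have "det3 ?g = dot a (cross b c)" by (simp add: det3_def dot_def algebra_simps)
  with assms show "?g \<in> GL3" by (simp add: GL3_def)
  show "(\<lambda>l. ?g l I1) = a \<and> (\<lambda>l. ?g l I2) = b" by simp
qed

lemma exists_GL3_column:
  fixes a :: "'k::field vec"
  assumes "a I1 \<noteq> 0 \<or> a I2 \<noteq> 0 \<or> a I3 \<noteq> 0"
  shows "\<exists>g\<in>GL3. (\<lambda>l. g l I1) = a"
proof -
  have "dot a (cross (ev I2) (ev I3)) \<noteq> 0 \<or> dot a (cross (ev I3) (ev I1)) \<noteq> 0
    \<or> dot a (cross (ev I1) (ev I2)) \<noteq> 0"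
    using assms by (simp add: dot_def ev_def)
  then show ?thesis using exists_GL3_columns by blast
qed

lemma C3_0_eq: "C3_0 = pspan (set (E0 :: 'k::field_char_0 fn list))"
proof
  have "glact g (e2 I1 I1) \<in> pspan (set E0)" for g :: "'k m3"
    unfolding glact_e2 q0_expand[abs_def] by (intro pspan_add pspan_cscale pspan_E0)
  then show "C3_0 \<subseteq> pspan (set (E0 :: 'k fn list))"
    unfolding C3_0_def PGL_def by (intro pspan_subset) blast
  have q: "q0 a \<in> C3_0" if n: "a I1 \<noteq> 0 \<or> a I2 \<noteq> 0 \<or> a I3 \<noteq> 0" for a :: "'k vec"
  proof -
    obtain g where g: "g \<in> GL3" "(\<lambda>l. g l I1) = a" using exists_GL3_column[OF n] by blast
    then have "q0 a = glact g (e2 I1 I1)" by (simp add: glact_e2)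
    then show ?thesis unfolding C3_0_def PGL_def using g(1) by (intro pspan_gen) blast
  qed
  have e: "e2 i j \<in> (C3_0 :: 'k fn set)" for i j
  proof -
    \<comment> \<open>Polarisation of the quadratic map \<open>q0\<close>. For \<open>i = j\<close>
      the vector is \<open>2 ev i\<close>, which is nonzero in characteristic 0, and the formula
      still gives \<open>e2 i i\<close>.\<close>
    have "(\<lambda>x. (1/2) * (q0 (\<lambda>l. ev i l + ev j l) x + (- 1) * (q0 (ev i) x + q0 (ev j) x)))
      \<in> (C3_0 :: 'k fn set)"
    proof -
      have "q0 (\<lambda>l. ev i l + ev j l) \<in> (C3_0 :: 'k fn set)" "q0 (ev i) \<in> (C3_0 :: 'k fn set)"
        "q0 (ev j) \<in> (C3_0 :: 'k fn set)"
        by (rule q; cases i; cases j; simp add: ev_def)+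
      then show ?thesis unfolding C3_0_def PGL_def by (intro pspan_cscale pspan_add)
    qed
    moreover have "tcomb x (ev i) = vv x i" for i and x :: "'k pt"
      by (cases i) (simp_all add: tcomb_def ev_def)
    moreover have "tcomb x (\<lambda>l. ev i l + ev j l) = (\<lambda>k. tcomb x (ev i) k + tcomb x (ev j) k)"
      for x :: "'k pt" by (simp add: tcomb_def algebra_simps)
    moreover have "bil x (vv x j) (vv x i) = bil x (vv x i) (vv x j)" for x :: "'k pt" by (rule bil_sym)
    ultimately show ?thesis by (simp add: e2_bil q0_def bil_add bil_add2)
  qed
  show "pspan (set (E0 :: 'k fn list)) \<subseteq> C3_0"
    using e unfolding C3_0_def PGL_def by (intro pspan_subset) (simp add: E0_def)
qed

lemma C3_1_eq: "C3_1 = pspan (set (E1 :: 'k::field_char_0 fn list))"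
proof
  have E: "e \<in> pspan (set E1)" if "e \<in> set E1" for e :: "'k fn" using that by (rule pspan_gen)
  have "glact g (eiij I1 I2) \<in> pspan (set E1)" for g :: "'k m3"
    unfolding glact_eiij q1_expand[abs_def]
    by (intro pspan_add pspan_cscale E) (simp_all add: E1_def)
  then show "C3_1 \<subseteq> pspan (set (E1 :: 'k fn list))"
    unfolding C3_1_def PGL_def by (intro pspan_subset) blast
  have q: "q1 a b \<in> C3_1" if d: "dot a (cross b c) \<noteq> 0" for a b c :: "'k vec"
  proof -
    obtain g where g: "g \<in> GL3" "(\<lambda>l. g l I1) = a" "(\<lambda>l. g l I2) = b"
      using exists_GL3_columns[OF d] by blast
    then have "q1 a b = glact g (eiij I1 I2)" by (simp add: glact_eiij)
    then show ?thesis unfolding C3_1_def PGL_def using g(1) by (intro pspan_gen) blast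
  qed
  have iij: "eiij i j \<in> (C3_1 :: 'k fn set)" if "i \<noteq> j" for i j
  proof -
    obtain k where "k \<noteq> i" "k \<noteq> j" by (cases i; cases j) auto
    with that have "dot (ev i) (cross (ev j) (ev k)) \<noteq> (0::'k)"
      by (cases i; cases j; cases k) (simp_all add: dot_def ev_def)
    from q[OF this] have "q1 (ev i) (ev j) \<in> (C3_1 :: 'k fn set)" .
    moreover have "tcomb x (ev i) = vv x i" for i and x :: "'k pt"
      by (cases i) (simp_all add: tcomb_def ev_def)
    ultimately show ?thesis by (simp add: q1_def eiij_bil)
  qed
  \<comment> \<open>Replacing \<open>t_1\<close> by \<open>t_1 + t_3\<close> in \<open>e_112\<close>
    gives \<open>e_112 + e_332\<close> and the mixed term \<open>e132\<close>; the same device below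
    produces \<open>e123\<close>.\<close>
  have "q1 (\<lambda>l. ev I1 l + ev I3 l) (ev I2) \<in> (C3_1 :: 'k fn set)"
    by (rule q[of _ _ "ev I3"]) (simp add: dot_def ev_def)
  then have "(\<lambda>x. q1 (\<lambda>l. ev I1 l + ev I3 l) (ev I2) x + (- 1) * (eiij I1 I2 x + eiij I3 I2 x))
    \<in> (C3_1 :: 'k fn set)"
    using iij[of I1 I2] iij[of I3 I2] unfolding C3_1_def PGL_def by (intro pspan_cscale pspan_add) simp_all
  moreover have "q1 (\<lambda>l. ev I1 l + ev I3 l) (ev I2) x + (- 1) * (eiij I1 I2 x + eiij I3 I2 x) = e132 x"
    for x :: "'k pt" by (simp add: q1_expand ev_def)
  ultimately have e132: "e132 \<in> (C3_1 :: 'k fn set)" by simp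
  have "q1 (\<lambda>l. ev I1 l + ev I2 l) (ev I3) \<in> (C3_1 :: 'k fn set)"
    by (rule q[of _ _ "ev I2"]) (simp add: dot_def ev_def)
  then have "(\<lambda>x. q1 (\<lambda>l. ev I1 l + ev I2 l) (ev I3) x + (- 1) * (eiij I1 I3 x + eiij I2 I3 x))
    \<in> (C3_1 :: 'k fn set)"
    using iij[of I1 I3] iij[of I2 I3] unfolding C3_1_def PGL_def by (intro pspan_cscale pspan_add) simp_all
  moreover have "q1 (\<lambda>l. ev I1 l + ev I2 l) (ev I3) x + (- 1) * (eiij I1 I3 x + eiij I2 I3 x) = e123 x"
    for x :: "'k pt" by (simp add: q1_expand ev_def)
  ultimately have e123: "e123 \<in> (C3_1 :: 'k fn set)" by simp
  show "pspan (set (E1 :: 'k fn list)) \<subseteq> C3_1"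
    using iij e132 e123 unfolding C3_1_def PGL_def by (intro pspan_subset) (simp add: E1_def)
qed

text \<open>Simultaneous negation of the \<open>t\<^sub>k\<close> separates the two summands.\<close>

lemma C3_0_C3_1: "C3_0 \<inter> C3_1 = {(\<lambda>x. 0 :: 'k::field_char_0)}"
proof -
  define ng :: "'k pt \<Rightarrow> 'k pt" where "ng x = (\<lambda>v. case v of T k p \<Rightarrow> - x (T k p) | Z i j \<Rightarrow> x (Z i j))" for x
  have vv: "vv (ng x) k = (\<lambda>i. - 1 * vv x k i)" for x k
    by (rule ix_eqI) (simp_all add: ng_def)
  have sm: "sm (ng x) = sm x" for x by (intro ext) (simp add: sm_def ng_def)
  have bil: "bil (ng x) = bil x" for x by (intro ext) (simp add: bil_def sm)
  have e2: "e2 i j (ng x) = e2 i j x" for i j x by (simp only: e2_bil vv bil bil_scale bil_scale2) simp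
  have e3: "eiij i j (ng x) = - eiij i j x" "e132 (ng x) = - e132 x" "e123 (ng x) = - e123 x" for i j x
    by (simp_all only: eiij_bil e132_bil e123_bil vv bil bil_scale bil_scale2 cross_scale) (simp_all add: algebra_simps)
  have dn: "dot (\<lambda>i. - 1 * a i) (\<lambda>i. - 1 * b i) = dot a b" for a b :: "'k vec" by (simp add: dot_def)
  have tr: "trp i j (ng x) = trp i j x" for i j x by (simp only: trp_dot vv dn)
  have p: "p (ng x) = p x" if "p \<in> P" for p x
    using that unfolding P_def by (induction rule: alg.induct) (auto simp: tr)
  have 0: "f (ng x) = f x" if "f \<in> C3_0" for f x
    using that unfolding C3_0_eq
    by (induction rule: pspan_induct) (auto simp: p E0_def e2)
  have 1: "f (ng x) = - f x" if "f \<in> C3_1" for f x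
    using that unfolding C3_1_eq
    by (induction rule: pspan_induct) (auto simp: p E1_def e3)
  have "f = (\<lambda>x. 0)" if "f \<in> C3_0" "f \<in> C3_1" for f :: "'k fn"
  proof
    fix x
    have "f x = - f x" using 0[OF that(1), of x] 1[OF that(2), of x] by simp
    then show "f x = 0" by (simp add: eq_neg_iff_add_eq_0)
  qed
  then show ?thesis unfolding C3_0_eq C3_1_eq using pspan_zero by blast
qed

section \<open>The ring P as a polynomial ring in the Gram entries\<close>

subsection \<open>Polynomial functions\<close>

definition polyfn :: "'k::comm_ring_1 fn set" where
  "polyfn = alg (range (\<lambda>v x. x v))"

lemma alg_mono: "S \<subseteq> S' \<Longrightarrow> alg S \<subseteq> alg S'"
proof
  fix f assume "S \<subseteq> S'" "f \<in> alg S"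
  from this(2,1) show "f \<in> alg S'" by (induction rule: alg.induct) (auto intro: alg.intros)
qed

lemma polyfn_line:
  assumes "f \<in> polyfn"
  shows "\<exists>p. \<forall>t. f (\<lambda>v. a v + t * b v) = poly p t"
  using assms unfolding polyfn_def
proof (induction rule: alg.induct)
  case (gen f)
  then obtain v where "f = (\<lambda>x. x v)" by blast
  then show ?case by (intro exI[of _ "[:a v, b v:]"]) simp
next
  case (const c)
  show ?case by (rule exI[of _ "[:c:]"]) simp
next
  case (add f g)
  then obtain p q where "\<forall>t. f (\<lambda>v. a v + t * b v) = poly p t" "\<forall>t. g (\<lambda>v. a v + t * b v) = poly q t"
    by blast
  then show ?case by (intro exI[of _ "p + q"]) simp
next
  case (mult f g)
  then obtain p q where "\<forall>t. f (\<lambda>v. a v + t * b v) = poly p t" "\<forall>t. g (\<lambda>v. a v + t * b v) = poly q t"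
    by blast
  then show ?case by (intro exI[of _ "p * q"]) simp
qed

lemma polyfn_upd:
  assumes "f \<in> polyfn"
  shows "\<exists>p. \<forall>t. f (x(v := t)) = poly p t"
proof -
  have "x(v := t) = (\<lambda>w. (x(v := 0)) w + t * (if w = v then 1 else 0))" for t by auto
  then show ?thesis
    using polyfn_line[OF assms, of "x(v := 0)" "\<lambda>w. if w = v then 1 else 0"] by simp
qed

text \<open>On the line from \<open>x\<close> to \<open>y\<close> both functions are univariate
  polynomials and \<open>g\<close> is not zero, so \<open>f\<close> vanishes on the whole line and
  in particular at \<open>x\<close>.\<close>

lemma polyfn_domain:
  fixes f g :: "'k::field_char_0 fn"
  assumes "f \<in> polyfn" "g \<in> polyfn" and fg: "\<And>x. f x * g x = 0" and g: "g y \<noteq> 0"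
  shows "f = (\<lambda>x. 0)"
proof
  fix x
  obtain p where p: "\<And>t. f (\<lambda>v. x v + t * (y v - x v)) = poly p t"
    using polyfn_line[OF assms(1), of x "\<lambda>v. y v - x v"] by blast
  obtain q where q: "\<And>t. g (\<lambda>v. x v + t * (y v - x v)) = poly q t"
    using polyfn_line[OF assms(2), of x "\<lambda>v. y v - x v"] by blast
  have "poly (p * q) t = poly 0 t" for t using fg by (simp add: p[symmetric] q[symmetric])
  then have "p * q = 0" using poly_eq_poly_eq_iff by blast
  moreover have "q \<noteq> 0" using q[of 1] g by auto
  ultimately have "p = 0" by simp
  then show "f x = 0" using p[of 0] by simp
qed

lemma polyfn_add: "f \<in> polyfn \<Longrightarrow> g \<in> polyfn \<Longrightarrow> (\<lambda>x. f x + g x) \<in> polyfn"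
  and polyfn_mult: "f \<in> polyfn \<Longrightarrow> g \<in> polyfn \<Longrightarrow> (\<lambda>x. f x * g x) \<in> polyfn"
  and polyfn_const: "(\<lambda>x. c) \<in> polyfn"
  and polyfn_var: "(\<lambda>x. x v) \<in> polyfn"
  unfolding polyfn_def by (rule alg.add alg.mult alg.const alg.gen; (assumption | rule rangeI))+

lemma polyfn_diff: "f \<in> polyfn \<Longrightarrow> g \<in> polyfn \<Longrightarrow> (\<lambda>x. f x - g x) \<in> polyfn"
  using polyfn_add[OF _ polyfn_mult[OF polyfn_const[of "- 1"]], of f g] by simp

lemma polyfn_cancel:
  fixes f g h :: "'k::field_char_0 fn"
  assumes "f \<in> polyfn" "g \<in> polyfn" "h \<in> polyfn" and eq: "\<And>x. h x * f x = h x * g x" and "h y \<noteq> 0"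
  shows "f = g"
proof -
  have "(\<lambda>x. f x - g x) = (\<lambda>x. 0)"
  proof (rule polyfn_domain[OF polyfn_diff[OF assms(1,2)] assms(3) _ assms(5)])
    show "(f x - g x) * h x = 0" for x using eq[of x] by (simp add: left_diff_distrib mult.commute)
  qed
  then show ?thesis by (simp add: fun_eq_iff)
qed

lemma P_polyfn: "p \<in> P \<Longrightarrow> p \<in> polyfn"
proof -
  have "KT \<subseteq> polyfn" unfolding KT_def polyfn_def by (rule alg_mono) blast
  then show "p \<in> P \<Longrightarrow> p \<in> polyfn" using P_inv by blast
qed

lemma P_diff: "f \<in> P \<Longrightarrow> g \<in> P \<Longrightarrow> (\<lambda>x. f x - g x) \<in> P"
  using P_add[OF _ P_mult[OF P_const[of "- 1"]], of f g] by simp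

lemma P_neg: "f \<in> P \<Longrightarrow> (\<lambda>x. - f x) \<in> P"
  using P_mult[OF P_const[of "- 1"], of f] by simp

subsection \<open>Algebraic independence of the Gram matrix entries\<close>

text \<open>Six of the \<open>Z\<close> positions serve here as independent variables for the
  entries of the symmetric Gram matrix; \<open>gpoly\<close> is the polynomial ring in them.\<close>

definition gvars :: "var set" where
  "gvars = {Z I1 I1, Z I2 I2, Z I3 I3, Z I1 I2, Z I1 I3, Z I2 I3}"

definition gpoly :: "'k::comm_ring_1 fn set" where
  "gpoly = alg ((\<lambda>v h. h v) ` gvars)"

definition gram :: "'k::comm_ring_1 pt \<Rightarrow> 'k pt" where
  "gram x = (\<lambda>v. case v of T k p \<Rightarrow> 0 | Z i j \<Rightarrow> trp i j x)"

lemma gram_Z [simp]: "gram x (Z i j) = trp i j x"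
  by (simp add: gram_def)

lemma gpoly_polyfn: "F \<in> gpoly \<Longrightarrow> F \<in> polyfn"
  using alg_mono[of "(\<lambda>v h. h v) ` gvars" "range (\<lambda>v x. x v)"] unfolding gpoly_def polyfn_def by blast

lemma gpoly_add: "f \<in> gpoly \<Longrightarrow> g \<in> gpoly \<Longrightarrow> (\<lambda>x. f x + g x) \<in> gpoly"
  and gpoly_mult: "f \<in> gpoly \<Longrightarrow> g \<in> gpoly \<Longrightarrow> (\<lambda>x. f x * g x) \<in> gpoly"
  and gpoly_const: "(\<lambda>x. c) \<in> gpoly"
  and gpoly_var: "v \<in> gvars \<Longrightarrow> (\<lambda>x. x v) \<in> gpoly"
  unfolding gpoly_def by (rule alg.add alg.mult alg.const alg.gen; (assumption | rule imageI, assumption))+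

lemma gpoly_diff: "f \<in> gpoly \<Longrightarrow> g \<in> gpoly \<Longrightarrow> (\<lambda>x. f x - g x) \<in> gpoly"
  using gpoly_add[OF _ gpoly_mult[OF gpoly_const[of "- 1"]], of f g] by simp

lemma gpoly_cong:
  assumes "F \<in> gpoly" "\<And>v. v \<in> gvars \<Longrightarrow> h v = h' v"
  shows "F h = F h'"
  using assms(1) unfolding gpoly_def by (induction rule: alg.induct) (auto simp: assms(2))

lemma P_gpoly: "p \<in> P \<longleftrightarrow> (\<exists>F\<in>gpoly. p = (\<lambda>x. F (gram x)))"
proof
  assume "p \<in> P"
  then show "\<exists>F\<in>gpoly. p = (\<lambda>x. F (gram x))" unfolding P_def
  proof (induction rule: alg.induct)
    case (gen f)
    then obtain i j where "f = trp i j" "Z i j \<in> gvars" by (auto simp: gvars_def)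
    then show ?case by (intro bexI[of _ "\<lambda>h. h (Z i j)"] gpoly_var) (simp_all add: fun_eq_iff)
  next
    case (const c)
    show ?case by (intro bexI[of _ "\<lambda>h. c"] gpoly_const) simp
  next
    case (add f g)
    then obtain F G where "F \<in> gpoly" "G \<in> gpoly" "f = (\<lambda>x. F (gram x))" "g = (\<lambda>x. G (gram x))" by blast
    then show ?case by (intro bexI[of _ "\<lambda>h. F h + G h"] gpoly_add) simp_all
  next
    case (mult f g)
    then obtain F G where "F \<in> gpoly" "G \<in> gpoly" "f = (\<lambda>x. F (gram x))" "g = (\<lambda>x. G (gram x))" by blast
    then show ?case by (intro bexI[of _ "\<lambda>h. F h * G h"] gpoly_mult) simp_all
  qed
next
  assume "\<exists>F\<in>gpoly. p = (\<lambda>x. F (gram x))"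
  then obtain F where F: "F \<in> gpoly" and p: "p = (\<lambda>x. F (gram x))" by blast
  from F show "p \<in> P" unfolding p gpoly_def
  proof (induction rule: alg.induct)
    case (gen f)
    then obtain i j where "f = (\<lambda>h. h (Z i j))" by (auto simp: gvars_def)
    then show ?case using P_trp[of i j] by simp
  qed (auto intro: P_const P_add P_mult)
qed

text \<open>Without square roots in the field, a diagonal Gram entry is only known to take values of
  this form. The choices c = 1, 2, 3, ... already give infinitely many zeros of a univariate
  polynomial.\<close>

lemma polyfn_infinite_zeros:
  fixes F :: "'k::field_char_0 fn"
  assumes "F \<in> polyfn" and z: "\<And>c. c \<noteq> 0 \<Longrightarrow> F (h(v := - 2 * (k + c * c))) = 0"
  shows "F h = 0"
proof -
  obtain p where p: "\<And>t. F (h(v := t)) = poly p t" using polyfn_upd[OF assms(1)] by blast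
  define s :: "nat \<Rightarrow> 'k" where "s n = - 2 * (k + of_nat (Suc n) * of_nat (Suc n))" for n
  have "inj s"
  proof (rule injI)
    fix m n assume "s m = s n"
    then have "of_nat (Suc m * Suc m) = (of_nat (Suc n * Suc n) :: 'k)"
      unfolding s_def of_nat_mult by (simp del: of_nat_Suc)
    then have "Suc m * Suc m = Suc n * Suc n" by (simp only: of_nat_eq_iff)
    then have "(Suc m)^2 = (Suc n)^2" by (simp only: power2_eq_square)
    then show "m = n" using power_eq_iff_eq_base[of 2 "Suc m" "Suc n"] by simp
  qed
  then have "infinite (range s)" by (simp add: finite_image_iff)
  moreover have "range s \<subseteq> {t. poly p t = 0}"
  proof
    fix t assume "t \<in> range s"
    then obtain n where "t = s n" by blast
    then show "t \<in> {t. poly p t = 0}" using z[of "of_nat (Suc n)"] p[of t] unfolding s_def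
      by (simp del: of_nat_Suc)
  qed
  ultimately have "p = 0" using poly_roots_finite finite_subset by blast
  then show ?thesis using p[of "h v"] by simp
qed

text \<open>A point with prescribed axis vectors; the signs undo those in \<open>vv\<close>.\<close>

definition tpt :: "'k::comm_ring_1 vec \<Rightarrow> 'k vec \<Rightarrow> 'k vec \<Rightarrow> 'k m3 \<Rightarrow> 'k pt" where
  "tpt a b c z = (\<lambda>v. case v of
      T k p \<Rightarrow> (let w = (case k of I1 \<Rightarrow> a | I2 \<Rightarrow> b | I3 \<Rightarrow> c) in
        (case p of P23 \<Rightarrow> - w I1 | P13 \<Rightarrow> w I2 | P12 \<Rightarrow> - w I3))
    | Z i j \<Rightarrow> z i j)"

lemma tpt_vv [simp]: "vv (tpt a b c z) I1 = a" "vv (tpt a b c z) I2 = b" "vv (tpt a b c z) I3 = c"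
  by (rule ix_eqI; simp add: tpt_def)+

definition v3 :: "'k \<Rightarrow> 'k \<Rightarrow> 'k \<Rightarrow> 'k vec" where
  "v3 a b c = (\<lambda>i. case i of I1 \<Rightarrow> a | I2 \<Rightarrow> b | I3 \<Rightarrow> c)"

lemma v3_nth [simp]: "v3 a b c I1 = a" "v3 a b c I2 = b" "v3 a b c I3 = c"
  by (simp_all add: v3_def)

text \<open>The Gram matrices of upper triangular matrices are dense: solve for the off-diagonal entries,
  then free the diagonal entries one after the other.\<close>

lemma gram_dense:
  fixes F :: "'k::field_char_0 fn"
  assumes F: "F \<in> gpoly" and z: "\<And>x. F (gram x) = 0"
  shows "F h = 0"
proof -
  note inf = polyfn_infinite_zeros[OF gpoly_polyfn[OF F]]
  have 1: "F (((h(Z I1 I1 := - 2 * (0 + a * a)))(Z I2 I2 := - 2 * (b * b + c * c)))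
      (Z I3 I3 := - 2 * (d * d + e * e + f * f))) = 0"
    if a: "a \<noteq> 0" and b: "b = - h (Z I1 I2) / (2 * a)" and c: "c \<noteq> 0"
      and d: "d = - h (Z I1 I3) / (2 * a)" and e: "e = (- h (Z I2 I3) / 2 - b * d) / c"
    for a b c d e f
  proof -
    define x where "x = tpt (v3 a 0 0) (v3 b c 0) (v3 d e f) (\<lambda>i j. 0)"
    have "F (((h(Z I1 I1 := - 2 * (0 + a * a)))(Z I2 I2 := - 2 * (b * b + c * c)))
      (Z I3 I3 := - 2 * (d * d + e * e + f * f))) = F (gram x)"
    proof (rule gpoly_cong[OF F])
      fix v assume v: "v \<in> gvars"
      have "h (Z I1 I2) = - 2 * (a * b)" "h (Z I1 I3) = - 2 * (a * d)" "h (Z I2 I3) = - 2 * (b * d + c * e)"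
        using a c by (simp_all add: b d e field_simps)
      then show "(((h(Z I1 I1 := - 2 * (0 + a * a)))(Z I2 I2 := - 2 * (b * b + c * c)))
         (Z I3 I3 := - 2 * (d * d + e * e + f * f))) v = gram x v"
        using v by (auto simp: gvars_def trp_dot dot_def x_def algebra_simps)
    qed
    then show ?thesis using z by simp
  qed
  have 2: "F ((h(Z I1 I1 := - 2 * (0 + a * a)))(Z I2 I2 := - 2 * (b * b + c * c))) = 0"
    if "a \<noteq> 0" "b = - h (Z I1 I2) / (2 * a)" "c \<noteq> 0" for a b c
    by (rule inf[OF 1[OF that refl refl]])
  have 3: "F (h(Z I1 I1 := - 2 * (0 + a * a))) = 0" if "a \<noteq> 0" for a
    by (rule inf[OF 2[OF that refl]])
  show ?thesis by (rule inf[OF 3])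
qed

subsection \<open>Coprimality in P\<close>

lemmas gpoly_induct [consumes 1, case_names gen const add mult] =
  alg.induct[of _ "(\<lambda>v h. h v) ` gvars", folded gpoly_def]

definition indep :: "var \<Rightarrow> 'k fn \<Rightarrow> bool" where
  "indep v f \<longleftrightarrow> (\<forall>h t. f (h(v := t)) = f h)"

text \<open>Division by \<open>h\<^sub>2\<^sub>2 h\<^sub>3\<^sub>3 - h\<^sub>2\<^sub>3\<^sup>2\<close>, which is monic up to sign in \<open>h\<^sub>2\<^sub>3\<close>.\<close>

lemma gpoly_div_minor:
  fixes F :: "'k::comm_ring_1 fn"
  assumes "F \<in> gpoly"
  shows "\<exists>q\<in>gpoly. \<exists>\<alpha>\<in>gpoly. \<exists>\<beta>\<in>gpoly. indep (Z I2 I3) \<alpha> \<and> indep (Z I2 I3) \<beta> \<and>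
    (\<forall>h. F h = q h * (h (Z I2 I2) * h (Z I3 I3) - h (Z I2 I3) * h (Z I2 I3))
        + (\<alpha> h + \<beta> h * h (Z I2 I3)))"
  using assms
proof (induction rule: gpoly_induct)
  case (gen f)
  then obtain v where v: "v \<in> gvars" "f = (\<lambda>h. h v)" by blast
  show ?case
  proof (cases "v = Z I2 I3")
    case True
    show ?thesis
      by (rule bexI[OF _ gpoly_const[of 0]], rule bexI[OF _ gpoly_const[of 0]],
          rule bexI[OF _ gpoly_const[of 1]]) (simp add: v True indep_def)
  next
    case False
    show ?thesis
      by (rule bexI[OF _ gpoly_const[of 0]], rule bexI[OF _ gpoly_var[OF v(1)]],
          rule bexI[OF _ gpoly_const[of 0]]) (use False in \<open>simp add: v indep_def\<close>)
  qed
next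
  case (const c)
  show ?case
    by (rule bexI[OF _ gpoly_const[of 0]], rule bexI[OF _ gpoly_const[of c]],
        rule bexI[OF _ gpoly_const[of 0]]) (simp add: indep_def)
next
  case (add f g)
  let ?m = "\<lambda>h :: 'k pt. h (Z I2 I2) * h (Z I3 I3) - h (Z I2 I3) * h (Z I2 I3)"
  from add.IH(1) obtain q a b where f: "q \<in> gpoly" "a \<in> gpoly" "b \<in> gpoly"
    "indep (Z I2 I3) a" "indep (Z I2 I3) b" "\<And>h. f h = q h * ?m h + (a h + b h * h (Z I2 I3))" by blast
  from add.IH(2) obtain q' a' b' where g: "q' \<in> gpoly" "a' \<in> gpoly" "b' \<in> gpoly"
    "indep (Z I2 I3) a'" "indep (Z I2 I3) b'" "\<And>h. g h = q' h * ?m h + (a' h + b' h * h (Z I2 I3))" by blast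
  show ?case
    by (rule bexI[OF _ gpoly_add[OF f(1) g(1)]], rule bexI[OF _ gpoly_add[OF f(2) g(2)]],
        rule bexI[OF _ gpoly_add[OF f(3) g(3)]])
      (use f(4,5) g(4,5) in \<open>simp add: f(6) g(6) indep_def; simp add: algebra_simps\<close>)
next
  case (mult f g)
  let ?m = "\<lambda>h :: 'k pt. h (Z I2 I2) * h (Z I3 I3) - h (Z I2 I3) * h (Z I2 I3)"
  from mult.IH(1) obtain q a b where f: "q \<in> gpoly" "a \<in> gpoly" "b \<in> gpoly"
    "indep (Z I2 I3) a" "indep (Z I2 I3) b" "\<And>h. f h = q h * ?m h + (a h + b h * h (Z I2 I3))" by blast
  from mult.IH(2) obtain q' a' b' where g: "q' \<in> gpoly" "a' \<in> gpoly" "b' \<in> gpoly"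
    "indep (Z I2 I3) a'" "indep (Z I2 I3) b'" "\<And>h. g h = q' h * ?m h + (a' h + b' h * h (Z I2 I3))" by blast
  have v: "Z I2 I3 \<in> gvars" "Z I2 I2 \<in> gvars" "Z I3 I3 \<in> gvars" by (simp_all add: gvars_def)
  \<comment> \<open>In the product of the two remainders the square of the variable is replaced by
    \<open>h (Z I2 I2) * h (Z I3 I3)\<close> minus the minor. This moves \<open>- b h * b' h\<close>
    into the quotient.\<close>
  have Q: "(\<lambda>h. q h * g h + q' h * (a h + b h * h (Z I2 I3)) - b h * b' h) \<in> gpoly"
    by (intro gpoly_diff gpoly_add gpoly_mult f g mult.hyps gpoly_var v)
  have A: "(\<lambda>h. a h * a' h + b h * b' h * (h (Z I2 I2) * h (Z I3 I3))) \<in> gpoly"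
    by (intro gpoly_add gpoly_mult f g gpoly_var v)
  have B: "(\<lambda>h. a h * b' h + b h * a' h) \<in> gpoly"
    by (intro gpoly_add gpoly_mult f g)
  show ?case
    by (rule bexI[OF _ Q], rule bexI[OF _ A], rule bexI[OF _ B])
      (use f(4,5) g(4,5) in \<open>simp add: f(6) g(6) indep_def; simp add: algebra_simps\<close>)
qed

lemma gpoly_div_var:
  fixes F :: "'k::comm_ring_1 fn"
  assumes "F \<in> gpoly" and v: "v \<in> gvars"
  shows "\<exists>q\<in>gpoly. \<exists>\<alpha>\<in>gpoly. indep v \<alpha> \<and> (\<forall>h. F h = q h * h v + \<alpha> h)"
  using assms(1)
proof (induction rule: gpoly_induct)
  case (gen f)
  then obtain w where w: "w \<in> gvars" "f = (\<lambda>h. h w)" by blast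
  show ?case
  proof (cases "w = v")
    case True
    show ?thesis
      by (rule bexI[OF _ gpoly_const[of 1]], rule bexI[OF _ gpoly_const[of 0]])
        (simp add: w True indep_def)
  next
    case False
    show ?thesis
      by (rule bexI[OF _ gpoly_const[of 0]], rule bexI[OF _ gpoly_var[OF w(1)]])
        (use False in \<open>simp add: w indep_def\<close>)
  qed
next
  case (const c)
  show ?case
    by (rule bexI[OF _ gpoly_const[of 0]], rule bexI[OF _ gpoly_const[of c]]) (simp add: indep_def)
next
  case (add f g)
  from add.IH(1) obtain q a where f: "q \<in> gpoly" "a \<in> gpoly"
    "indep v a" "\<And>h. f h = q h * h v + a h" by blast
  from add.IH(2) obtain q' a' where g: "q' \<in> gpoly" "a' \<in> gpoly"
    "indep v a'" "\<And>h. g h = q' h * h v + a' h" by blast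
  show ?case
    by (rule bexI[OF _ gpoly_add[OF f(1) g(1)]], rule bexI[OF _ gpoly_add[OF f(2) g(2)]])
      (use f(3) g(3) in \<open>simp add: f(4) g(4) indep_def; simp add: algebra_simps\<close>)
next
  case (mult f g)
  from mult.IH(1) obtain q a where f: "q \<in> gpoly" "a \<in> gpoly"
    "indep v a" "\<And>h. f h = q h * h v + a h" by blast
  from mult.IH(2) obtain q' a' where g: "q' \<in> gpoly" "a' \<in> gpoly"
    "indep v a'" "\<And>h. g h = q' h * h v + a' h" by blast
  have "(\<lambda>h. q h * g h + q' h * a h) \<in> gpoly"
    by (intro gpoly_add gpoly_mult f g mult.hyps)
  then show ?case
    by (rule bexI[rotated], intro bexI[OF _ gpoly_mult[OF f(2) g(2)]])
      (use f(3) g(3) in \<open>simp add: f(4) g(4) indep_def; simp add: algebra_simps\<close>)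
qed

text \<open>The left minor is free of the variable \<open>Z I2 I3\<close>, so its product with the
  remainder has degree at most 1 there. Being a multiple of a polynomial of degree 2, it is zero,
  and hence so is the remainder.\<close>

lemma gpoly_coprime_minors:
  fixes F G :: "'k::field_char_0 fn"
  assumes F: "F \<in> gpoly" and G: "G \<in> gpoly"
    and eq: "\<And>h. F h * (h (Z I1 I1) * h (Z I3 I3) - h (Z I1 I3) * h (Z I1 I3))
      = G h * (h (Z I2 I2) * h (Z I3 I3) - h (Z I2 I3) * h (Z I2 I3))"
  shows "\<exists>q\<in>gpoly. \<forall>h. F h = q h * (h (Z I2 I2) * h (Z I3 I3) - h (Z I2 I3) * h (Z I2 I3))"
proof -
  obtain q a b where q: "q \<in> gpoly" and a: "a \<in> gpoly" "indep (Z I2 I3) a"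
    and b: "b \<in> gpoly" "indep (Z I2 I3) b"
    and Fq: "\<And>h. F h = q h * (h (Z I2 I2) * h (Z I3 I3) - h (Z I2 I3) * h (Z I2 I3))
        + (a h + b h * h (Z I2 I3))"
    using gpoly_div_minor[OF F] by blast
  let ?c = "\<lambda>h :: 'k pt. h (Z I1 I1) * h (Z I3 I3) - h (Z I1 I3) * h (Z I1 I3)"
  have ab: "a h * ?c h = 0 \<and> b h * ?c h = 0" for h
  proof -
    obtain p where p: "\<And>t. G (h(Z I2 I3 := t)) = poly p t"
      using polyfn_upd[OF gpoly_polyfn[OF G]] by blast
    obtain r where r: "\<And>t. q (h(Z I2 I3 := t)) = poly r t"
      using polyfn_upd[OF gpoly_polyfn[OF q]] by blast
    let ?m = "[:h (Z I2 I2) * h (Z I3 I3), 0, - 1:]"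
    have "poly [:a h * ?c h, b h * ?c h:] t = poly ((p - smult (?c h) r) * ?m) t" for t
      using eq[of "h(Z I2 I3 := t)"] a(2) b(2) unfolding Fq indep_def
      by (simp add: p r algebra_simps)
    then have e: "[:a h * ?c h, b h * ?c h:] = (p - smult (?c h) r) * ?m"
      using poly_eq_poly_eq_iff by blast
    have "p - smult (?c h) r = 0"
    proof (rule ccontr)
      assume "p - smult (?c h) r \<noteq> 0"
      then have "degree ((p - smult (?c h) r) * ?m) = degree (p - smult (?c h) r) + 2"
        by (subst degree_mult_eq) simp_all
      moreover have "degree [:a h * ?c h, b h * ?c h:] \<le> 1" by (simp add: degree_pCons_le)
      ultimately show False unfolding e by simp
    qed
    with e show ?thesis by (simp del: mult_eq_0_iff)
  qed
  have c: "?c \<in> polyfn" by (intro polyfn_diff polyfn_mult polyfn_var)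
  have c1: "?c (\<lambda>v. if v = Z I1 I3 then 0 else 1) \<noteq> 0" by simp
  have "a = (\<lambda>h. 0)" "b = (\<lambda>h. 0)"
    by (rule polyfn_domain[OF gpoly_polyfn[OF a(1)] c _ c1], use ab in blast)
      (rule polyfn_domain[OF gpoly_polyfn[OF b(1)] c _ c1], use ab in blast)
  with Fq q show ?thesis by auto
qed

text \<open>Setting \<open>v\<close> to 0 kills the right-hand side and leaves the remainder of
  \<open>F\<close> times \<open>w\<close>, so the remainder is zero.\<close>

lemma gpoly_coprime_vars:
  fixes F G :: "'k::field_char_0 fn"
  assumes F: "F \<in> gpoly" and v: "v \<in> gvars" and w: "w \<noteq> v" and eq: "\<And>h. F h * h w = G h * h v"
  shows "\<exists>q\<in>gpoly. \<forall>h. F h = q h * h v"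
proof -
  obtain q a where q: "q \<in> gpoly" and a: "a \<in> gpoly" "indep v a" and Fq: "\<And>h. F h = q h * h v + a h"
    using gpoly_div_var[OF F v] by blast
  have "a h * h w = 0" for h
  proof -
    have "a (h(v := 0)) * h w = 0"
      using eq[of "h(v := 0)"] w by (simp only: Fq) simp
    then show ?thesis using a(2) by (simp only: indep_def)
  qed
  then have "a = (\<lambda>h. 0)"
    by (rule polyfn_domain[OF gpoly_polyfn[OF a(1)] polyfn_var[of w], of "\<lambda>v. 1"]) simp
  with Fq q show ?thesis by auto
qed

text \<open>Density of Gram matrices lifts identities in \<open>P\<close> to identities of
  polynomials in free variables, where division with remainder is available.\<close>

lemma gpoly_gram_eq:
  fixes F G :: "'k::field_char_0 fn"
  assumes "F \<in> gpoly" "G \<in> gpoly" "\<And>x. F (gram x) = G (gram x)"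
  shows "F h = G h"
  using gram_dense[OF gpoly_diff[OF assms(1,2)], of h] assms(3) by simp

lemma P_coprime_minors:
  fixes f g :: "'k::field_char_0 fn"
  assumes f: "f \<in> P" and g: "g \<in> P"
    and eq: "\<And>x. f x * (trp I1 I1 x * trp I3 I3 x - trp I1 I3 x * trp I1 I3 x)
      = g x * (trp I2 I2 x * trp I3 I3 x - trp I2 I3 x * trp I2 I3 x)"
  shows "\<exists>q\<in>P. \<forall>x. f x = q x * (trp I2 I2 x * trp I3 I3 x - trp I2 I3 x * trp I2 I3 x)"
proof -
  from f g obtain F G where F: "F \<in> gpoly" "f = (\<lambda>x. F (gram x))" and G: "G \<in> gpoly" "g = (\<lambda>x. G (gram x))"
    using P_gpoly by blast
  have "F h * (h (Z I1 I1) * h (Z I3 I3) - h (Z I1 I3) * h (Z I1 I3))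
      = G h * (h (Z I2 I2) * h (Z I3 I3) - h (Z I2 I3) * h (Z I2 I3))" for h
    by (rule gpoly_gram_eq[of "\<lambda>h. F h * (h (Z I1 I1) * h (Z I3 I3) - h (Z I1 I3) * h (Z I1 I3))"
          "\<lambda>h. G h * (h (Z I2 I2) * h (Z I3 I3) - h (Z I2 I3) * h (Z I2 I3))"];
        (intro gpoly_diff gpoly_mult F G gpoly_var; simp add: gvars_def)?)
      (use eq F G in simp)
  from gpoly_coprime_minors[OF F(1) G(1) this] obtain q where "q \<in> gpoly"
    "\<forall>h. F h = q h * (h (Z I2 I2) * h (Z I3 I3) - h (Z I2 I3) * h (Z I2 I3))" by blast
  then show ?thesis by (intro bexI[of _ "\<lambda>x. q (gram x)"]) (auto simp: F P_gpoly)
qed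

lemma P_coprime_trp:
  fixes f g :: "'k::field_char_0 fn"
  assumes f: "f \<in> P" and g: "g \<in> P" and v: "Z i j \<in> gvars" "Z k l \<in> gvars" "Z k l \<noteq> Z i j"
    and eq: "\<And>x. f x * trp k l x = g x * trp i j x"
  shows "\<exists>q\<in>P. \<forall>x. f x = q x * trp i j x"
proof -
  from f g obtain F G where F: "F \<in> gpoly" "f = (\<lambda>x. F (gram x))" and G: "G \<in> gpoly" "g = (\<lambda>x. G (gram x))"
    using P_gpoly by blast
  have "F h * h (Z k l) = G h * h (Z i j)" for h
    by (rule gpoly_gram_eq[of "\<lambda>h. F h * h (Z k l)" "\<lambda>h. G h * h (Z i j)"])
      (use eq F G v in \<open>simp_all add: gpoly_mult gpoly_var\<close>)
  from gpoly_coprime_vars[OF F(1) v(1,3) this] obtain q where "q \<in> gpoly"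
    "\<forall>h. F h = q h * h (Z i j)" by blast
  then show ?thesis by (intro bexI[of _ "\<lambda>x. q (gram x)"]) (auto simp: F P_gpoly)
qed

subsection \<open>Cancellation in P\<close>

lemma P_cancel:
  assumes "f \<in> P" "g \<in> P" "h \<in> P" "\<And>x. h x * f x = h x * g x" "h y \<noteq> (0::'k::field_char_0)"
  shows "f = g"
  using polyfn_cancel assms P_polyfn by meson

text \<open>The standard basis as the three vectors. Its Gram matrix of traces is -2 times the
  identity, so the principal minors used for cancellation are nonzero there.\<close>

definition stdpt :: "'k::comm_ring_1 pt" where
  "stdpt = tpt (v3 1 0 0) (v3 0 1 0) (v3 0 0 1) (\<lambda>i j. 0)"

lemma stdpt_trp: "trp i j stdpt = (if i = j then - 2 else 0)"
  by (cases i; cases j) (simp_all add: trp_dot stdpt_def dot_def)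

lemma polyfn_tdet: "tdet \<in> polyfn"
proof -
  have v: "(\<lambda>x. vv x k i) \<in> polyfn" for k i
    using polyfn_mult[OF polyfn_const[of "- 1"] polyfn_var] by (cases i) (simp_all add: polyfn_var)
  have "(\<lambda>x. dot (vv x I1) (cross (vv x I2) (vv x I3))) \<in> polyfn"
    unfolding dot_def cross_nth by (intro polyfn_add polyfn_mult polyfn_diff v)
  then show ?thesis by (simp add: tdet_def[abs_def])
qed

text \<open>Identities in \<open>P\<close> may be checked where the three vectors form a
  basis.\<close>

lemma tdet_cancel:
  fixes f g :: "'k::field_char_0 fn"
  assumes "f \<in> P" "g \<in> P" "\<And>x. tdet x \<noteq> 0 \<Longrightarrow> f x = g x"
  shows "f = g"
proof (rule polyfn_cancel[OF P_polyfn P_polyfn polyfn_tdet])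
  show "tdet x * f x = tdet x * g x" for x using assms(3)[of x] by auto
  show "tdet stdpt \<noteq> (0::'k)" by (simp add: tdet_def stdpt_def dot_def)
qed (use assms in simp_all)

section \<open>Exactness of the two resolutions\<close>

subsection \<open>Syzygies\<close>

definition setz :: "'k pt \<Rightarrow> 'k m3 \<Rightarrow> 'k pt" where
  "setz x z = (\<lambda>v. case v of T k p \<Rightarrow> x (T k p) | Z i j \<Rightarrow> z i j)"

lemma vv_setz [simp]: "vv (setz x z) = vv x"
  by (rule ext, rule ix_eqI) (simp_all add: setz_def)

text \<open>Coefficients in \<open>P\<close> ignore \<open>z\<close>, so a relation among the
  generators can be tested at any \<open>z\<close> while the vectors stay fixed.\<close>

lemma P_setz: "p \<in> P \<Longrightarrow> p (setz x z) = (p x :: 'k::comm_ring_1)"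
  unfolding P_def by (induction rule: alg.induct) (auto simp: trp_dot)

lemma bil_setz:
  "bil (setz x (\<lambda>i j. w i * w' j)) a b
   = (dot a w * dot b w' + dot a w' * dot b w) / 2 - dot w w' / 3 * dot a b"
proof -
  have s: "sm (setz x (\<lambda>i j. w i * w' j)) i j
    = (w i * w' j + w j * w' i) / 2 - (if i = j then dot w w' / 3 else 0)" for i j
    by (simp add: sm_def setz_def dot_def)
  show ?thesis by (simp add: bil_def mv_def s dot_def field_simps)
qed

text \<open>The dual basis of the three vectors, scaled by \<open>tdet\<close> (see
  \<open>dot_vv_wv\<close>).\<close>

definition wv :: "'k::comm_ring_1 pt \<Rightarrow> ix \<Rightarrow> 'k vec" where
  "wv x i = (case i of I1 \<Rightarrow> cross (vv x I2) (vv x I3) | I2 \<Rightarrow> cross (vv x I3) (vv x I1)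
    | I3 \<Rightarrow> cross (vv x I1) (vv x I2))"

lemma wv_simps: "wv x I1 = cross (vv x I2) (vv x I3)" "wv x I2 = cross (vv x I3) (vv x I1)"
  "wv x I3 = cross (vv x I1) (vv x I2)"
  by (simp_all add: wv_def)

lemma wv_setz [simp]: "wv (setz x z) = wv x"
  by (rule ext) (simp add: wv_def split: ix.split)

lemma dot_vv_wv: "dot (vv x k) (wv x i) = (if k = i then tdet x else 0)"
  by (cases k; cases i; simp add: wv_def tdet_def dot_def; simp add: algebra_simps)

lemma dot_wv_vv: "dot (wv x i) (vv x k) = (if k = i then tdet x else 0)"
  by (subst dot_comm) (rule dot_vv_wv)

text \<open>Up to the factor \<open>tdet x\<close>, the Gram matrix expresses the vectors in the
  dual basis \<open>wv\<close>.\<close>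

lemma tdet_bil: "tdet x * bil x a (vv x k) = dot (vv x k) (vv x I1) * bil x a (wv x I1)
  + (dot (vv x k) (vv x I2) * bil x a (wv x I2) + dot (vv x k) (vv x I3) * bil x a (wv x I3))"
  unfolding tdet_def wv_simps using bil_det[of "vv x I1" "vv x I2" "vv x I3" x "vv x k" a]
  by (simp add: bil_sym[of x "vv x k" a])

lemma less_6: "(\<forall>i<6::nat. Q i) \<longleftrightarrow> Q 0 \<and> Q 1 \<and> Q 2 \<and> Q 3 \<and> Q 4 \<and> Q 5"
proof -
  have e: "{..<6::nat} = {0, 1, 2, 3, 4, 5}" by auto
  have "(\<forall>i<6::nat. Q i) \<longleftrightarrow> (\<forall>i\<in>{..<6}. Q i)" by (simp add: Ball_def)
  then show ?thesis unfolding e by simp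
qed

lemma less_8: "(\<forall>i<8::nat. Q i) \<longleftrightarrow> Q 0 \<and> Q 1 \<and> Q 2 \<and> Q 3 \<and> Q 4 \<and> Q 5 \<and> Q 6 \<and> Q 7"
proof -
  have e: "{..<8::nat} = {0, 1, 2, 3, 4, 5, 6, 7}" by auto
  have "(\<forall>i<8::nat. Q i) \<longleftrightarrow> (\<forall>i\<in>{..<8}. Q i)" by (simp add: Ball_def)
  then show ?thesis unfolding e by simp
qed

lemma less_3: "(\<forall>i<3::nat. Q i) \<longleftrightarrow> Q 0 \<and> Q 1 \<and> Q 2"
proof -
  have e: "{..<3::nat} = {0, 1, 2}" by auto
  have "(\<forall>i<3::nat. Q i) \<longleftrightarrow> (\<forall>i\<in>{..<3}. Q i)" by (simp add: Ball_def)
  then show ?thesis unfolding e by simp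
qed

lemma sum_6: "(\<Sum>i<6::nat. f i) = f 0 + f 1 + f 2 + f 3 + f 4 + f 5"
  and sum_8: "(\<Sum>i<8::nat. f i) = f 0 + f 1 + f 2 + f 3 + f 4 + f 5 + f 6 + f 7"
  and sum_3: "(\<Sum>i<3::nat. f i) = f 0 + f 1 + f 2"
  for f :: "nat \<Rightarrow> 'a::comm_monoid_add"
  by (simp_all add: numeral_eq_Suc)

lemma phi_E0: "phi E0 p x = p 0 x * e2 I1 I1 x + p 1 x * e2 I1 I2 x + p 2 x * e2 I1 I3 x
    + p 3 x * e2 I2 I2 x + p 4 x * e2 I2 I3 x + p 5 x * e2 I3 I3 x"
proof -
  have "length (E0 :: 'a fn list) = 6" by (simp add: E0_def)
  then show ?thesis unfolding phi_def by (simp only: sum_6) (simp add: E0_def)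
qed

text \<open>Everything is written in the nine values of \<open>s\<close> on pairs of a vector and a
  dual vector. The cyclic relation leaves the diagonal coefficients open up to a common shift; the
  choice here has sum zero.\<close>

lemma phi_E1: "phi E1 p x = 2 * ((p 7 x - p 6 x) * bil x (vv x I1) (wv x I1)
    - p 2 x * bil x (vv x I1) (wv x I2) + p 0 x * bil x (vv x I1) (wv x I3)
    + p 4 x * bil x (vv x I2) (wv x I1) - p 7 x * bil x (vv x I2) (wv x I2)
    - p 1 x * bil x (vv x I2) (wv x I3) - p 5 x * bil x (vv x I3) (wv x I1)
    + p 3 x * bil x (vv x I3) (wv x I2) + p 6 x * bil x (vv x I3) (wv x I3))"
proof -
  have "length (E1 :: 'a fn list) = 8" by (simp add: E1_def)
  then have "phi E1 p x = p 0 x * eiij I1 I2 x + p 1 x * eiij I2 I1 x + p 2 x * eiij I1 I3 x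
    + p 3 x * eiij I3 I1 x + p 4 x * eiij I2 I3 x + p 5 x * eiij I3 I2 x + p 6 x * e132 x + p 7 x * e123 x"
    unfolding phi_def by (simp only: sum_8) (simp add: E1_def)
  then show ?thesis unfolding E1_bil wv_simps cross_anti[of "vv x I3" "vv x I1"] bil_scale2
    by (simp add: algebra_simps)
qed

lemma psi0_simps:
  "psi0 0 x = (trp I2 I2 x * trp I3 I3 x - trp I2 I3 x * trp I2 I3 x) / 2"
  "psi0 1 x = trp I1 I3 x * trp I2 I3 x - trp I1 I2 x * trp I3 I3 x"
  "psi0 2 x = trp I1 I2 x * trp I2 I3 x - trp I1 I3 x * trp I2 I2 x"
  "psi0 3 x = (trp I1 I1 x * trp I3 I3 x - trp I1 I3 x * trp I1 I3 x) / 2"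
  "psi0 4 x = trp I1 I2 x * trp I1 I3 x - trp I1 I1 x * trp I2 I3 x"
  "psi0 5 x = (trp I1 I1 x * trp I2 I2 x - trp I1 I2 x * trp I1 I2 x) / 2"
  unfolding psi0_def by (simp_all add: power2_eq_square)

text \<open>The adjugate of the Gram matrix is, up to a factor, the Gram matrix of the cross
  products; off-diagonal entries count twice.\<close>

lemma psi0_wv:
  "psi0 0 x = 2 * dot (wv x I1) (wv x I1)" "psi0 1 x = 4 * dot (wv x I1) (wv x I2)"
  "psi0 2 x = 4 * dot (wv x I1) (wv x I3)" "psi0 3 x = 2 * dot (wv x I2) (wv x I2)"
  "psi0 4 x = 4 * dot (wv x I2) (wv x I3)" "psi0 5 x = 2 * dot (wv x I3) (wv x I3)"
  unfolding psi0_simps wv_simps dot_cross_cross trp_dot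
    dot_comm[of "vv x I2" "vv x I1"] dot_comm[of "vv x I3" "vv x I1"] dot_comm[of "vv x I3" "vv x I2"]
  by (simp_all add: field_simps)

lemma P_psi0: "\<forall>i<6. psi0 i \<in> P"
proof -
  have h: "(\<lambda>x. f x / 2) \<in> P" if "f \<in> P" for f :: "'a fn"
    using P_mult[OF P_const[of "1/2"] that] by simp
  show ?thesis unfolding less_6 psi0_simps[abs_def]
    by (intro conjI h P_diff P_mult P_trp)
qed

text \<open>Contracting the Gram matrix of the dual vectors with the vectors gives
  \<open>tdet\<close> times the dual vectors. The relation is therefore \<open>2 * tdet x\<close>
  times the cyclic sum, which vanishes because \<open>s\<close> has trace 0.\<close>

lemma psi0_syzygy: "phi E0 psi0 x = 0"
proof -
  have d: "tdet x * a i = dot a (wv x I1) * vv x I1 i + (dot a (wv x I2) * vv x I2 i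
     + dot a (wv x I3) * vv x I3 i)" for a i
    by (cases i; simp add: tdet_def dot_def wv_simps; simp add: algebra_simps)
  have b: "tdet x * bil x c a = dot a (wv x I1) * bil x c (vv x I1) + (dot a (wv x I2) * bil x c (vv x I2)
     + dot a (wv x I3) * bil x c (vv x I3))" for a c
    unfolding bil_scale2[symmetric] bil_add2[symmetric] d ..
  have cyc: "bil x (vv x I1) (wv x I1) + bil x (vv x I2) (wv x I2) + bil x (vv x I3) (wv x I3) = 0"
    unfolding wv_simps by (rule bil_cyc)
  have "phi E0 psi0 x = 2 * (tdet x * bil x (vv x I1) (wv x I1)
    + (tdet x * bil x (vv x I2) (wv x I2) + tdet x * bil x (vv x I3) (wv x I3)))"
    unfolding phi_E0 psi0_wv e2_bil b
      dot_comm[of "wv x I2" "wv x I1"] dot_comm[of "wv x I3" "wv x I1"] dot_comm[of "wv x I3" "wv x I2"]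
      bil_sym[of x "vv x I2" "vv x I1"] bil_sym[of x "vv x I3" "vv x I1"] bil_sym[of x "vv x I3" "vv x I2"]
    by (simp add: algebra_simps)
  also have "\<dots> = 2 * tdet x * (bil x (vv x I1) (wv x I1) + bil x (vv x I2) (wv x I2) + bil x (vv x I3) (wv x I3))"
    by (simp add: algebra_simps)
  finally show ?thesis unfolding cyc by simp
qed

lemma sum_minus_scaled:
  fixes m :: "'k::comm_ring_1"
  assumes "p0 * (a0 - m * c0) + p1 * (a1 - m * c1) + p2 * (a2 - m * c2) + p3 * (a3 - m * c3)
     + p4 * (a4 - m * c4) + p5 * (a5 - m * c5) = 0"
  shows "p0 * a0 + p1 * a1 + p2 * a2 + p3 * a3 + p4 * a4 + p5 * a5
     = m * (p0 * c0 + p1 * c1 + p2 * c2 + p3 * c3 + p4 * c4 + p5 * c5)"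
  using assms by (simp add: algebra_simps)

text \<open>Taking \<open>z\<close> as the product of two dual vectors \<open>w_i\<close>,
  \<open>w_j\<close> singles out the coefficient of \<open>e_ij\<close>. Only the trace correction
  remains, proportional to the dot product of \<open>w_i\<close> and \<open>w_j\<close> and thus to
  an entry of \<open>psi0\<close>.\<close>

lemma ker_E0_proportional:
  fixes p :: "nat \<Rightarrow> 'k::field_char_0 fn"
  assumes p: "p \<in> Pvec 6" and z: "phi E0 p = (\<lambda>x. 0)" and d: "tdet x \<noteq> 0"
  shows "\<exists>\<tau>. \<forall>k<6. p k x = psi0 k x * \<tau>"
proof -
  have ps: "p 0 (setz x z) = p 0 x" "p 1 (setz x z) = p 1 x" "p 2 (setz x z) = p 2 x"
    "p 3 (setz x z) = p 3 x" "p 4 (setz x z) = p 4 x" "p 5 (setz x z) = p 5 x" for z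
    using p[unfolded Pvec_def mem_Collect_eq less_6] by (simp_all add: P_setz)
  \<comment> \<open>This sum arises from the trace correction and is the same for all pairs of dual
    vectors.\<close>
  define \<sigma> where "\<sigma> = p 0 x * dot (vv x I1) (vv x I1) + p 1 x * dot (vv x I1) (vv x I2)
    + p 2 x * dot (vv x I1) (vv x I3) + p 3 x * dot (vv x I2) (vv x I2)
    + p 4 x * dot (vv x I2) (vv x I3) + p 5 x * dot (vv x I3) (vv x I3)"
  have "phi E0 p (setz x (\<lambda>k l. wv x i k * wv x j l)) = 0" for i j using z by simp
  note e = this[unfolded phi_E0 e2_bil ps vv_setz bil_setz dot_vv_wv, THEN sum_minus_scaled,
      folded \<sigma>_def]
  have g: "p k x = psi0 k x * (\<sigma> / (6 * (tdet x * tdet x)))"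
    if "p k x * (tdet x * tdet x) * 6 = psi0 k x * \<sigma>" for k
    using that d by (simp add: field_simps)
  have 0: "p 0 x * (tdet x * tdet x) * 6 = psi0 0 x * \<sigma>"
    unfolding psi0_wv using e[of I1 I1] by (simp add: field_simps)
  have 1: "p 1 x * (tdet x * tdet x) * 6 = psi0 1 x * \<sigma>"
    unfolding psi0_wv using e[of I1 I2] by (simp add: field_simps)
  have 2: "p 2 x * (tdet x * tdet x) * 6 = psi0 2 x * \<sigma>"
    unfolding psi0_wv using e[of I1 I3] by (simp add: field_simps)
  have 3: "p 3 x * (tdet x * tdet x) * 6 = psi0 3 x * \<sigma>"
    unfolding psi0_wv using e[of I2 I2] by (simp add: field_simps)
  have 4: "p 4 x * (tdet x * tdet x) * 6 = psi0 4 x * \<sigma>"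
    unfolding psi0_wv using e[of I2 I3] by (simp add: field_simps)
  have 5: "p 5 x * (tdet x * tdet x) * 6 = psi0 5 x * \<sigma>"
    unfolding psi0_wv using e[of I3 I3] by (simp add: field_simps)
  show ?thesis unfolding less_6
    by (intro exI conjI) (rule g[OF 0] g[OF 1] g[OF 2] g[OF 3] g[OF 4] g[OF 5])+
qed

lemma exact_E0:
  fixes p :: "nat \<Rightarrow> 'k::field_char_0 fn"
  assumes p: "p \<in> Pvec 6"
  shows "phi E0 p = (\<lambda>x. 0) \<longleftrightarrow> (\<exists>q\<in>P. \<forall>i<6. p i = (\<lambda>x. q x * psi0 i x))"
proof
  assume z: "phi E0 p = (\<lambda>x. 0)"
  have pP: "p k \<in> P" if "k < 6" for k using p that by (simp add: Pvec_def)
  have psP: "psi0 k \<in> (P :: 'k fn set)" if "k < 6" for k by (rule P_psi0[rule_format, OF that])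
  \<comment> \<open>Cross multiplication eliminates the factor that depends on the point, so the
    equations become identities in \<open>P\<close>.\<close>
  have cross: "p i x * psi0 j x = p j x * psi0 i x" if ij: "i < 6" "j < 6" for i j x
  proof -
    have "(\<lambda>x. p i x * psi0 j x) = (\<lambda>x. p j x * psi0 i x)"
    proof (rule tdet_cancel)
      fix x assume "tdet x \<noteq> (0::'k)"
      from ker_E0_proportional[OF p z this] obtain t where "\<forall>k<6. p k x = psi0 k x * t" by blast
      with ij show "p i x * psi0 j x = p j x * psi0 i x" by simp
    qed (intro P_mult pP psP ij)+
    then show ?thesis by (rule fun_cong)
  qed
  have p03: "p 0 \<in> P" "p 3 \<in> P" by (simp_all add: pP)
  have "p 0 x * (trp I1 I1 x * trp I3 I3 x - trp I1 I3 x * trp I1 I3 x)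
      = p 3 x * (trp I2 I2 x * trp I3 I3 x - trp I2 I3 x * trp I2 I3 x)" for x
    using cross[of 0 3 x] unfolding psi0_simps by simp
  from P_coprime_minors[OF p03 this] obtain r where r: "r \<in> P"
    "\<And>x. p 0 x = r x * (trp I2 I2 x * trp I3 I3 x - trp I2 I3 x * trp I2 I3 x)" by blast
  \<comment> \<open>The factor 2 compensates that \<open>psi0 0\<close> is half of the
    minor.\<close>
  have q: "(\<lambda>x. 2 * r x) \<in> P" by (intro P_mult P_const r)
  have pq: "p i = (\<lambda>x. (2 * r x) * psi0 i x)" if i: "i < 6" for i
  proof (rule P_cancel[OF pP[OF i] P_mult[OF q psP[OF i]] psP[of 0]])
    fix x
    have "psi0 0 x * p i x = p 0 x * psi0 i x" using cross[OF i, of 0 x] by (simp add: mult.commute)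
    also have "p 0 x = psi0 0 x * (2 * r x)" unfolding r(2) psi0_simps by simp
    finally show "psi0 0 x * p i x = psi0 0 x * (2 * r x * psi0 i x)" by (simp only: mult.assoc)
    show "psi0 0 stdpt \<noteq> (0::'k)" by (simp add: psi0_simps stdpt_trp)
  qed simp
  show "\<exists>q\<in>P. \<forall>i<6. p i = (\<lambda>x. q x * psi0 i x)"
    by (intro bexI[OF _ q] allI impI) (rule pq)
next
  assume "\<exists>q\<in>P. \<forall>i<6. p i = (\<lambda>x. q x * psi0 i x)"
  then obtain q where q: "\<forall>i<6. p i = (\<lambda>x. q x * psi0 i x)" by blast
  have "phi E0 p x = q x * phi E0 psi0 x" for x
    using q unfolding less_6 phi_E0 by (simp add: algebra_simps)
  then show "phi E0 p = (\<lambda>x. 0)" by (simp add: psi0_syzygy fun_eq_iff)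
qed

lemma psi0_inj:
  fixes q :: "'k::field_char_0 fn"
  assumes "q \<in> P" "\<forall>i<6. (\<lambda>x. q x * psi0 i x) = (\<lambda>x. 0)"
  shows "q = (\<lambda>x. 0)"
proof (rule P_cancel[OF assms(1) P_const, of "psi0 0"])
  show "psi0 0 \<in> (P :: 'k fn set)" by (rule P_psi0[rule_format]) simp
  show "psi0 0 x * q x = psi0 0 x * 0" for x
    using assms(2) by (auto simp: fun_eq_iff dest!: spec[of _ 0])
  show "psi0 0 stdpt \<noteq> (0::'k)" by (simp add: psi0_simps stdpt_trp)
qed

lemma psi1_simps:
  "psi1 0 0 x = trp I2 I3 x" "psi1 0 1 x = 0" "psi1 0 2 x = - trp I3 I3 x"
  "psi1 1 0 x = trp I1 I3 x" "psi1 1 1 x = - trp I3 I3 x" "psi1 1 2 x = 0"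
  "psi1 2 0 x = - trp I2 I2 x" "psi1 2 1 x = 0" "psi1 2 2 x = trp I2 I3 x"
  "psi1 3 0 x = 0" "psi1 3 1 x = - trp I2 I2 x" "psi1 3 2 x = trp I1 I2 x"
  "psi1 4 0 x = - trp I1 I1 x" "psi1 4 1 x = trp I1 I3 x" "psi1 4 2 x = 0"
  "psi1 5 0 x = 0" "psi1 5 1 x = trp I1 I2 x" "psi1 5 2 x = - trp I1 I1 x"
  "psi1 6 0 x = 0" "psi1 6 1 x = - trp I2 I3 x" "psi1 6 2 x = trp I1 I3 x"
  "psi1 7 0 x = trp I1 I2 x" "psi1 7 1 x = - trp I2 I3 x" "psi1 7 2 x = 0"
  unfolding psi1_def by simp_all

text \<open>Writing an element as \<open>\<Sum> c\<^sub>k\<^sub>l s(v\<^sub>k, w\<^sub>l)\<close> with the traceless matrix \<open>C\<close> read off from \<open>phi_E1\<close>,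
  evaluation at \<open>z = v\<^sub>i v\<^sub>j\<^sup>T\<close> shows that \<open>G C\<close> is skew-symmetric, where \<open>G\<close> is the Gram matrix.\<close>

lemma ker_E1_skew:
  fixes p :: "nat \<Rightarrow> 'k::field_char_0 fn"
  assumes p: "p \<in> Pvec 8" and z: "phi E1 p = (\<lambda>x. 0)" and d: "tdet x \<noteq> 0"
  shows "trp I1 I1 x * (p 7 x - p 6 x) + trp I1 I2 x * p 4 x - trp I1 I3 x * p 5 x = 0"
    "trp I2 I3 x * p 3 x - trp I1 I2 x * p 2 x - trp I2 I2 x * p 7 x = 0"
    "trp I1 I3 x * p 0 x - trp I2 I3 x * p 1 x + trp I3 I3 x * p 6 x = 0"
    "trp I1 I3 x * p 3 x - trp I1 I1 x * p 2 x - trp I1 I2 x * p 6 x + trp I2 I2 x * p 4 x - trp I2 I3 x * p 5 x = 0"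
    "trp I1 I1 x * p 0 x - trp I1 I2 x * p 1 x + trp I1 I3 x * p 7 x + trp I2 I3 x * p 4 x - trp I3 I3 x * p 5 x = 0"
    "trp I1 I2 x * p 0 x - trp I2 I2 x * p 1 x + trp I2 I3 x * p 6 x - trp I1 I3 x * p 2 x - trp I2 I3 x * p 7 x + trp I3 I3 x * p 3 x = 0"
proof -
  have ps: "p 0 (setz x z) = p 0 x" "p 1 (setz x z) = p 1 x" "p 2 (setz x z) = p 2 x"
    "p 3 (setz x z) = p 3 x" "p 4 (setz x z) = p 4 x" "p 5 (setz x z) = p 5 x"
    "p 6 (setz x z) = p 6 x" "p 7 (setz x z) = p 7 x" for z
    using p[unfolded Pvec_def mem_Collect_eq less_8] by (simp_all add: P_setz)
  have z0: "phi E1 p (setz x (\<lambda>k l. vv x i k * vv x j l)) = 0" for i j using z by simp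
  define g where "g i j = dot (vv x i) (vv x j)" for i j
  have gs: "g I2 I1 = g I1 I2" "g I3 I1 = g I1 I3" "g I3 I2 = g I2 I3"
    unfolding g_def by (rule dot_comm)+
  have b: "bil (setz x (\<lambda>k l. vv x i k * vv x j l)) (vv x k) (wv x l)
    = tdet x * ((g k i * (if j = l then 1 else 0) + g k j * (if i = l then 1 else 0)) / 2
        - g i j / 3 * (if k = l then 1 else 0))" for i j k l
    unfolding bil_setz dot_vv_wv dot_wv_vv g_def[symmetric] by (simp add: algebra_simps)
  \<comment> \<open>Each term carries the factor \<open>tdet x\<close>, which is cancelled here; the
    factor -2 converts dot products into traces.\<close>
  have scale: "f = 0" if "2 * ((c1 * (tdet x * a1) - c2 * (tdet x * a2) + c3 * (tdet x * a3)
     + c4 * (tdet x * a4) - c5 * (tdet x * a5) - c6 * (tdet x * a6)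
     - c7 * (tdet x * a7) + c8 * (tdet x * a8) + c9 * (tdet x * a9))) = 0"
     "f = - 2 * (c1 * a1 - c2 * a2 + c3 * a3 + c4 * a4 - c5 * a5 - c6 * a6 - c7 * a7 + c8 * a8 + c9 * a9)"
     for c1 c2 c3 c4 c5 c6 c7 c8 c9 a1 a2 a3 a4 a5 a6 a7 a8 a9 f
  proof -
    have "tdet x * (c1 * a1 - c2 * a2 + c3 * a3 + c4 * a4 - c5 * a5 - c6 * a6 - c7 * a7 + c8 * a8 + c9 * a9) = 0"
      using that(1)[unfolded mult_eq_0_iff, simplified] by (simp add: algebra_simps)
    with d have "c1 * a1 - c2 * a2 + c3 * a3 + c4 * a4 - c5 * a5 - c6 * a6 - c7 * a7 + c8 * a8 + c9 * a9 = 0"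
      by simp
    then show ?thesis unfolding that(2) by (simp only: mult_zero_right)
  qed
  note e = z0[unfolded phi_E1 ps vv_setz wv_setz b]
  have t: "trp i j x = - 2 * g i j" for i j by (simp add: trp_dot g_def)
  show "trp I1 I1 x * (p 7 x - p 6 x) + trp I1 I2 x * p 4 x - trp I1 I3 x * p 5 x = 0"
    by (rule scale[OF e[of I1 I1]]) (simp add: t gs; simp add: field_simps)
  show "trp I2 I3 x * p 3 x - trp I1 I2 x * p 2 x - trp I2 I2 x * p 7 x = 0"
    by (rule scale[OF e[of I2 I2]]) (simp add: t gs; simp add: field_simps)
  show "trp I1 I3 x * p 0 x - trp I2 I3 x * p 1 x + trp I3 I3 x * p 6 x = 0"
    by (rule scale[OF e[of I3 I3]]) (simp add: t gs; simp add: field_simps)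
  have "(trp I1 I3 x * p 3 x - trp I1 I1 x * p 2 x - trp I1 I2 x * p 6 x + trp I2 I2 x * p 4 x - trp I2 I3 x * p 5 x) / 2 = 0"
    by (rule scale[OF e[of I1 I2]]) (simp add: t gs; simp add: field_simps)
  then show "trp I1 I3 x * p 3 x - trp I1 I1 x * p 2 x - trp I1 I2 x * p 6 x + trp I2 I2 x * p 4 x - trp I2 I3 x * p 5 x = 0" by simp
  have "(trp I1 I1 x * p 0 x - trp I1 I2 x * p 1 x + trp I1 I3 x * p 7 x + trp I2 I3 x * p 4 x - trp I3 I3 x * p 5 x) / 2 = 0"
    by (rule scale[OF e[of I1 I3]]) (simp add: t gs; simp add: field_simps)
  then show "trp I1 I1 x * p 0 x - trp I1 I2 x * p 1 x + trp I1 I3 x * p 7 x + trp I2 I3 x * p 4 x - trp I3 I3 x * p 5 x = 0" by simp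
  have "(trp I1 I2 x * p 0 x - trp I2 I2 x * p 1 x + trp I2 I3 x * p 6 x - trp I1 I3 x * p 2 x - trp I2 I3 x * p 7 x + trp I3 I3 x * p 3 x) / 2 = 0"
    by (rule scale[OF e[of I2 I3]]) (simp add: t gs; simp add: field_simps)
  then show "trp I1 I2 x * p 0 x - trp I2 I2 x * p 1 x + trp I2 I3 x * p 6 x - trp I1 I3 x * p 2 x - trp I2 I3 x * p 7 x + trp I3 I3 x * p 3 x = 0" by simp
qed

text \<open>Coprime minors first yield the coefficient \<open>q0\<close> of the first column of
  \<open>psi1\<close>, then coprime Gram entries yield the other two. The remaining components
  follow from the skewness equations by cancelling \<open>trp I3 I3\<close> or a minor.\<close>

lemma ker_E1_subset_im:
  fixes p :: "nat \<Rightarrow> 'k::field_char_0 fn"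
  assumes p: "p \<in> Pvec 8" and z: "phi E1 p = (\<lambda>x. 0)"
  shows "\<exists>q\<in>Pvec 3. \<forall>i<8. p i = (\<lambda>x. \<Sum>j<3. psi1 i j x * q j x)"
proof -
  have pP: "p 0 \<in> P" "p 1 \<in> P" "p 2 \<in> P" "p 3 \<in> P" "p 4 \<in> P" "p 5 \<in> P" "p 6 \<in> P" "p 7 \<in> P"
    using p[unfolded Pvec_def mem_Collect_eq less_8] by blast+
  note cl = P_add P_diff P_mult P_neg P_trp pP
  \<comment> \<open>The six skewness equations are extended from points with nonzero determinant to
    all points.\<close>
  have "(\<lambda>x. trp I1 I1 x * (p 7 x - p 6 x) + trp I1 I2 x * p 4 x - trp I1 I3 x * p 5 x) = (\<lambda>x. 0)"
    by (rule tdet_cancel) (intro cl, rule P_const, rule ker_E1_skew[OF p z])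
  then have K11: "trp I1 I1 x * (p 7 x - p 6 x) + trp I1 I2 x * p 4 x - trp I1 I3 x * p 5 x = 0" for x by (rule fun_cong)
  have "(\<lambda>x. trp I2 I3 x * p 3 x - trp I1 I2 x * p 2 x - trp I2 I2 x * p 7 x) = (\<lambda>x. 0)"
    by (rule tdet_cancel) (intro cl, rule P_const, rule ker_E1_skew[OF p z])
  then have K22: "trp I2 I3 x * p 3 x - trp I1 I2 x * p 2 x - trp I2 I2 x * p 7 x = 0" for x by (rule fun_cong)
  have "(\<lambda>x. trp I1 I3 x * p 0 x - trp I2 I3 x * p 1 x + trp I3 I3 x * p 6 x) = (\<lambda>x. 0)"
    by (rule tdet_cancel) (intro cl, rule P_const, rule ker_E1_skew[OF p z])
  then have K33: "trp I1 I3 x * p 0 x - trp I2 I3 x * p 1 x + trp I3 I3 x * p 6 x = 0" for x by (rule fun_cong)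
  have "(\<lambda>x. trp I1 I3 x * p 3 x - trp I1 I1 x * p 2 x - trp I1 I2 x * p 6 x + trp I2 I2 x * p 4 x - trp I2 I3 x * p 5 x) = (\<lambda>x. 0)"
    by (rule tdet_cancel) (intro cl, rule P_const, rule ker_E1_skew[OF p z])
  then have K12: "trp I1 I3 x * p 3 x - trp I1 I1 x * p 2 x - trp I1 I2 x * p 6 x + trp I2 I2 x * p 4 x - trp I2 I3 x * p 5 x = 0" for x by (rule fun_cong)
  have "(\<lambda>x. trp I1 I1 x * p 0 x - trp I1 I2 x * p 1 x + trp I1 I3 x * p 7 x + trp I2 I3 x * p 4 x - trp I3 I3 x * p 5 x) = (\<lambda>x. 0)"
    by (rule tdet_cancel) (intro cl, rule P_const, rule ker_E1_skew[OF p z])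
  then have K13: "trp I1 I1 x * p 0 x - trp I1 I2 x * p 1 x + trp I1 I3 x * p 7 x + trp I2 I3 x * p 4 x - trp I3 I3 x * p 5 x = 0" for x by (rule fun_cong)
  have "(\<lambda>x. trp I1 I2 x * p 0 x - trp I2 I2 x * p 1 x + trp I2 I3 x * p 6 x - trp I1 I3 x * p 2 x - trp I2 I3 x * p 7 x + trp I3 I3 x * p 3 x) = (\<lambda>x. 0)"
    by (rule tdet_cancel) (intro cl, rule P_const, rule ker_E1_skew[OF p z])
  then have K23: "trp I1 I2 x * p 0 x - trp I2 I2 x * p 1 x + trp I2 I3 x * p 6 x - trp I1 I3 x * p 2 x - trp I2 I3 x * p 7 x + trp I3 I3 x * p 3 x = 0" for x by (rule fun_cong)
  let ?A = "\<lambda>x. trp I2 I2 x * trp I3 I3 x - trp I2 I3 x * trp I2 I3 x :: 'k"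
  let ?B = "\<lambda>x. trp I1 I1 x * trp I3 I3 x - trp I1 I3 x * trp I1 I3 x :: 'k"
  have PA: "?A \<in> P" and PB: "?B \<in> P" by (intro cl)+
  have A0: "?A stdpt \<noteq> 0" and B0: "?B stdpt \<noteq> 0" and t0: "trp I3 I3 stdpt \<noteq> (0::'k)"
    by (simp_all add: stdpt_trp)
  have "(p 0 x * trp I2 I3 x + p 2 x * trp I3 I3 x) * ?B x
      = (p 1 x * trp I1 I3 x + p 4 x * trp I3 I3 x) * ?A x" for x
  proof -
    \<comment> \<open>This combination of the equations 12, 23, 13 and 33 is chosen so that
      \<open>p 3\<close>, \<open>p 5\<close>, \<open>p 6\<close> and \<open>p 7\<close> drop
      out.\<close>
    have "(p 0 x * trp I2 I3 x + p 2 x * trp I3 I3 x) * ?B x - (p 1 x * trp I1 I3 x + p 4 x * trp I3 I3 x) * ?A x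
      = - (trp I3 I3 x * trp I3 I3 x) * (trp I1 I3 x * p 3 x - trp I1 I1 x * p 2 x - trp I1 I2 x * p 6 x + trp I2 I2 x * p 4 x - trp I2 I3 x * p 5 x)
      + trp I1 I3 x * trp I3 I3 x * (trp I1 I2 x * p 0 x - trp I2 I2 x * p 1 x + trp I2 I3 x * p 6 x - trp I1 I3 x * p 2 x - trp I2 I3 x * p 7 x + trp I3 I3 x * p 3 x)
      + trp I2 I3 x * trp I3 I3 x * (trp I1 I1 x * p 0 x - trp I1 I2 x * p 1 x + trp I1 I3 x * p 7 x + trp I2 I3 x * p 4 x - trp I3 I3 x * p 5 x)
      - (trp I1 I2 x * trp I3 I3 x + trp I1 I3 x * trp I2 I3 x) * (trp I1 I3 x * p 0 x - trp I2 I3 x * p 1 x + trp I3 I3 x * p 6 x)"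
      by (simp add: algebra_simps)
    then show ?thesis unfolding K12 K23 K13 K33 by simp
  qed
  note I = this
  have "(\<lambda>x. p 0 x * trp I2 I3 x + p 2 x * trp I3 I3 x) \<in> P"
    "(\<lambda>x. p 1 x * trp I1 I3 x + p 4 x * trp I3 I3 x) \<in> P" by (intro cl)+
  from P_coprime_minors[OF this I]
  obtain r where r: "r \<in> P" "\<And>x. p 0 x * trp I2 I3 x + p 2 x * trp I3 I3 x = r x * ?A x"
    by blast
  have r': "p 1 x * trp I1 I3 x + p 4 x * trp I3 I3 x = r x * ?B x" for x
  proof -
    have "(\<lambda>x. p 1 x * trp I1 I3 x + p 4 x * trp I3 I3 x) = (\<lambda>x. r x * ?B x)"
    proof (rule P_cancel[OF _ _ PA _ A0])
      show "?A x * (p 1 x * trp I1 I3 x + p 4 x * trp I3 I3 x) = ?A x * (r x * ?B x)" for x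
        using I[of x] unfolding r(2) by (simp only: mult_ac)
    qed (intro cl r)+
    then show ?thesis by (rule fun_cong)
  qed
  \<comment> \<open>The sign matches \<open>psi1\<close>, whose first and third rows give
    \<open>- q0\<close> times the minor.\<close>
  define q0 where "q0 = (\<lambda>x. - r x)"
  have q0: "q0 \<in> P" unfolding q0_def by (intro cl r)
  have q0a: "p 0 x * trp I2 I3 x + p 2 x * trp I3 I3 x = - q0 x * ?A x"
    and q0b: "p 1 x * trp I1 I3 x + p 4 x * trp I3 I3 x = - q0 x * ?B x" for x
    by (simp_all only: q0_def r r' minus_minus)
  have gv: "Z I3 I3 \<in> gvars" "Z I2 I3 \<in> gvars" "Z I1 I3 \<in> gvars" by (simp_all add: gvars_def)
  \<comment> \<open>Two distinct Gram entries are coprime, so the first factor is a multiple of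
    \<open>trp I3 I3\<close>; the quotient is the coefficient of the third column.\<close>
  have "(trp I2 I3 x * q0 x - p 0 x) * trp I2 I3 x = (p 2 x + trp I2 I2 x * q0 x) * trp I3 I3 x" for x
    using q0a[of x] by (simp add: algebra_simps)
  from P_coprime_trp[OF _ _ gv(1,2) _ this]
  obtain q2 where q2: "q2 \<in> P" "\<And>x. trp I2 I3 x * q0 x - p 0 x = q2 x * trp I3 I3 x"
    using P_diff[OF P_mult[OF P_trp q0] pP(1)] P_add[OF pP(3) P_mult[OF P_trp q0]] by fastforce
  have "(trp I1 I3 x * q0 x - p 1 x) * trp I1 I3 x = (p 4 x + trp I1 I1 x * q0 x) * trp I3 I3 x" for x
    using q0b[of x] by (simp add: algebra_simps)
  from P_coprime_trp[OF _ _ gv(1,3) _ this]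
  obtain q1 where q1: "q1 \<in> P" "\<And>x. trp I1 I3 x * q0 x - p 1 x = q1 x * trp I3 I3 x"
    using P_diff[OF P_mult[OF P_trp q0] pP(2)] P_add[OF pP(5) P_mult[OF P_trp q0]] by fastforce
  note Q = cl q0 q1(1) q2(1)
  have 0: "p 0 = (\<lambda>x. trp I2 I3 x * q0 x - trp I3 I3 x * q2 x)"
    using q2(2) by (auto simp: fun_eq_iff algebra_simps)
  have 1: "p 1 = (\<lambda>x. trp I1 I3 x * q0 x - trp I3 I3 x * q1 x)"
    using q1(2) by (auto simp: fun_eq_iff algebra_simps)
  note c33 = P_cancel[OF _ _ P_trp[of I3 I3] _ t0] and cA = P_cancel[OF _ _ PA _ A0]
  have 2: "p 2 = (\<lambda>x. trp I2 I3 x * q2 x - trp I2 I2 x * q0 x)"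
  proof (rule c33)
    show "trp I3 I3 x * p 2 x = trp I3 I3 x * (trp I2 I3 x * q2 x - trp I2 I2 x * q0 x)" for x
      using q0a[of x] unfolding fun_cong[OF 0] by (simp add: algebra_simps)
  qed (intro Q)+
  have 4: "p 4 = (\<lambda>x. trp I1 I3 x * q1 x - trp I1 I1 x * q0 x)"
  proof (rule c33)
    show "trp I3 I3 x * p 4 x = trp I3 I3 x * (trp I1 I3 x * q1 x - trp I1 I1 x * q0 x)" for x
      using q0b[of x] unfolding fun_cong[OF 1] by (simp add: algebra_simps)
  qed (intro Q)+
  have 6: "p 6 = (\<lambda>x. trp I1 I3 x * q2 x - trp I2 I3 x * q1 x)"
  proof (rule c33)
    show "trp I3 I3 x * p 6 x = trp I3 I3 x * (trp I1 I3 x * q2 x - trp I2 I3 x * q1 x)" for x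
      using K33[of x] unfolding fun_cong[OF 0] fun_cong[OF 1] by (simp add: algebra_simps)
  qed (intro Q)+
  note val = fun_cong[OF 0] fun_cong[OF 1] fun_cong[OF 2] fun_cong[OF 4] fun_cong[OF 6]
  \<comment> \<open>Here \<open>trp I2 I3\<close> times equation 23 minus \<open>trp I3 I3\<close>
    times equation 22 removes \<open>p 3\<close> and leaves \<open>p 7\<close> times the
    minor.\<close>
  have 7: "p 7 = (\<lambda>x. trp I1 I2 x * q0 x - trp I2 I3 x * q1 x)"
  proof (rule cA)
    show "?A x * p 7 x = ?A x * (trp I1 I2 x * q0 x - trp I2 I3 x * q1 x)" for x
    proof -
      have "?A x * p 7 x - ?A x * (trp I1 I2 x * q0 x - trp I2 I3 x * q1 x)
        = trp I2 I3 x * (trp I1 I2 x * p 0 x - trp I2 I2 x * p 1 x + trp I2 I3 x * p 6 x - trp I1 I3 x * p 2 x - trp I2 I3 x * p 7 x + trp I3 I3 x * p 3 x) - trp I3 I3 x * (trp I2 I3 x * p 3 x - trp I1 I2 x * p 2 x - trp I2 I2 x * p 7 x)"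
        unfolding val by (simp add: algebra_simps)
      then show ?thesis unfolding K22 K23 by simp
    qed
  qed (intro Q)+
  have 3: "p 3 = (\<lambda>x. trp I1 I2 x * q2 x - trp I2 I2 x * q1 x)"
  proof (rule c33)
    show "trp I3 I3 x * p 3 x = trp I3 I3 x * (trp I1 I2 x * q2 x - trp I2 I2 x * q1 x)" for x
      using K23[of x] unfolding val fun_cong[OF 7] by (simp add: algebra_simps)
  qed (intro Q)+
  have 5: "p 5 = (\<lambda>x. trp I1 I2 x * q1 x - trp I1 I1 x * q2 x)"
  proof (rule c33)
    show "trp I3 I3 x * p 5 x = trp I3 I3 x * (trp I1 I2 x * q1 x - trp I1 I1 x * q2 x)" for x
      using K13[of x] unfolding val fun_cong[OF 7] by (simp add: algebra_simps)
  qed (intro Q)+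
  show ?thesis
  proof (rule bexI)
    let ?q = "\<lambda>j::nat. if j = 0 then q0 else if j = 1 then q1 else q2"
    show "?q \<in> Pvec 3" using q0 q1 q2 by (simp add: Pvec_def)
    show "\<forall>i<8. p i = (\<lambda>x. \<Sum>j<3. psi1 i j x * ?q j x)"
      unfolding less_8 sum_3 psi1_simps 0 1 2 3 4 5 6 7 by (simp add: fun_eq_iff)
  qed
qed

text \<open>Each column of \<open>psi1\<close> produces a difference \<open>T k l - T l k\<close>.
  Since \<open>T k l\<close> is a multiple of \<open>s\<close> on two of the vectors, the symmetry
  of \<open>s\<close> makes it vanish.\<close>

lemma psi1_syzygy:
  fixes p :: "nat \<Rightarrow> 'k::field_char_0 fn"
  assumes "\<forall>i<8. p i = (\<lambda>x. \<Sum>j<3. psi1 i j x * q j x)"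
  shows "phi E1 p = (\<lambda>x. 0)"
proof
  fix x :: "'k pt"
  define T where "T k l = trp k I1 x * bil x (vv x l) (wv x I1)
    + (trp k I2 x * bil x (vv x l) (wv x I2) + trp k I3 x * bil x (vv x l) (wv x I3))" for k l
  have T: "T k l = - 2 * tdet x * bil x (vv x l) (vv x k)" for k l
  proof -
    have "T k l = - 2 * (tdet x * bil x (vv x l) (vv x k))"
      unfolding T_def trp_dot tdet_bil by (simp add: algebra_simps)
    then show ?thesis by simp
  qed
  have sym: "T k l = T l k" for k l unfolding T by (simp add: bil_sym)
  have "phi E1 p x = 2 * (q 0 x * (T I2 I1 - T I1 I2) + q 1 x * (T I3 I2 - T I2 I3) + q 2 x * (T I1 I3 - T I3 I1))"
    using assms unfolding less_8 sum_3 psi1_simps phi_E1 T_def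
      trp_comm[of I2 I1] trp_comm[of I3 I1] trp_comm[of I3 I2]
    by (simp add: algebra_simps)
  then show "phi E1 p x = 0" by (simp add: sym[of I2 I1] sym[of I3 I2] sym[of I3 I1])
qed

lemma psi1_inj:
  fixes q :: "nat \<Rightarrow> 'k::field_char_0 fn"
  assumes q: "q \<in> Pvec 3" and z: "\<forall>i<8. (\<lambda>x. \<Sum>j<3. psi1 i j x * q j x) = (\<lambda>x. 0)"
  shows "\<forall>j<3. q j = (\<lambda>x. 0)"
proof -
  have qP: "q 0 \<in> P" "q 1 \<in> P" "q 2 \<in> P" using q[unfolded Pvec_def mem_Collect_eq less_3] by blast+
  let ?A = "\<lambda>x. trp I2 I2 x * trp I3 I3 x - trp I2 I3 x * trp I2 I3 x :: 'k"
  have PA: "?A \<in> P" by (intro P_diff P_mult P_trp)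
  have A0: "?A stdpt \<noteq> 0" and t0: "trp I3 I3 stdpt \<noteq> (0::'k)" by (simp_all add: stdpt_trp)
  have e: "(\<Sum>j<3. psi1 i j x * q j x) = 0" if "i < 8" for i x using z that by meson
  note e' = e[of 0] e[of 1] e[of 2]
  note e'' = e'[unfolded sum_3 psi1_simps, simplified]
  have 0: "q 0 = (\<lambda>x. 0)"
  proof (rule P_cancel[OF qP(1) P_const PA _ A0])
    \<comment> \<open>The first and third rows form a 2 by 2 system for \<open>q 0\<close> and
      \<open>q 2\<close> with determinant minus the minor.\<close>
    show "?A x * q 0 x = ?A x * 0" for x using e''(1)[of x] e''(3)[of x] by algebra
  qed
  have 1: "q 1 = (\<lambda>x. 0)"
    by (rule P_cancel[OF qP(2) P_const P_trp[of I3 I3] _ t0]) (use e''(2) 0 in simp)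
  have 2: "q 2 = (\<lambda>x. 0)"
    by (rule P_cancel[OF qP(3) P_const P_trp[of I3 I3] _ t0]) (use e''(1) 0 in simp)
  show ?thesis unfolding less_3 using 0 1 2 by blast
qed

theorem theorem5p5:
  fixes dummy :: "'k::field_char_0"
  shows
    \<comment> \<open>(i)\<close>
    "(C3 :: 'k fn set) = pspan (set E0 \<union> set E1) \<and>
     (C3 :: 'k fn set) = {(\<lambda>x. a x + b x) | a b. a \<in> C3_0 \<and> b \<in> C3_1} \<and>
     (C3_0 :: 'k fn set) \<inter> C3_1 = {(\<lambda>x. 0)} \<and>
    \<comment> \<open>(ii)\<close>
     phi E0 ` Pvec 6 = (C3_0 :: 'k fn set) \<and>
     (\<forall>p \<in> (Pvec 6 :: (nat \<Rightarrow> 'k fn) set).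
        phi E0 p = (\<lambda>x. 0) \<longleftrightarrow> (\<exists>q \<in> P. \<forall>i<6. p i = (\<lambda>x. q x * psi0 i x))) \<and>
     (\<forall>q \<in> (P :: 'k fn set). (\<forall>i<6. (\<lambda>x. q x * psi0 i x) = (\<lambda>x. 0)) \<longrightarrow> q = (\<lambda>x. 0)) \<and>
    \<comment> \<open>(iii)\<close>
     phi E1 ` Pvec 8 = (C3_1 :: 'k fn set) \<and>
     (\<forall>p \<in> (Pvec 8 :: (nat \<Rightarrow> 'k fn) set).
        phi E1 p = (\<lambda>x. 0) \<longleftrightarrow>
        (\<exists>q \<in> Pvec 3. \<forall>i<8. p i = (\<lambda>x. \<Sum>j<3. psi1 i j x * q j x))) \<and>
     (\<forall>q \<in> (Pvec 3 :: (nat \<Rightarrow> 'k fn) set).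
        (\<forall>i<8. (\<lambda>x. \<Sum>j<3. psi1 i j x * q j x) = (\<lambda>x. 0)) \<longrightarrow> (\<forall>j<3. q j = (\<lambda>x. 0)))"
proof (intro conjI ballI)
  show "(C3 :: 'k fn set) = pspan (set E0 \<union> set E1)" by (rule C3_eq)
  show "(C3 :: 'k fn set) = {(\<lambda>x. a x + b x) | a b. a \<in> C3_0 \<and> b \<in> C3_1}"
    unfolding C3_eq C3_0_eq C3_1_eq by (rule pspan_union)
  show "(C3_0 :: 'k fn set) \<inter> C3_1 = {(\<lambda>x. 0)}" by (rule C3_0_C3_1)
  show "phi E0 ` Pvec 6 = (C3_0 :: 'k fn set)"
  proof -
    have "length (E0 :: 'k fn list) = 6" by (simp add: E0_def)
    then show ?thesis unfolding C3_0_eq pspan_phi by simp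
  qed
  show "phi E1 ` Pvec 8 = (C3_1 :: 'k fn set)"
  proof -
    have "length (E1 :: 'k fn list) = 8" by (simp add: E1_def)
    then show ?thesis unfolding C3_1_eq pspan_phi by simp
  qed
  show "phi E0 p = (\<lambda>x. 0) \<longleftrightarrow> (\<exists>q \<in> P. \<forall>i<6. p i = (\<lambda>x. q x * psi0 i x))"
    if "p \<in> Pvec 6" for p :: "nat \<Rightarrow> 'k fn" using that by (rule exact_E0)
  show "(\<forall>i<6. (\<lambda>x. q x * psi0 i x) = (\<lambda>x. 0)) \<longrightarrow> q = (\<lambda>x. 0)" if "q \<in> P" for q :: "'k fn"
    using psi0_inj[OF that] by (rule impI)
  show "phi E1 p = (\<lambda>x. 0) \<longleftrightarrow> (\<exists>q \<in> Pvec 3. \<forall>i<8. p i = (\<lambda>x. \<Sum>j<3. psi1 i j x * q j x))"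
    if "p \<in> Pvec 8" for p :: "nat \<Rightarrow> 'k fn"
    using ker_E1_subset_im[OF that] psi1_syzygy by (intro iffI) blast+
  show "(\<forall>i<8. (\<lambda>x. \<Sum>j<3. psi1 i j x * q j x) = (\<lambda>x. 0)) \<longrightarrow> (\<forall>j<3. q j = (\<lambda>x. 0))"
    if "q \<in> Pvec 3" for q :: "nat \<Rightarrow> 'k fn"
    using psi1_inj[OF that] by (rule impI)
qed

end
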